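(* Suppose all the assumptions listed in the context hold. Let $N\ge 2$ and run Algorithm EC-SCGD with $\lambda_0=0$, $\tau_t=t/2$, $\alpha_t=\alpha=2\sqrt N$ and $\eta_t=\eta=\frac{15C_g^2\sqrt N}{2}$ for all $0\le t\le N$. Let $$R=\frac{7C_{f_1}^2C_{f_2}^2}{C_g^2}+\frac{D_X^2C_g^2}{2}+2\|\lambda^*\|^2+\frac{\sigma_g^2}{2}+L_{f_1}\sigma_{f_2}^2+3C_{f_1}\sigma_{f_2}+\|\lambda^*\|\sigma_g+\frac{15C_g^2}{4}\|x_0-x^*\|^2+\|\lambda_0-\lambda^*\|^2 .$$ Then $\bar x_N=\frac1N\sum_{t=1}^N x_t$ satisfies $$\mathbb E[F(\bar x_N)]-F(x^* )\le\frac1{\sqrt N}\Big(\frac{7C_{f_1}^2C_{f_2}^2}{C_g^2}+L_{f_1}\sigma_{f_2}^2+3C_{f_1}\sigma_{f_2}+\frac{15C_g^2}{4}\|x_0-x^*\|^2+\frac{4\|\lambda^*\|^2+8Re^2}{3}\Big)$$ and $$\mathbb E\big[\|g(\bar x_N)_+\|\big]\le\frac1{\sqrt N}\Big(\frac{7C_{f_1}^2C_{f_2}^2}{C_g^2}+L_{f_1}\sigma_{f_2}^2+3C_{f_1}\sigma_{f_2}+\frac{15C_g^2}{4}\|x_0-x^*\|^2+\frac{D_X^2C_g^2}{2}+\frac{\sigma_g^2}{2}\Big)+\frac{(2\|\lambda^*\|^2+4Re^2)+3(\|\lambda^*\|+1)^2+(\|\lambda^*\|+1)\sigma_g}{\sqrt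 N},$$ where $g(x)_+=\max\{g(x),0\}$ componentwise.
   Context: Problem. $\mathcal X\subset\mathbb R^{d_x}$ is convex; $\xi_1,\xi_2,\zeta=(\zeta_1,\dots,\zeta_m)$ are independent random vectors. Minimize $F(x)=f_1(f_2(x))$ over $x\in\mathcal X$ subject to $g^{(j)}(x)\le 0$, $j=1,\dots,m$, where $f_1(y)=\mathbb E[f_1(y,\xi_1)]:\mathbb R^{d_y}\to\mathbb R$ is convex and differentiable, $f_2(x)=\mathbb E[f_2(x,\xi_2)]:\mathbb R^{d_x}\to\mathbb R^{d_y}$ has convex components, $g^{(j)}(x)=\mathbb E[g^{(j)}(x,\zeta_j)]:\mathbb R^{d_x}\to\mathbb R$ is convex, and $F$ is convex. Write $g=(g^{(1)},\dots,g^{(m)})^\top$, $g(x,\zeta)=(g^{(1)}(x,\zeta_1),\dots,g^{(m)}(x,\zeta_m))^\top$. For vector-valued functions, $\partial$ denotes matrices whose $j$-th column is a subgradient of the $j$-th component (so $\partial f_2(x)\subset\mathbb R^{d_x\times d_y}$, $\partial g(x)\subset\mathbb R^{d_x\times m}$); $\partial f_2(x,\xi_2)$, $\partial g(x,\zeta)$, $\nabla f_1(y,\xi_1)$ denote the stochastic (sub)gradients returned by the sampling oracle. $\|\cdot\|$ is the Euclidean norm. Saddle point. There is $(x^*,\lambda^* )\in\mathcal X\times\mathbb R_+^m$ such that $\mathcal L(x,\lambda)=F(x)+\lambda^\top g(x)$ satisfies $\mathcal L(x^*,\lambda)\le\mathcal L(x^*,\lambda^* )\le\mathcal L(x,\lambda^*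 )$ for all $(x,\lambda)\in\mathcal X\times\mathbb R_+^m$. Assumptions, with positive constants $C_{f_1},C_{f_2},\sigma_{f_1},\sigma_{f_2},L_{f_1},D_X,C_g,\sigma_g$. On the objective: (a) $\mathcal X$ is convex and bounded, $\sup_{x\in\mathcal X}\|x-x^*\|\le D_X$. (b) $f_1,f_2$ are convex with $f_1(y)=\max_{\pi_1\in\Pi_1}\langle\pi_1,y\rangle-f_1^*(\pi_1)$ for $y\in\mathbb R^{d_y}$ and $f_2(x)=\max_{\pi_2\in\Pi_2}\pi_2^\top x-f_2^*(\pi_2)$ (componentwise) for $x\in\mathcal X$, where $f_1^*$ is the Fenchel conjugate, $f_2^*$ is the componentwise Fenchel conjugate ($j$-th component $=$ conjugate of $f_2^{(j)}$ at the $j$-th column of $\pi_2$), and $\Pi_1\subset\mathbb R^{d_y}$, $\Pi_2\subset\mathbb R^{d_x\times d_y}$ are their domains. (c) $\nabla f_1$ is $L_{f_1}$-Lipschitz. (d) $\mathbb E[f_2(x,\xi_2)]=f_2(x)$, $\mathbb E\|f_2(x,\xi_2)-f_2(x)\|^2=\sigma_{f_2}^2$ for all $x\in\mathcal X$. (e) $\mathbb E[f_1(y,\xi_1)]=f_1(y)$, $\mathbb E(f_1(y,\xi_1)-f_1(y))^2=\sigma_{f_1}^2$ for all $y$. (f) $\mathbb E[\partial f_2(x,\xi_2)]\in\partial f_2(x)$, $\mathbb E\|\partial f_2(x,\xi_2)\|^2\le C_{f_2}^2$ for all $x\in\mathcal X$. (g) $\mathbb E[\nabla f_1(y,\xi_1)]=\nabla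 f_1(y)$, $\mathbb E\|\nabla f_1(y,\xi_1)\|^2\le C_{f_1}^2$ for all $y$. On the constraints: each $g^{(j)}$ is convex with $g^{(j)}(x)=\max_{v\in V^{(j)}}\langle x,v\rangle-[g^{(j)}]^*(v)$ for $x\in\mathcal X$, $V^{(j)}\subset\mathbb R^{d_x}$ the domain of $[g^{(j)}]^*$; and for all $x\in\mathcal X$: $\mathbb E[g(x,\zeta)]=g(x)$, $\mathbb E\|g(x,\zeta)-g(x)\|^2\le\sigma_g^2$, $\mathbb E[\partial g(x,\zeta)]\in\partial g(x)$, $\mathbb E\|\partial g(x,\zeta)\|^2\le C_g^2$. Monotonicity: if $f_2$ is not affine then $\nabla f_1(y)\ge0$ componentwise for all $y\in\mathbb R^{d_y}$. Algorithm EC-SCGD. Given step-sizes $\alpha_t,\eta_t,\tau_t$, $x_0\in\mathcal X$, $y_0=0$, $\lambda_0\in\mathbb R_+^m$, for $t=0,\dots,N-1$: $y_{t+1}=\frac{f_2(x_t,\xi_{2,t}^1)+\tau_ty_t}{1+\tau_t}$; $x_{t+1}=\mathrm{Proj}_{\mathcal X}\big[x_t-\frac1{\eta_t}\big(\partial f_2(x_t,\xi_{2,t}^0)\nabla f_1(y_{t+1},\xi_{1,t}^0)+\partial g(x_t,\zeta_t^0)\lambda_t\big)\big]$; $\lambda_{t+1}=[\lambda_t+g(x_t,\zeta_t^1)/\alpha_t]_+$. All samples $\xi_{1,t}^0,\xi_{2,t}^0,\xi_{2,t}^1,\zeta_t^0,\zeta_t^1$ over all $t$ are mutually independent copies of $\xi_1,\xi_2,\zeta$.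 *)

theory Defs
  imports "HOL-Probability.Probability"
begin

definition subdifferential :: "('a::real_inner \<Rightarrow> real) \<Rightarrow> 'a \<Rightarrow> 'a set" where
  "subdifferential f x = {v. \<forall>y. f x + v \<bullet> (y - x) \<le> f y}"

definition subgradient_matrices ::
    "(real^'n \<Rightarrow> real^'k) \<Rightarrow> real^'n \<Rightarrow> (real^'k^'n) set" where
  "subgradient_matrices f x = {A. \<forall>j. column j A \<in> subdifferential (\<lambda>z. f z $ j) x}"

text \<open>The conjugate takes values in the extended reals; its effective domain is
  \<open>fenchel_domain\<close>, and the real-valued \<open>fenchel_conjugate\<close> is meaningful only there.\<close>

definition fenchel_domain :: "('a::real_inner \<Rightarrow> real) \<Rightarrow> 'a set" where
  "fenchel_domain f = {v. bdd_above (range (\<lambda>x. v \<bullet> x - f x))}"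

definition fenchel_conjugate :: "('a::real_inner \<Rightarrow> real) \<Rightarrow> 'a \<Rightarrow> real" where
  "fenchel_conjugate f v = (SUP x. v \<bullet> x - f x)"

definition fenchel_domain_matrices :: "(real^'n \<Rightarrow> real^'k) \<Rightarrow> (real^'k^'n) set" where
  "fenchel_domain_matrices f = {A. \<forall>j. column j A \<in> fenchel_domain (\<lambda>x. f x $ j)}"

definition fenchel_conjugate_vec :: "(real^'n \<Rightarrow> real^'k) \<Rightarrow> real^'k^'n \<Rightarrow> real^'k" where
  "fenchel_conjugate_vec f A = (\<chi> j. fenchel_conjugate (\<lambda>x. f x $ j) (column j A))"

text \<open>The maximum of \<open>h\<close> over \<open>S\<close> is attained and equals \<open>c\<close>.\<close>

definition is_max_value :: "('a \<Rightarrow> real) \<Rightarrow> 'a set \<Rightarrow> real \<Rightarrow> bool" where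
  "is_max_value h S c \<longleftrightarrow> (\<exists>s. is_arg_max h (\<lambda>s. s \<in> S) s \<and> h s = c)"

definition affine_map :: "('a::real_vector \<Rightarrow> 'b::real_vector) \<Rightarrow> bool" where
  "affine_map f \<longleftrightarrow> (\<exists>h c. linear h \<and> f = (\<lambda>x. h x + c))"

definition pos_part :: "real^'n \<Rightarrow> real^'n" where
  "pos_part v = (\<chi> j. max (v $ j) 0)"

definition nonneg_orthant :: "(real^'n) set" where
  "nonneg_orthant = {v. \<forall>j. 0 \<le> v $ j}"

definition lagrangian :: "('a \<Rightarrow> real) \<Rightarrow> ('a \<Rightarrow> real^'m) \<Rightarrow> 'a \<Rightarrow> real^'m \<Rightarrow> real" where
  "lagrangian F g x l = F x + l \<bullet> g x"

definition saddle_point ::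
    "'a set \<Rightarrow> ('a \<Rightarrow> real) \<Rightarrow> ('a \<Rightarrow> real^'m) \<Rightarrow> 'a \<Rightarrow> real^'m \<Rightarrow> bool" where
  "saddle_point X F g xopt lopt \<longleftrightarrow>
     xopt \<in> X \<and> lopt \<in> nonneg_orthant \<and>
     (\<forall>x\<in>X. \<forall>l\<in>nonneg_orthant.
        lagrangian F g xopt l \<le> lagrangian F g xopt lopt \<and>
        lagrangian F g xopt lopt \<le> lagrangian F g x lopt)"

text \<open>Random elements take values in arbitrary measurable spaces. As they have different
  types, independence is stated through \<open>indep_sets\<close> for the events they generate
  (as in \<open>indep_vars_def2\<close>).\<close>

definition events_of :: "'w measure \<Rightarrow> 'a measure \<Rightarrow> ('w \<Rightarrow> 'a) \<Rightarrow> 'w set set" where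
  "events_of M S X = {X -` A \<inter> space M | A. A \<in> sets S}"

definition independent_triple ::
    "'w measure \<Rightarrow> 'a measure \<Rightarrow> 'b measure \<Rightarrow> 'c measure \<Rightarrow>
     ('w \<Rightarrow> 'a) \<Rightarrow> ('w \<Rightarrow> 'b) \<Rightarrow> ('w \<Rightarrow> 'c) \<Rightarrow> bool" where
  "independent_triple M S1 S2 S3 X1 X2 X3 \<longleftrightarrow>
     X1 \<in> measurable M S1 \<and> X2 \<in> measurable M S2 \<and> X3 \<in> measurable M S3 \<and>
     prob_space.indep_sets M
       (\<lambda>k. [events_of M S1 X1, events_of M S2 X2, events_of M S3 X3] ! k) {..<3}"

definition copy_of :: "'w measure \<Rightarrow> 'a measure \<Rightarrow> ('w \<Rightarrow> 'a) \<Rightarrow> ('w \<Rightarrow> 'a) \<Rightarrow> bool" where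
  "copy_of M S X Y \<longleftrightarrow> Y \<in> measurable M S \<and> distr M S Y = distr M S X"

text \<open>The five samples \<open>\<xi>\<^sub>1\<^sup>0, \<xi>\<^sub>2\<^sup>0, \<xi>\<^sub>2\<^sup>1, \<zeta>\<^sup>0, \<zeta>\<^sup>1\<close>
  of the iterations \<open>t < N\<close>; the joint family is indexed by pairs \<open>(k, t)\<close>.\<close>

definition independent_samples ::
    "'w measure \<Rightarrow> 'a measure \<Rightarrow> 'b measure \<Rightarrow> 'c measure \<Rightarrow>
     ('w \<Rightarrow> 'a) \<Rightarrow> ('w \<Rightarrow> 'b) \<Rightarrow> ('w \<Rightarrow> 'c) \<Rightarrow> nat \<Rightarrow>
     (nat \<Rightarrow> 'w \<Rightarrow> 'a) \<Rightarrow> (nat \<Rightarrow> 'w \<Rightarrow> 'b) \<Rightarrow> (nat \<Rightarrow> 'w \<Rightarrow> 'b) \<Rightarrow>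
     (nat \<Rightarrow> 'w \<Rightarrow> 'c) \<Rightarrow> (nat \<Rightarrow> 'w \<Rightarrow> 'c) \<Rightarrow> bool" where
  "independent_samples M S1 S2 SZ \<xi>1 \<xi>2 \<zeta> N u10 u20 u21 z0 z1 \<longleftrightarrow>
     (\<forall>t<N. copy_of M S1 \<xi>1 (u10 t) \<and>
            copy_of M S2 \<xi>2 (u20 t) \<and> copy_of M S2 \<xi>2 (u21 t) \<and>
            copy_of M SZ \<zeta> (z0 t) \<and> copy_of M SZ \<zeta> (z1 t)) \<and>
     prob_space.indep_sets M
       (\<lambda>(k, t). [events_of M S1 (u10 t), events_of M S2 (u20 t), events_of M S2 (u21 t),
                  events_of M SZ (z0 t), events_of M SZ (z1 t)] ! k)
       ({..<5} \<times> {..<N})"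

text \<open>The \<open>j\<close>-th component of the sampled constraint uses only the \<open>j\<close>-th component of the
  sample.\<close>

definition sampled_constraints ::
    "('m::finite \<Rightarrow> 'x \<Rightarrow> 'c \<Rightarrow> real) \<Rightarrow> 'x \<Rightarrow> ('m \<Rightarrow> 'c) \<Rightarrow> real^'m" where
  "sampled_constraints gs x z = (\<chi> j. gs j x (z j))"

text \<open>One trajectory of EC-SCGD. Since the feasible set is not required to be closed, the
  projection step is stated as the requirement that the new iterate is a nearest point of
  \<open>X\<close>. For convex \<open>X\<close> such a point is unique, and for closed \<open>X\<close> it is
  \<open>closest_point X\<close>.\<close>

definition ec_scgd_run ::
    "(real^'dx) set \<Rightarrow> (real^'dx \<Rightarrow> 'b \<Rightarrow> real^'dy) \<Rightarrow> (real^'dx \<Rightarrow> 'b \<Rightarrow> real^'dy^'dx) \<Rightarrow>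
     (real^'dy \<Rightarrow> 'a \<Rightarrow> real^'dy) \<Rightarrow> ('m::finite \<Rightarrow> real^'dx \<Rightarrow> 'c \<Rightarrow> real) \<Rightarrow>
     (real^'dx \<Rightarrow> ('m \<Rightarrow> 'c) \<Rightarrow> real^'m^'dx) \<Rightarrow>
     (nat \<Rightarrow> real) \<Rightarrow> (nat \<Rightarrow> real) \<Rightarrow> (nat \<Rightarrow> real) \<Rightarrow> nat \<Rightarrow> real^'dx \<Rightarrow> real^'m \<Rightarrow>
     (nat \<Rightarrow> 'a) \<Rightarrow> (nat \<Rightarrow> 'b) \<Rightarrow> (nat \<Rightarrow> 'b) \<Rightarrow> (nat \<Rightarrow> 'm \<Rightarrow> 'c) \<Rightarrow> (nat \<Rightarrow> 'm \<Rightarrow> 'c) \<Rightarrow>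
     (nat \<Rightarrow> real^'dx) \<Rightarrow> (nat \<Rightarrow> real^'dy) \<Rightarrow> (nat \<Rightarrow> real^'m) \<Rightarrow> bool" where
  "ec_scgd_run X f2s df2s df1s gs dgs \<alpha> \<eta> \<tau> N x0 l0 u10 u20 u21 z0 z1 x y l \<longleftrightarrow>
     x 0 = x0 \<and> y 0 = 0 \<and> l 0 = l0 \<and>
     (\<forall>t<N.
        y (Suc t) = (1 / (1 + \<tau> t)) *\<^sub>R (f2s (x t) (u21 t) + \<tau> t *\<^sub>R y t) \<and>
        is_arg_min
          (dist (x t - (1 / \<eta> t) *\<^sub>R
             (df2s (x t) (u20 t) *v df1s (y (Suc t)) (u10 t) + dgs (x t) (z0 t) *v l t)))
          (\<lambda>p. p \<in> X) (x (Suc t)) \<and>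
        l (Suc t) = pos_part (l t + (1 / \<alpha> t) *\<^sub>R sampled_constraints gs (x t) (z1 t)))"

end

theory Submission
  imports Defs
begin

text \<open>
  The theorem holds because one inequality along each trajectory bounds the saddle gap at the
  averaged iterate by a sum of terms that are either martingale differences or second moments.

  The compositional part is controlled by duality between the tracking sequence \<open>y\<close> and the
  gradients of \<open>f1\<close>. Since \<open>\<tau> 0 = 0\<close> and \<open>\<tau> (t+1) \<le> 1 + \<tau> t\<close>, the linearisations of \<open>f1\<close> at
  \<open>y (t+1)\<close>, evaluated at the samples of \<open>f2 (x t)\<close>, telescope: their sum dominates \<open>N\<close> times
  the value of \<open>f1\<close> at the plain mean of these samples (\<open>averaged_linearisations\<close>). The distance
  between \<open>y (t+1)\<close> and \<open>f2 (x t)\<close>, which may well grow like \<open>sqrt N\<close>, therefore never enters.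
  Monotonicity of \<open>f1\<close>, or affinity of \<open>f2\<close>, turns the linearised decrease into a subgradient
  inequality for the composition (\<open>linearised_decrease\<close>). Adding the inequality of the projected
  step in \<open>x\<close> and that of the multiplier step gives \<open>pathwise_gap\<close>, which is valid for every
  nonnegative \<open>v\<close>, even one that is chosen after the trajectory is known.

  In expectation the remainder terms are small because each one is a second moment or pairs a vector
  that is determined by the past with fresh noise. Independence allows to freeze the past and to integrate over the
  sample alone (\<open>freezing\<close>), which gives \<open>remainder_expectation\<close>; the two accumulated noises grow
  like \<open>sqrt N\<close> by orthogonality (\<open>noise_sums\<close>).

  Three choices of \<open>v\<close> finish the proof. With \<open>v = lopt\<close> the gap is nonnegative by the saddle
  point property, so the inequality bounds the mean square of the multipliers by a constant plus a
  small multiple of the average of the earlier mean squares. The remainder is thus absorbed by strong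
  induction (\<open>multiplier_deviation\<close>). With \<open>v = 0\<close> the inequality bounds the objective, and with
  \<open>v\<close> of norm \<open>norm lopt + 1\<close> in the direction of the violated constraints it bounds the violation.
  The mean in these inequalities runs over the times \<open>0, ..., N-1\<close>; moving to \<open>1, ..., N\<close> changes
  it by at most \<open>2 D\<^sub>X / N\<close>, which the Lipschitz bounds absorb (\<open>shifted_mean\<close>).
\<close>


section \<open>Deterministic inequalities for one step\<close>

lemma norm_add_square_le: "(norm (a + b))\<^sup>2 \<le> 2 * (norm a)\<^sup>2 + 2 * (norm b)\<^sup>2"
  for a b :: "'a::real_inner"
  using zero_le_power2[of "norm (a - b)"] unfolding power2_norm_eq_inner
  by (simp add: inner_add_left inner_add_right inner_diff_left inner_diff_right inner_commute)

text \<open>A nearest point of a convex set that is not closed is also nearest in the closure. This makes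
  the iterates a continuous function of the unprojected point, which is what measurability needs.\<close>

lemma nearest_point_eq_closest_point:
  fixes X :: "'a::euclidean_space set"
  assumes "convex X" and near: "is_arg_min (dist p) (\<lambda>q. q \<in> X) q"
  shows "q = closest_point (closure X) p"
proof (rule closest_point_unique)
  show "convex (closure X)" using assms(1) by (rule convex_closure)
  show "q \<in> closure X" using near closure_subset by (auto simp: is_arg_min_def)
  have "dist p q \<le> dist p z" if "z \<in> X" for z
    using near that by (auto simp: is_arg_min_def not_less)
  moreover have "closed {z. dist p q \<le> dist p z}"
    by (intro closed_Collect_le continuous_intros)
  ultimately have "closure X \<subseteq> {z. dist p q \<le> dist p z}"
    by (intro closure_minimal) auto
  then show "\<forall>z\<in>closure X. dist p q \<le> dist p z" by auto
qed simp

text \<open>Projection does not increase the distance to \<open>z\<close>; expanding the square gives the usual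
  inequality of the subgradient method.\<close>

lemma projected_step_inequality:
  fixes X :: "'a::euclidean_space set"
  assumes "convex X" and near: "is_arg_min (dist (w - (1 / \<eta>) *\<^sub>R d)) (\<lambda>q. q \<in> X) q"
    and "z \<in> X" and "0 < \<eta>"
  shows "d \<bullet> (w - z) \<le> \<eta> / 2 * ((norm (w - z))\<^sup>2 - (norm (q - z))\<^sup>2) + (norm d)\<^sup>2 / (2 * \<eta>)"
proof -
  let ?C = "closure X" and ?p = "w - (1 / \<eta>) *\<^sub>R d"
  have z: "z \<in> ?C" using \<open>z \<in> X\<close> closure_subset by blast
  have "dist (closest_point ?C ?p) (closest_point ?C z) \<le> dist ?p z"
    using z \<open>convex X\<close> by (intro closest_point_lipschitz convex_closure) auto
  then have "norm (q - z) \<le> norm ((w - z) - (1 / \<eta>) *\<^sub>R d)"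
    using nearest_point_eq_closest_point[OF \<open>convex X\<close> near] closest_point_self[OF z]
    by (simp add: dist_norm algebra_simps)
  then have "(norm (q - z))\<^sup>2 \<le> (norm ((w - z) - (1 / \<eta>) *\<^sub>R d))\<^sup>2"
    by (intro power_mono) auto
  also have "\<dots> = (norm (w - z))\<^sup>2 - 2 / \<eta> * (d \<bullet> (w - z)) + (norm d)\<^sup>2 / \<eta>\<^sup>2"
    unfolding power2_norm_eq_inner
    by (simp add: inner_diff_left inner_diff_right inner_commute power2_eq_square algebra_simps)
  finally show ?thesis using \<open>0 < \<eta>\<close> by (simp add: field_simps power2_eq_square)
qed

lemma pos_part_nonneg: "pos_part u \<in> nonneg_orthant"
  by (simp add: pos_part_def nonneg_orthant_def)

lemma inner_nonneg_mono:
  fixes v :: "real^'n"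
  assumes "v \<in> nonneg_orthant" and "\<And>j. a $ j \<le> b $ j"
  shows "v \<bullet> a \<le> v \<bullet> b"
  using assms unfolding inner_vec_def nonneg_orthant_def
  by (intro sum_mono) (auto intro: mult_left_mono)

text \<open>The variational characterisation of \<open>pos_part\<close> as the projection onto the nonnegative orthant.\<close>

lemma pos_part_variational:
  assumes "v \<in> nonneg_orthant"
  shows "(u - pos_part u) \<bullet> (v - pos_part u) \<le> 0"
  using assms unfolding inner_vec_def
  by (intro sum_nonpos)
    (auto simp: pos_part_def nonneg_orthant_def max_def mult_nonpos_nonneg)

text \<open>The point of the shift by \<open>c\<close> is that the sampled constraints \<open>G\<close> may be large when some
  constraint is very slack at the optimum. A nonpositive \<open>c\<close>, later the constraint values at
  the optimum, only helps in the pairing with the new multiplier, so that just the norm of \<open>G - c\<close>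
  has to be paid.\<close>

lemma dual_step_inequality:
  fixes l c v G :: "real^'n"
  assumes "0 < \<alpha>" and v: "v \<in> nonneg_orthant" and c: "\<And>j. c $ j \<le> 0"
    and l': "l' = pos_part (l + (1 / \<alpha>) *\<^sub>R G)"
  shows "G \<bullet> v - (G - c) \<bullet> l
    \<le> \<alpha> / 2 * ((norm (l - v))\<^sup>2 - (norm (l' - v))\<^sup>2) + (norm (G - c))\<^sup>2 / (2 * \<alpha>)"
proof -
  have "(l + (1 / \<alpha>) *\<^sub>R G - l') \<bullet> (v - l') \<le> 0"
    using pos_part_variational[OF v, of "l + (1 / \<alpha>) *\<^sub>R G"] by (simp add: l')
  then have "\<alpha> * ((l + (1 / \<alpha>) *\<^sub>R G - l') \<bullet> (v - l')) \<le> 0"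
    using \<open>0 < \<alpha>\<close> by (simp add: mult_le_0_iff)
  then have vi: "G \<bullet> (v - l') \<le> \<alpha> * ((l' - l) \<bullet> (v - l'))"
    using \<open>0 < \<alpha>\<close> by (simp add: inner_diff_left inner_add_left algebra_simps)
  have "c \<bullet> l' \<le> 0"
    using c inner_nonneg_mono[of l' c 0] pos_part_nonneg[of "l + (1 / \<alpha>) *\<^sub>R G"]
    by (simp add: l' inner_commute)
  moreover have "(G - c) \<bullet> (l' - l) \<le> \<alpha> / 2 * (norm (l' - l))\<^sup>2 + (norm (G - c))\<^sup>2 / (2 * \<alpha>)"
  proof -
    have "0 \<le> (norm ((G - c) - \<alpha> *\<^sub>R (l' - l)))\<^sup>2" by simp
    also have "\<dots> = (norm (G - c))\<^sup>2 - 2 * \<alpha> * ((G - c) \<bullet> (l' - l)) + \<alpha>\<^sup>2 * (norm (l' - l))\<^sup>2"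
      unfolding power2_norm_eq_inner
      by (simp add: inner_diff_left inner_diff_right inner_commute power2_eq_square algebra_simps)
    finally show ?thesis using \<open>0 < \<alpha>\<close> by (simp add: field_simps power2_eq_square)
  qed
  moreover have E: "(l' - l) \<bullet> (v - l')
      = ((norm (l - v))\<^sup>2 - (norm (l' - v))\<^sup>2 - (norm (l' - l))\<^sup>2) / 2"
    unfolding power2_norm_eq_inner
    by (simp add: inner_diff_left inner_diff_right inner_commute algebra_simps)
  moreover have "G \<bullet> v - G \<bullet> l'
      \<le> \<alpha> / 2 * ((norm (l - v))\<^sup>2 - (norm (l' - v))\<^sup>2) - \<alpha> / 2 * (norm (l' - l))\<^sup>2"
    using vi unfolding E by (simp add: inner_diff_right field_simps)
  moreover have "G \<bullet> v - (G - c) \<bullet> l = (G \<bullet> v - G \<bullet> l') + c \<bullet> l' + (G - c) \<bullet> (l' - l)"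
    by (simp add: inner_diff_left inner_diff_right)
  ultimately show ?thesis by linarith
qed

lemma norm_vec_square: "(norm u)\<^sup>2 = (\<Sum>i\<in>UNIV. (norm (u $ i))\<^sup>2)"
  by (simp add: norm_vec_def L2_set_def sum_nonneg)

text \<open>The norm of a matrix is the Frobenius norm here.\<close>

lemma norm_matrix_vector_le:
  fixes A :: "real^'n^'m"
  shows "norm (A *v u) \<le> norm A * norm u"
proof -
  have "(norm (A *v u))\<^sup>2 = (\<Sum>i\<in>UNIV. (A $ i \<bullet> u)\<^sup>2)"
    by (simp add: norm_vec_square[of "A *v u"] matrix_vector_mul_component)
  also have "\<dots> \<le> (\<Sum>i\<in>UNIV. (norm (A $ i))\<^sup>2 * (norm u)\<^sup>2)"
    by (intro sum_mono) (metis Cauchy_Schwarz_ineq power2_norm_eq_inner)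
  also have "\<dots> = (norm A * norm u)\<^sup>2"
    by (simp add: power_mult_distrib sum_distrib_right [symmetric] norm_vec_square[of A])
  finally show ?thesis by (rule power2_le_imp_le) simp
qed

lemma sum_norm_column_square:
  fixes A :: "real^'n^'m"
  shows "(\<Sum>j\<in>UNIV. (norm (column j A))\<^sup>2) = (norm A)\<^sup>2"
  unfolding power2_norm_eq_inner inner_vec_def column_def
  by (simp, rule sum.swap)

lemma matrix_vector_inner_columns:
  fixes A :: "real^'n^'m"
  shows "(A *v u) \<bullet> z = (\<Sum>j\<in>UNIV. u $ j * (column j A \<bullet> z))"
  by (simp add: matrix_mult_sum inner_sum_left scalar_mult_eq_scaleR)

lemma subgradient_matrices_le:
  assumes "A \<in> subgradient_matrices f w"
  shows "f w $ j + column j A \<bullet> (z - w) \<le> f z $ j"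
  using assms by (auto simp: subgradient_matrices_def subdifferential_def)

text \<open>A componentwise subgradient inequality may be summed with weights \<open>q\<close> if these are nonnegative,
  or if the inequality is an equality. With \<open>q\<close> a gradient of \<open>f1\<close> this is the chain rule for
  subgradients; taking for \<open>w\<close> a mean of points \<open>z\<close> it is also Jensen's inequality for the
  composition.\<close>

lemma linearised_decrease:
  assumes A: "A \<in> subgradient_matrices f w" and "affine_map f \<or> q \<in> nonneg_orthant"
  shows "q \<bullet> (f w - f z) \<le> (A *v q) \<bullet> (w - z)"
proof -
  have le: "f w $ j - f z $ j \<le> column j A \<bullet> (w - z)" for j z
    using subgradient_matrices_le[OF A, of j z] by (simp add: inner_diff_right)
  have "q $ j * (f w $ j - f z $ j) \<le> q $ j * (column j A \<bullet> (w - z))" for j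
    using assms(2)
  proof
    assume "affine_map f"
    then obtain h c where h: "linear h" and f: "f = (\<lambda>x. h x + c)"
      by (auto simp: affine_map_def)
    (* an affine function lies above its linearisation only if it agrees with it: reflect z in w *)
    have "h (w + (w - z)) = h w + (h w - h z)"
      by (simp only: linear_add[OF h] linear_diff[OF h])
    then have "f w $ j - f (w + (w - z)) $ j = - (f w $ j - f z $ j)"
      by (simp add: f)
    then have "f w $ j - f z $ j = column j A \<bullet> (w - z)"
      using le[of j z] le[of j "w + (w - z)"] by (simp add: inner_diff_right inner_add_right)
    then show ?thesis by simp
  next
    assume "q \<in> nonneg_orthant"
    then show ?thesis by (intro mult_left_mono le) (simp add: nonneg_orthant_def)
  qed
  then show ?thesis
    unfolding matrix_vector_inner_columns by (auto simp: inner_vec_def intro: sum_mono)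
qed

text \<open>Each component lies between its two linearisations, so its square is at most the sum of the
  squares of both.\<close>

lemma subgradient_lipschitz:
  assumes A: "A \<in> subgradient_matrices f w" and B: "B \<in> subgradient_matrices f z"
  shows "(norm (f w - f z))\<^sup>2 \<le> ((norm A)\<^sup>2 + (norm B)\<^sup>2) * (norm (w - z))\<^sup>2"
proof -
  have "((f w - f z) $ j)\<^sup>2 \<le> ((norm (column j A))\<^sup>2 + (norm (column j B))\<^sup>2) * (norm (w - z))\<^sup>2" for j
  proof -
    let ?a = "column j A \<bullet> (w - z)" and ?b = "column j B \<bullet> (w - z)"
    have "f w $ j - f z $ j \<le> ?a" "?b \<le> f w $ j - f z $ j"
      using subgradient_matrices_le[OF A, of j z] subgradient_matrices_le[OF B, of j w]
      by (simp_all add: inner_diff_right)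
    then have "\<bar>f w $ j - f z $ j\<bar> \<le> \<bar>?a\<bar> \<or> \<bar>f w $ j - f z $ j\<bar> \<le> \<bar>?b\<bar>" by linarith
    then have "(f w $ j - f z $ j)\<^sup>2 \<le> ?a\<^sup>2 + ?b\<^sup>2"
      by (metis abs_le_square_iff add_increasing add_increasing2 zero_le_power2)
    also have "\<dots> \<le> (norm (column j A))\<^sup>2 * (norm (w - z))\<^sup>2
        + (norm (column j B))\<^sup>2 * (norm (w - z))\<^sup>2"
      by (intro add_mono) (metis Cauchy_Schwarz_ineq power2_norm_eq_inner)+
    finally show ?thesis by (simp add: distrib_right)
  qed
  then have "(\<Sum>j\<in>UNIV. ((f w - f z) $ j)\<^sup>2)
      \<le> (\<Sum>j\<in>UNIV. ((norm (column j A))\<^sup>2 + (norm (column j B))\<^sup>2) * (norm (w - z))\<^sup>2)"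
    by (rule sum_mono)
  then show ?thesis
    by (simp add: power2_norm_eq_inner[of "f w - f z"] inner_vec_def power2_eq_square[symmetric]
        sum_distrib_right[symmetric] sum.distrib sum_norm_column_square)
qed

text \<open>Restriction to the line through \<open>b\<close> and \<open>a\<close> reduces this to the one-dimensional tangent.\<close>

lemma gradient_inequality:
  fixes f :: "'a::real_inner \<Rightarrow> real"
  assumes f: "convex_on UNIV f" and D: "GDERIV f b :> D"
  shows "f b + D \<bullet> (a - b) \<le> f a"
proof -
  let ?g = "\<lambda>t. b + t *\<^sub>R (a - b)"
  have conv: "convex_on UNIV (\<lambda>t. f (?g t))"
  proof (rule convex_onI)
    fix t s r :: real assume "0 < t" "t < 1"
    then have "f ((1 - t) *\<^sub>R ?g s + t *\<^sub>R ?g r) \<le> (1 - t) * f (?g s) + t * f (?g r)"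
      by (intro convex_onD[OF f]) auto
    also have "(1 - t) *\<^sub>R ?g s + t *\<^sub>R ?g r = ?g ((1 - t) *\<^sub>R s + t *\<^sub>R r)"
      by (simp add: algebra_simps)
    finally show "f (?g ((1 - t) *\<^sub>R s + t *\<^sub>R r)) \<le> (1 - t) * f (?g s) + t * f (?g r)" .
  qed simp
  have "(f has_derivative (\<lambda>h. h \<bullet> D)) (at (?g 0))" using D by (simp add: gderiv_def)
  then have "((\<lambda>t. f (?g t)) has_derivative (\<lambda>t. (t *\<^sub>R (a - b)) \<bullet> D)) (at 0)"
    by (rule has_derivative_compose[rotated]) (auto intro!: derivative_eq_intros)
  then have "((\<lambda>t. f (?g t)) has_real_derivative D \<bullet> (a - b)) (at 0)"
    by (simp add: has_field_derivative_def inner_commute mult_commute_abs)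
  from convex_on_imp_above_tangent[OF conv, of 0 1, OF _ _ _ this] show ?thesis by simp
qed

text \<open>Let \<open>m\<close> be the mean of the \<open>s t\<close> and let \<open>\<phi>\<close> be the gap between \<open>f\<close> and its tangent at \<open>m\<close>, so
  that \<open>\<phi> \<ge> 0\<close>. The recursion says that \<open>s t = (1 + \<tau> t) y (t+1) - \<tau> t y t\<close>, and convexity of \<open>f\<close>
  along the segment from \<open>y t\<close> to \<open>y (t+1)\<close> bounds the linearisation at \<open>s t\<close> from below by the same
  combination of values. Up to terms that cancel because \<open>m\<close> is the mean, what remains is the sum
  of \<open>(1 + \<tau> t) \<phi> (y (t+1)) - \<tau> t \<phi> (y t)\<close>, which is nonnegative by telescoping. The linearisation at
  \<open>c\<close> is at most \<open>f c\<close>, which turns values into differences.\<close>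

lemma averaged_linearisations:
  fixes f :: "'a::real_inner \<Rightarrow> real" and s y :: "nat \<Rightarrow> 'a"
  assumes grad: "\<And>a b. f b + D b \<bullet> (a - b) \<le> f a"
    and y: "\<And>t. t < k \<Longrightarrow> y (Suc t) = (1 / (1 + \<tau> t)) *\<^sub>R (s t + \<tau> t *\<^sub>R y t)"
    and "\<tau> 0 = 0" and \<tau>_pos: "\<And>t. t < k \<Longrightarrow> 0 \<le> \<tau> t"
    and \<tau>_step: "\<And>t. Suc t < k \<Longrightarrow> \<tau> (Suc t) \<le> 1 + \<tau> t" and "0 < k"
  shows "real k * (f ((1 / real k) *\<^sub>R (\<Sum>t<k. s t)) - f c) \<le> (\<Sum>t<k. D (y (Suc t)) \<bullet> (s t - c))"
proof -
  define m where "m = (1 / real k) *\<^sub>R (\<Sum>t<k. s t)"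
  define \<phi> where "\<phi> v = f v - f m - D m \<bullet> (v - m)" for v
  have \<phi>_pos: "0 \<le> \<phi> v" for v using grad[of m v] by (simp add: \<phi>_def)
  have y': "(1 + \<tau> t) *\<^sub>R y (Suc t) = s t + \<tau> t *\<^sub>R y t" if "t < k" for t
    using y[OF that] \<tau>_pos[OF that] by simp
  have "(1 + \<tau> t) * \<phi> (y (Suc t)) - \<tau> t * \<phi> (y t) + f m - f c + D m \<bullet> (s t - m)
      \<le> D (y (Suc t)) \<bullet> (s t - c)" if "t < k" for t
  proof -
    let ?y = "y (Suc t)"
    have s: "s t = (1 + \<tau> t) *\<^sub>R ?y - \<tau> t *\<^sub>R y t" using y'[OF that] by simp
    have "\<tau> t * (f ?y + D ?y \<bullet> (y t - ?y)) \<le> \<tau> t * f (y t)"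
      using grad \<tau>_pos[OF that] by (intro mult_left_mono)
    then have "(1 + \<tau> t) * f ?y - \<tau> t * f (y t) \<le> f ?y + D ?y \<bullet> (s t - ?y)"
      unfolding s by (simp add: inner_diff_right inner_add_right algebra_simps)
    moreover have "f ?y + D ?y \<bullet> (c - ?y) \<le> f c" by (rule grad)
    moreover have "(1 + \<tau> t) * \<phi> ?y - \<tau> t * \<phi> (y t)
        = (1 + \<tau> t) * f ?y - \<tau> t * f (y t) - f m - D m \<bullet> (s t - m)"
      unfolding s \<phi>_def by (simp add: inner_diff_right inner_add_right algebra_simps)
    ultimately show ?thesis by (simp add: inner_diff_right)
  qed
  then have "(\<Sum>t<k. (1 + \<tau> t) * \<phi> (y (Suc t)) - \<tau> t * \<phi> (y t) + f m - f c + D m \<bullet> (s t - m))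
      \<le> (\<Sum>t<k. D (y (Suc t)) \<bullet> (s t - c))" by (intro sum_mono) auto
  moreover have "0 \<le> (\<Sum>t<k. (1 + \<tau> t) * \<phi> (y (Suc t)) - \<tau> t * \<phi> (y t))"
  proof -
    have "j \<le> k \<Longrightarrow> (case j of 0 \<Rightarrow> 0 | Suc i \<Rightarrow> (1 + \<tau> i) * \<phi> (y (Suc i)))
        \<le> (\<Sum>t<j. (1 + \<tau> t) * \<phi> (y (Suc t)) - \<tau> t * \<phi> (y t))" for j
    proof (induction j)
      case (Suc j)
      have "\<tau> j * \<phi> (y j) \<le> (case j of 0 \<Rightarrow> 0 | Suc i \<Rightarrow> (1 + \<tau> i) * \<phi> (y (Suc i)))"
        using \<open>\<tau> 0 = 0\<close> \<tau>_step Suc.prems \<phi>_pos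
        by (auto split: nat.splits intro: mult_right_mono)
      with Suc show ?case by simp
    qed simp
    moreover have "0 \<le> (case k of 0 \<Rightarrow> 0 | Suc i \<Rightarrow> (1 + \<tau> i) * \<phi> (y (Suc i)))"
      using \<tau>_pos \<phi>_pos by (auto split: nat.splits)
    ultimately show ?thesis by (meson order.refl order.trans)
  qed
  moreover have "(\<Sum>t<k. D m \<bullet> (s t - m)) = 0"
    using \<open>0 < k\<close> by (simp add: inner_sum_right[symmetric] sum_subtractf m_def sum_constant_scaleR)
  ultimately show ?thesis
    unfolding m_def[symmetric] by (simp add: sum.distrib sum_subtractf algebra_simps)
qed

section \<open>Fresh samples are independent of the past\<close>

text \<open>The sigma-algebra generated by the events of the indices in \<open>J\<close>. The families of events, rather
  than the random variables, are the index because the samples have different types.\<close>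

definition history :: "'w measure \<Rightarrow> ('i \<Rightarrow> 'w set set) \<Rightarrow> 'i set \<Rightarrow> 'w measure" where
  "history M E J = sigma (space M) (\<Union>i\<in>J. E i)"

lemma space_history [simp]: "space (history M E J) = space M"
  by (simp add: history_def space_measure_of_conv)

lemma sets_history:
  assumes "\<And>i. i \<in> J \<Longrightarrow> E i \<subseteq> Pow (space M)"
  shows "sets (history M E J) = sigma_sets (space M) (\<Union>i\<in>J. E i)"
  unfolding history_def using assms by (intro sets_measure_of) auto

lemma Int_stable_events_of: "Int_stable (events_of M S U)"
proof (rule Int_stableI)
  fix a b assume "a \<in> events_of M S U" "b \<in> events_of M S U"
  then obtain A B where "A \<in> sets S" "B \<in> sets S"
    "a = U -` A \<inter> space M" "b = U -` B \<inter> space M"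
    by (auto simp: events_of_def)
  then show "a \<inter> b \<in> events_of M S U"
    by (auto simp: events_of_def intro!: exI[of _ "A \<inter> B"])
qed

lemma measurable_from_history:
  assumes "\<And>i. i \<in> J \<Longrightarrow> E i \<subseteq> sets M" and "W \<in> measurable (history M E J) T"
  shows "W \<in> measurable M T"
proof -
  have sp: "\<And>i. i \<in> J \<Longrightarrow> E i \<subseteq> Pow (space M)"
    using assms(1) sets.sets_into_space by blast
  have "sets (history M E J) \<subseteq> sets M"
    by (subst sets_history[OF sp]) (use assms(1) in \<open>auto intro!: sets.sigma_sets_subset\<close>)
  with assms(2) show ?thesis by (auto simp: measurable_def)
qed

lemma measurable_history_mono:
  assumes "J \<subseteq> J'" and "\<And>i. i \<in> J' \<Longrightarrow> E i \<subseteq> sets M"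
    and "W \<in> measurable (history M E J) T"
  shows "W \<in> measurable (history M E J') T"
proof -
  have sp: "\<And>i. i \<in> J' \<Longrightarrow> E i \<subseteq> Pow (space M)"
    using assms(2) sets.sets_into_space by blast
  have "sets (history M E J) \<subseteq> sets (history M E J')"
    using sp assms(1) by (subst (1 2) sets_history) (auto intro!: sigma_sets_mono')
  with assms(3) show ?thesis by (auto simp: measurable_def)
qed

lemma measurable_history_member:
  assumes "i \<in> J" and "E i = events_of M S U" and "U \<in> measurable M S"
    and "\<And>i. i \<in> J \<Longrightarrow> E i \<subseteq> sets M"
  shows "U \<in> measurable (history M E J) S"
proof (rule measurableI)
  have sp: "\<And>i. i \<in> J \<Longrightarrow> E i \<subseteq> Pow (space M)"
    using assms(4) sets.sets_into_space by blast
  fix A assume "A \<in> sets S"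
  then have "U -` A \<inter> space M \<in> E i" using assms(2) by (auto simp: events_of_def)
  then show "U -` A \<inter> space (history M E J) \<in> sets (history M E J)"
    using assms(1) sp by (subst sets_history) auto
qed (use assms(3) in \<open>auto simp: measurable_space\<close>)

context prob_space
begin

text \<open>Grouping the independent families into the indices of \<open>J\<close> and the single index \<open>i\<close> keeps them
  independent.\<close>

lemma indep_set_history:
  assumes ind: "indep_sets E I" and stable: "\<And>i. i \<in> I \<Longrightarrow> Int_stable (E i)"
    and J: "J \<subseteq> I" and i: "i \<in> I - J"
    and W: "W \<in> measurable (history M E J) T" and U: "E i = events_of M S U"
  shows "indep_set (events_of M T W) (events_of M S U)"
proof -
  define K where "K = case_bool J {i}"
  have ev: "\<And>j. j \<in> I \<Longrightarrow> E j \<subseteq> sets M" using ind by (auto simp: indep_sets_def)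
  then have sp: "\<And>j. j \<in> J \<Longrightarrow> E j \<subseteq> Pow (space M)"
    using J sets.sets_into_space by blast
  have "indep_sets (\<lambda>b. sigma_sets (space M) (\<Union>j\<in>K b. E j)) UNIV"
  proof (rule indep_sets_collect_sigma)
    show "indep_sets E (\<Union>b. K b)"
      by (rule indep_sets_mono_index[OF _ ind]) (use J i in \<open>auto simp: K_def split: bool.splits\<close>)
    show "Int_stable (E j)" if "j \<in> K b" for b j
      using that J i by (intro stable) (auto simp: K_def split: bool.splits)
    show "disjoint_family_on K UNIV"
      using i by (auto simp: disjoint_family_on_def K_def split: bool.splits)
  qed
  then have "indep_sets (case_bool (events_of M T W) (events_of M S U)) UNIV"
  proof (rule indep_sets_mono_sets)
    fix b :: bool
    have "events_of M T W \<subseteq> sets (history M E J)"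
      using W by (auto simp: events_of_def dest!: measurable_sets)
    also have "\<dots> = sigma_sets (space M) (\<Union>j\<in>J. E j)" by (rule sets_history[OF sp])
    finally show "case_bool (events_of M T W) (events_of M S U) b
        \<subseteq> sigma_sets (space M) (\<Union>j\<in>K b. E j)"
      using U by (cases b) (auto simp: K_def)
  qed
  then show ?thesis by (simp add: indep_set_def)
qed

lemma distr_pair_of_indep_set:
  assumes W: "W \<in> measurable M T" and U: "U \<in> measurable M S"
    and ind: "indep_set (events_of M T W) (events_of M S U)"
  shows "distr M (T \<Otimes>\<^sub>M S) (\<lambda>\<omega>. (W \<omega>, U \<omega>)) = distr M T W \<Otimes>\<^sub>M distr M S U"
proof -
  interpret W: prob_space "distr M T W" using W by (rule prob_space_distr)
  interpret U: prob_space "distr M S U" using U by (rule prob_space_distr)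
  have "distr M T W \<Otimes>\<^sub>M distr M S U = distr M (T \<Otimes>\<^sub>M S) (\<lambda>\<omega>. (W \<omega>, U \<omega>))"
  proof (rule pair_measure_eqI)
    fix A B assume "A \<in> sets (distr M T W)" "B \<in> sets (distr M S U)"
    then have A: "A \<in> sets T" and B: "B \<in> sets S" by auto
    have "prob ((W -` A \<inter> space M) \<inter> (U -` B \<inter> space M))
        = prob (W -` A \<inter> space M) * prob (U -` B \<inter> space M)"
      using A B by (intro indep_setD[OF ind]) (auto simp: events_of_def)
    moreover have "(W -` A \<inter> space M) \<inter> (U -` B \<inter> space M)
        = (\<lambda>\<omega>. (W \<omega>, U \<omega>)) -` (A \<times> B) \<inter> space M" by auto
    ultimately show "emeasure (distr M T W) A * emeasure (distr M S U) B
        = emeasure (distr M (T \<Otimes>\<^sub>M S) (\<lambda>\<omega>. (W \<omega>, U \<omega>))) (A \<times> B)"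
      using A B W U by (simp add: emeasure_distr emeasure_eq_measure ennreal_mult)
  qed (simp_all add: W.sigma_finite_measure_axioms U.sigma_finite_measure_axioms
        cong: sets_pair_measure_cong)
  then show ?thesis ..
qed

text \<open>The joint law of the past \<open>W\<close> and the fresh sample \<open>U\<close> is a product, and it is the law of
  \<open>(W \<omega>, \<xi> \<omega>')\<close> under \<open>M \<Otimes>\<^sub>M M\<close>. Pulling everything back to \<open>M \<Otimes>\<^sub>M M\<close> before applying Fubini has the
  advantage that the hypotheses on \<open>h (W \<omega>, \<sqdot>)\<close> concern actual values of \<open>W\<close>: iterates lie in a
  convex set that may fail to be Borel, so "almost every \<open>w\<close> under the law of \<open>W\<close>" would not do.\<close>

lemma freezing:
  fixes h :: "'t \<times> 's \<Rightarrow> 'b::{banach, second_countable_topology}"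
  assumes W: "W \<in> measurable M T" and \<xi>: "\<xi> \<in> measurable M S" and U: "copy_of M S \<xi> U"
    and ind: "indep_set (events_of M T W) (events_of M S U)"
    and h[measurable]: "h \<in> borel_measurable (T \<Otimes>\<^sub>M S)"
    and int: "\<And>\<omega>. \<omega> \<in> space M \<Longrightarrow> integrable M (\<lambda>\<omega>'. h (W \<omega>, \<xi> \<omega>'))"
    and bound: "\<And>\<omega>. \<omega> \<in> space M \<Longrightarrow> (\<integral>\<omega>'. norm (h (W \<omega>, \<xi> \<omega>')) \<partial>M) \<le> Q \<omega>"
    and Q: "integrable M Q"
  shows "integrable M (\<lambda>\<omega>. h (W \<omega>, U \<omega>))"
    and "(\<integral>\<omega>. h (W \<omega>, U \<omega>) \<partial>M) = (\<integral>\<omega>. \<integral>\<omega>'. h (W \<omega>, \<xi> \<omega>') \<partial>M \<partial>M)"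
    and "integrable M (\<lambda>\<omega>. \<integral>\<omega>'. h (W \<omega>, \<xi> \<omega>') \<partial>M)"
proof -
  note [measurable] = W \<xi>
  have U'[measurable]: "U \<in> measurable M S" and law: "distr M S U = distr M S \<xi>"
    using U by (auto simp: copy_of_def)
  interpret P: pair_prob_space M M ..
  have eq: "distr M (T \<Otimes>\<^sub>M S) (\<lambda>\<omega>. (W \<omega>, U \<omega>))
      = distr (M \<Otimes>\<^sub>M M) (T \<Otimes>\<^sub>M S) (\<lambda>(\<omega>, \<omega>'). (W \<omega>, \<xi> \<omega>'))"
  proof -
    interpret \<xi>: prob_space "distr M S \<xi>" using \<xi> by (rule prob_space_distr)
    show ?thesis
      unfolding distr_pair_of_indep_set[OF W U' ind] law
      by (rule pair_measure_distr) (auto simp: \<xi>.sigma_finite_measure_axioms)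
  qed
  let ?h = "\<lambda>p. h (W (fst p), \<xi> (snd p))"
  have int2: "integrable (M \<Otimes>\<^sub>M M) ?h"
  proof (rule P.Fubini_integrable)
    show "integrable M (\<lambda>\<omega>. \<integral>\<omega>'. norm (?h (\<omega>, \<omega>')) \<partial>M)"
      by (rule Bochner_Integration.integrable_bound[OF Q])
        (auto intro!: AE_I2 bound order.trans[OF bound])
    show "AE \<omega> in M. integrable M (\<lambda>\<omega>'. ?h (\<omega>, \<omega>'))"
      using int by auto
  qed measurable
  have "integrable (distr M (T \<Otimes>\<^sub>M S) (\<lambda>\<omega>. (W \<omega>, U \<omega>))) h"
    unfolding eq using int2 by (subst integrable_distr_eq) (auto simp: case_prod_beta')
  then show "integrable M (\<lambda>\<omega>. h (W \<omega>, U \<omega>))"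
    by (subst (asm) integrable_distr_eq) auto
  have "(\<integral>\<omega>. h (W \<omega>, U \<omega>) \<partial>M) = integral\<^sup>L (distr M (T \<Otimes>\<^sub>M S) (\<lambda>\<omega>. (W \<omega>, U \<omega>))) h"
    by (subst integral_distr) auto
  also have "\<dots> = integral\<^sup>L (M \<Otimes>\<^sub>M M) ?h"
    unfolding eq by (subst integral_distr) (auto simp: case_prod_beta')
  also have "\<dots> = (\<integral>\<omega>. \<integral>\<omega>'. ?h (\<omega>, \<omega>') \<partial>M \<partial>M)"
    using P.integral_fst'[OF int2] by simp
  finally show "(\<integral>\<omega>. h (W \<omega>, U \<omega>) \<partial>M) = (\<integral>\<omega>. \<integral>\<omega>'. h (W \<omega>, \<xi> \<omega>') \<partial>M \<partial>M)" by simp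
  show "integrable M (\<lambda>\<omega>. \<integral>\<omega>'. h (W \<omega>, \<xi> \<omega>') \<partial>M)"
    using P.integrable_fst'[OF int2] by simp
qed

text \<open>From \<open>\<bar>a\<bar> \<le> (a\<^sup>2 / c + c) / 2\<close>, in place of the Cauchy-Schwarz inequality for integrals.\<close>

lemma expectation_le_of_square:
  assumes f: "f \<in> borel_measurable M" and int: "integrable M (\<lambda>\<omega>. (f \<omega>)\<^sup>2)"
    and le: "(\<integral>\<omega>. (f \<omega>)\<^sup>2 \<partial>M) \<le> c\<^sup>2" and "0 < (c::real)"
  shows "integrable M f" and "(\<integral>\<omega>. f \<omega> \<partial>M) \<le> c"
proof -
  have am_gm: "\<bar>a\<bar> \<le> (a\<^sup>2 / c + c) / 2" for a
  proof -
    have "0 \<le> (\<bar>a\<bar> - c)\<^sup>2" by simp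
    then have "2 * \<bar>a\<bar> * c \<le> a\<^sup>2 + c\<^sup>2" by (simp add: power2_diff)
    with \<open>0 < c\<close> show ?thesis by (simp add: field_simps power2_eq_square)
  qed
  have q: "integrable M (\<lambda>\<omega>. ((f \<omega>)\<^sup>2 / c + c) / 2)" using int by auto
  show i: "integrable M f"
    by (rule Bochner_Integration.integrable_bound[OF q f])
      (rule AE_I2, unfold real_norm_def, rule order.trans[OF am_gm abs_ge_self])
  have "(\<integral>\<omega>. f \<omega> \<partial>M) \<le> (\<integral>\<omega>. ((f \<omega>)\<^sup>2 / c + c) / 2 \<partial>M)"
    using i q by (rule integral_mono) (rule order.trans[OF abs_ge_self am_gm])
  also have "\<dots> = ((\<integral>\<omega>. (f \<omega>)\<^sup>2 \<partial>M) / c + c) / 2" using int by (simp add: prob_space)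
  also have "\<dots> \<le> (c\<^sup>2 / c + c) / 2" using le \<open>0 < c\<close> by (simp add: divide_right_mono)
  also have "\<dots> = c" using \<open>0 < c\<close> by (simp add: power2_eq_square)
  finally show "(\<integral>\<omega>. f \<omega> \<partial>M) \<le> c" .
qed

text \<open>The coefficient \<open>c\<close> is kept apart from \<open>W\<close> because it may involve more of the past than the
  noise \<open>n\<close> does.\<close>

lemma mean_zero_inner:
  fixes n :: "'t \<times> 's \<Rightarrow> 'b::euclidean_space" and c :: "'a \<Rightarrow> 'b"
  assumes W: "W \<in> measurable M T" and c: "c \<in> borel_measurable M"
    and \<xi>: "\<xi> \<in> measurable M S" and U: "copy_of M S \<xi> U"
    and ind: "indep_set (events_of M (T \<Otimes>\<^sub>M borel) (\<lambda>\<omega>. (W \<omega>, c \<omega>))) (events_of M S U)"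
    and n: "n \<in> borel_measurable (T \<Otimes>\<^sub>M S)"
    and int: "\<And>\<omega>. \<omega> \<in> space M \<Longrightarrow> integrable M (\<lambda>\<omega>'. n (W \<omega>, \<xi> \<omega>'))"
    and mean: "\<And>\<omega>. \<omega> \<in> space M \<Longrightarrow> (\<integral>\<omega>'. n (W \<omega>, \<xi> \<omega>') \<partial>M) = 0"
    and bound: "\<And>\<omega>. \<omega> \<in> space M \<Longrightarrow> (\<integral>\<omega>'. norm (n (W \<omega>, \<xi> \<omega>')) \<partial>M) \<le> K"
    and int_c: "integrable M (\<lambda>\<omega>. norm (c \<omega>))"
  shows "integrable M (\<lambda>\<omega>. c \<omega> \<bullet> n (W \<omega>, U \<omega>))"
    and "(\<integral>\<omega>. c \<omega> \<bullet> n (W \<omega>, U \<omega>) \<partial>M) = 0"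
proof -
  note [measurable] = W c \<xi> n
  let ?h = "\<lambda>p. snd (fst p) \<bullet> n (fst (fst p), snd p)"
  have 1: "(\<lambda>\<omega>. (W \<omega>, c \<omega>)) \<in> measurable M (T \<Otimes>\<^sub>M borel)" by measurable
  have 2: "?h \<in> borel_measurable ((T \<Otimes>\<^sub>M borel) \<Otimes>\<^sub>M S)" by measurable
  have 3: "(\<integral>\<omega>'. norm (?h ((W \<omega>, c \<omega>), \<xi> \<omega>')) \<partial>M) \<le> norm (c \<omega>) * K"
    if "\<omega> \<in> space M" for \<omega>
  proof -
    have "(\<integral>\<omega>'. norm (?h ((W \<omega>, c \<omega>), \<xi> \<omega>')) \<partial>M)
        \<le> (\<integral>\<omega>'. norm (c \<omega>) * norm (n (W \<omega>, \<xi> \<omega>')) \<partial>M)"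
      using int[OF that] by (intro integral_mono) (auto intro: Cauchy_Schwarz_ineq2)
    also have "\<dots> \<le> norm (c \<omega>) * K"
      using bound[OF that] by (simp add: mult_left_mono)
    finally show ?thesis .
  qed
  have 4: "integrable M (\<lambda>\<omega>'. ?h ((W \<omega>, c \<omega>), \<xi> \<omega>'))" if "\<omega> \<in> space M" for \<omega>
    using int[OF that] by simp
  have 5: "integrable M (\<lambda>\<omega>. norm (c \<omega>) * K)" using int_c by simp
  show "integrable M (\<lambda>\<omega>. c \<omega> \<bullet> n (W \<omega>, U \<omega>))"
    using freezing(1)[OF 1 \<xi> U ind 2 4 3 5] by simp
  have "(\<integral>\<omega>. c \<omega> \<bullet> n (W \<omega>, U \<omega>) \<partial>M) = (\<integral>\<omega>. \<integral>\<omega>'. c \<omega> \<bullet> n (W \<omega>, \<xi> \<omega>') \<partial>M \<partial>M)"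
    using freezing(2)[OF 1 \<xi> U ind 2 4 3 5] by simp
  also have "\<dots> = (\<integral>\<omega>. 0 \<partial>M)"
    using int mean by (intro Bochner_Integration.integral_cong) auto
  finally show "(\<integral>\<omega>. c \<omega> \<bullet> n (W \<omega>, U \<omega>) \<partial>M) = 0" by simp
qed

lemma weighted_moment_le:
  fixes h :: "'t \<times> 's \<Rightarrow> real" and q :: "'a \<Rightarrow> real"
  assumes W: "W \<in> measurable M T" and q: "q \<in> borel_measurable M"
    and \<xi>: "\<xi> \<in> measurable M S" and U: "copy_of M S \<xi> U"
    and ind: "indep_set (events_of M (T \<Otimes>\<^sub>M borel) (\<lambda>\<omega>. (W \<omega>, q \<omega>))) (events_of M S U)"
    and h: "h \<in> borel_measurable (T \<Otimes>\<^sub>M S)"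
    and nonneg: "\<And>p. 0 \<le> h p" "\<And>\<omega>. 0 \<le> q \<omega>"
    and int: "\<And>\<omega>. \<omega> \<in> space M \<Longrightarrow> integrable M (\<lambda>\<omega>'. h (W \<omega>, \<xi> \<omega>'))"
    and bound: "\<And>\<omega>. \<omega> \<in> space M \<Longrightarrow> (\<integral>\<omega>'. h (W \<omega>, \<xi> \<omega>') \<partial>M) \<le> K"
    and int_q: "integrable M q"
  shows "integrable M (\<lambda>\<omega>. q \<omega> * h (W \<omega>, U \<omega>))"
    and "(\<integral>\<omega>. q \<omega> * h (W \<omega>, U \<omega>) \<partial>M) \<le> K * (\<integral>\<omega>. q \<omega> \<partial>M)"
proof -
  note [measurable] = W q \<xi> h
  let ?h = "\<lambda>p. snd (fst p) * h (fst (fst p), snd p)"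
  have 1: "(\<lambda>\<omega>. (W \<omega>, q \<omega>)) \<in> measurable M (T \<Otimes>\<^sub>M borel)" by measurable
  have 2: "?h \<in> borel_measurable ((T \<Otimes>\<^sub>M borel) \<Otimes>\<^sub>M S)" by measurable
  have 3: "(\<integral>\<omega>'. norm (?h ((W \<omega>, q \<omega>), \<xi> \<omega>')) \<partial>M) \<le> K * q \<omega>" if "\<omega> \<in> space M" for \<omega>
    using bound[OF that] nonneg by (simp add: abs_mult mult_left_mono mult.commute[of K])
  have 4: "integrable M (\<lambda>\<omega>'. ?h ((W \<omega>, q \<omega>), \<xi> \<omega>'))" if "\<omega> \<in> space M" for \<omega>
    using int[OF that] by simp
  have 5: "integrable M (\<lambda>\<omega>. K * q \<omega>)" using int_q by simp
  show "integrable M (\<lambda>\<omega>. q \<omega> * h (W \<omega>, U \<omega>))"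
    using freezing(1)[OF 1 \<xi> U ind 2 4 3 5] by simp
  have "(\<integral>\<omega>. q \<omega> * h (W \<omega>, U \<omega>) \<partial>M) = (\<integral>\<omega>. \<integral>\<omega>'. q \<omega> * h (W \<omega>, \<xi> \<omega>') \<partial>M \<partial>M)"
    using freezing(2)[OF 1 \<xi> U ind 2 4 3 5] by simp
  also have "\<dots> \<le> (\<integral>\<omega>. K * q \<omega> \<partial>M)"
  proof (rule integral_mono)
    show "integrable M (\<lambda>\<omega>. \<integral>\<omega>'. q \<omega> * h (W \<omega>, \<xi> \<omega>') \<partial>M)"
      using freezing(3)[OF 1 \<xi> U ind 2 4 3 5] by simp
    show "(\<integral>\<omega>'. q \<omega> * h (W \<omega>, \<xi> \<omega>') \<partial>M) \<le> K * q \<omega>" if "\<omega> \<in> space M" for \<omega>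
      using bound[OF that] nonneg by (simp add: mult_left_mono mult.commute[of K])
  qed (rule 5)
  finally show "(\<integral>\<omega>. q \<omega> * h (W \<omega>, U \<omega>) \<partial>M) \<le> K * (\<integral>\<omega>. q \<omega> \<partial>M)" by simp
qed

text \<open>Square-integrable orthogonal increments have additive variances. Orthogonality may use the
  integrability of the partial sum, which the induction provides along the way.\<close>

lemma expectation_norm_sum_le:
  fixes n :: "nat \<Rightarrow> 'a \<Rightarrow> 'b::euclidean_space"
  assumes n: "\<And>t. t < k \<Longrightarrow> n t \<in> borel_measurable M"
    and sq: "\<And>t. t < k \<Longrightarrow> integrable M (\<lambda>\<omega>. (norm (n t \<omega>))\<^sup>2)"
    and var: "\<And>t. t < k \<Longrightarrow> (\<integral>\<omega>. (norm (n t \<omega>))\<^sup>2 \<partial>M) \<le> \<sigma>\<^sup>2"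
    and orth: "\<And>t. t < k \<Longrightarrow> integrable M (\<lambda>\<omega>. norm (\<Sum>s<t. n s \<omega>)) \<Longrightarrow>
      integrable M (\<lambda>\<omega>. (\<Sum>s<t. n s \<omega>) \<bullet> n t \<omega>) \<and> (\<integral>\<omega>. (\<Sum>s<t. n s \<omega>) \<bullet> n t \<omega> \<partial>M) = 0"
    and "0 < \<sigma>"
  shows "integrable M (\<lambda>\<omega>. norm (\<Sum>t<k. n t \<omega>))"
    and "(\<integral>\<omega>. norm (\<Sum>t<k. n t \<omega>) \<partial>M) \<le> \<sigma> * sqrt (real k)"
proof -
  let ?W = "\<lambda>j \<omega>. \<Sum>t<j. n t \<omega>"
  have meas: "(\<lambda>\<omega>. norm (?W j \<omega>)) \<in> borel_measurable M" if "j \<le> k" for j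
  proof -
    have "?W j \<in> borel_measurable M"
      using n that by (intro borel_measurable_sum) auto
    then show ?thesis by (rule measurable_compose[OF _ borel_measurable_norm])
  qed
  have step: "j \<le> k \<Longrightarrow> integrable M (\<lambda>\<omega>. (norm (?W j \<omega>))\<^sup>2)
      \<and> (\<integral>\<omega>. (norm (?W j \<omega>))\<^sup>2 \<partial>M) \<le> real j * \<sigma>\<^sup>2" for j
  proof (induction j)
    case (Suc j)
    then have IH: "integrable M (\<lambda>\<omega>. (norm (?W j \<omega>))\<^sup>2)"
      "(\<integral>\<omega>. (norm (?W j \<omega>))\<^sup>2 \<partial>M) \<le> real j * \<sigma>\<^sup>2" and j: "j < k" by auto
    have le: "(\<integral>\<omega>. (norm (?W j \<omega>))\<^sup>2 \<partial>M) \<le> (sqrt (real j * \<sigma>\<^sup>2 + 1))\<^sup>2"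
      using IH(2) by simp
    have "0 < sqrt (real j * \<sigma>\<^sup>2 + 1)" by (simp add: add_nonneg_pos)
    with IH(1) le have "integrable M (\<lambda>\<omega>. norm (?W j \<omega>))"
      using j by (intro expectation_le_of_square(1)[OF meas, of j "sqrt (real j * \<sigma>\<^sup>2 + 1)"]) auto
    from orth[OF j this]
    have o: "integrable M (\<lambda>\<omega>. ?W j \<omega> \<bullet> n j \<omega>)" "(\<integral>\<omega>. ?W j \<omega> \<bullet> n j \<omega> \<partial>M) = 0" by auto
    have eq: "(norm (?W (Suc j) \<omega>))\<^sup>2 = (norm (?W j \<omega>))\<^sup>2 + 2 * (?W j \<omega> \<bullet> n j \<omega>) + (norm (n j \<omega>))\<^sup>2"
      for \<omega> unfolding power2_norm_eq_inner
      by (simp add: inner_add_left inner_add_right inner_commute)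
    show ?case
      unfolding eq using IH o sq[OF j] var[OF j] by (simp add: distrib_right)
  qed simp
  have "integrable M (\<lambda>\<omega>. norm (?W k \<omega>)) \<and> (\<integral>\<omega>. norm (?W k \<omega>) \<partial>M) \<le> \<sigma> * sqrt (real k)"
  proof (cases "k = 0")
    case False
    have "(\<integral>\<omega>. (norm (?W k \<omega>))\<^sup>2 \<partial>M) \<le> (\<sigma> * sqrt (real k))\<^sup>2"
      using step[of k] by (simp add: power_mult_distrib mult.commute)
    then show ?thesis
      using expectation_le_of_square[OF meas[of k], of "\<sigma> * sqrt (real k)"]
        step[of k] False \<open>0 < \<sigma>\<close> by simp
  qed simp
  then show "integrable M (\<lambda>\<omega>. norm (?W k \<omega>))" "(\<integral>\<omega>. norm (?W k \<omega>) \<partial>M) \<le> \<sigma> * sqrt (real k)"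
    by auto
qed

end

section \<open>Measurability of vectors and matrices\<close>

lemma borel_measurable_vec_nth [measurable (raw)]:
  fixes f :: "'a \<Rightarrow> ('b::euclidean_space)^'n"
  assumes "f \<in> borel_measurable M"
  shows "(\<lambda>\<omega>. f \<omega> $ i) \<in> borel_measurable M"
  by (rule measurable_compose[OF assms])
    (intro borel_measurable_continuous_onI continuous_intros)

lemma borel_measurable_vecI:
  fixes f :: "'a \<Rightarrow> real^'n"
  assumes "\<And>i. (\<lambda>\<omega>. f \<omega> $ i) \<in> borel_measurable M"
  shows "f \<in> borel_measurable M"
  unfolding borel_measurable_euclidean_space[of f]
  using assms by (auto simp: Basis_vec_def inner_axis)

lemma borel_measurable_matrix_vector [measurable (raw)]:
  fixes A :: "'a \<Rightarrow> real^'n^'m"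
  assumes [measurable]: "A \<in> borel_measurable M" "u \<in> borel_measurable M"
  shows "(\<lambda>\<omega>. A \<omega> *v u \<omega>) \<in> borel_measurable M"
proof (rule borel_measurable_vecI)
  fix i
  have "(\<lambda>\<omega>. A \<omega> $ i \<bullet> u \<omega>) \<in> borel_measurable M" by measurable
  then show "(\<lambda>\<omega>. (A \<omega> *v u \<omega>) $ i) \<in> borel_measurable M"
    by (simp add: matrix_vector_mul_component)
qed

lemma borel_measurable_pos_part [measurable (raw)]:
  assumes [measurable]: "u \<in> borel_measurable M"
  shows "(\<lambda>\<omega>. pos_part (u \<omega>)) \<in> borel_measurable M"
  by (rule borel_measurable_vecI) (simp add: pos_part_def)

lemma norm_pos_part_le: "norm (pos_part u) \<le> norm u"
  by (rule norm_le_componentwise_cart) (auto simp: pos_part_def)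

text \<open>The outer product \<open>z u\<^sup>T\<close>. It rewrites \<open>(A *v u) \<bullet> z\<close> as an inner product with the matrix \<open>A\<close>, so
  that matrix noise can be treated as vector noise.\<close>

definition outer :: "real^'m \<Rightarrow> real^'n \<Rightarrow> real^'n^'m" where
  "outer z u = (\<chi> i. z $ i *\<^sub>R u)"

lemma inner_outer: "outer z u \<bullet> A = (A *v u) \<bullet> z"
proof -
  have "outer z u \<bullet> A = (\<Sum>i\<in>UNIV. outer z u $ i \<bullet> A $ i)" by (rule inner_vec_def)
  also have "\<dots> = (\<Sum>i\<in>UNIV. (A *v u) $ i * z $ i)"
    by (simp add: outer_def matrix_vector_mul_component inner_commute mult.commute)
  finally show ?thesis by (simp add: inner_vec_def)
qed

lemma norm_outer: "norm (outer z u) = norm z * norm u"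
proof (rule power2_eq_imp_eq)
  show "(norm (outer z u))\<^sup>2 = (norm z * norm u)\<^sup>2"
    by (simp add: outer_def norm_vec_square[of "\<chi> i. z $ i *\<^sub>R u"] norm_vec_square[of z]
        power_mult_distrib sum_distrib_right[symmetric])
qed simp_all

lemma borel_measurable_outer [measurable (raw)]:
  fixes z :: "'a \<Rightarrow> real^'m" and u :: "'a \<Rightarrow> real^'n"
  assumes [measurable]: "z \<in> borel_measurable M" "u \<in> borel_measurable M"
  shows "(\<lambda>\<omega>. outer (z \<omega>) (u \<omega>)) \<in> borel_measurable M"
  unfolding borel_measurable_euclidean_space[of "\<lambda>\<omega>. outer (z \<omega>) (u \<omega>)"]
  by (auto simp: Basis_vec_def inner_axis outer_def)

lemma integrable_vec:
  fixes f :: "'a \<Rightarrow> real^'n"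
  assumes "\<And>i. integrable M (\<lambda>\<omega>. f \<omega> $ i)"
  shows "integrable M f" and "(\<integral>\<omega>. f \<omega> \<partial>M) $ i = (\<integral>\<omega>. f \<omega> $ i \<partial>M)"
proof -
  have eq: "f = (\<lambda>\<omega>. \<Sum>i\<in>UNIV. f \<omega> $ i *\<^sub>R axis i 1)"
    by (intro ext) (simp only: scalar_mult_eq_scaleR[symmetric] basis_expansion)
  show "integrable M f" by (subst eq) (use assms in auto)
  then show "(\<integral>\<omega>. f \<omega> \<partial>M) $ i = (\<integral>\<omega>. f \<omega> $ i \<partial>M)"
    by (rule integral_bounded_linear[OF bounded_linear_vec_nth, symmetric])
qed

section \<open>The pathwise inequality\<close>

text \<open>A run of the algorithm with constant step sizes. The weights \<open>\<tau>\<close> are restricted only by what the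
  telescoping argument for \<open>y\<close> requires.\<close>

locale ec_scgd = prob_space M
  for M :: "'w measure" +
  fixes S1 :: "'a measure" and S2 :: "'b measure" and Z :: "'m::finite \<Rightarrow> 'c measure"
    and \<xi>1 :: "'w \<Rightarrow> 'a" and \<xi>2 :: "'w \<Rightarrow> 'b" and \<zeta> :: "'w \<Rightarrow> 'm \<Rightarrow> 'c"
    and X :: "(real^'dx) set"
    and f1 :: "real^'dy \<Rightarrow> real" and f2 :: "real^'dx \<Rightarrow> real^'dy" and g :: "real^'dx \<Rightarrow> real^'m"
    and f2s :: "real^'dx \<Rightarrow> 'b \<Rightarrow> real^'dy" and gs :: "'m \<Rightarrow> real^'dx \<Rightarrow> 'c \<Rightarrow> real"
    and df1 :: "real^'dy \<Rightarrow> real^'dy"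
    and df1s :: "real^'dy \<Rightarrow> 'a \<Rightarrow> real^'dy" and df2s :: "real^'dx \<Rightarrow> 'b \<Rightarrow> real^'dy^'dx"
    and dgs :: "real^'dx \<Rightarrow> ('m \<Rightarrow> 'c) \<Rightarrow> real^'m^'dx"
    and C\<^sub>f\<^sub>1 C\<^sub>f\<^sub>2 \<sigma>\<^sub>f\<^sub>2 L\<^sub>f\<^sub>1 D\<^sub>X C\<^sub>g \<sigma>\<^sub>g :: real
    and xopt x0 :: "real^'dx" and lopt :: "real^'m"
    and \<alpha> \<eta> :: real and \<tau> :: "nat \<Rightarrow> real" and N :: nat
    and u10 :: "nat \<Rightarrow> 'w \<Rightarrow> 'a" and u20 u21 :: "nat \<Rightarrow> 'w \<Rightarrow> 'b"
    and z0 z1 :: "nat \<Rightarrow> 'w \<Rightarrow> 'm \<Rightarrow> 'c"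
    and x :: "nat \<Rightarrow> 'w \<Rightarrow> real^'dx" and y :: "nat \<Rightarrow> 'w \<Rightarrow> real^'dy"
    and l :: "nat \<Rightarrow> 'w \<Rightarrow> real^'m"
  assumes sources [measurable]: "\<xi>1 \<in> measurable M S1" "\<xi>2 \<in> measurable M S2"
      "\<zeta> \<in> measurable M (Pi\<^sub>M UNIV Z)"
    and samples: "independent_samples M S1 S2 (Pi\<^sub>M UNIV Z) \<xi>1 \<xi>2 \<zeta> N u10 u20 u21 z0 z1"
    and oracle_measurable [measurable]: "(\<lambda>(v, s). df1s v s) \<in> borel_measurable (borel \<Otimes>\<^sub>M S1)"
      "(\<lambda>(w, s). f2s w s) \<in> borel_measurable (borel \<Otimes>\<^sub>M S2)"
      "(\<lambda>(w, s). df2s w s) \<in> borel_measurable (borel \<Otimes>\<^sub>M S2)"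
      "\<And>j. (\<lambda>(w, s). gs j w s) \<in> borel_measurable (borel \<Otimes>\<^sub>M Z j)"
      "(\<lambda>(w, s). dgs w s) \<in> borel_measurable (borel \<Otimes>\<^sub>M Pi\<^sub>M UNIV Z)"
    and constants: "0 < C\<^sub>f\<^sub>1" "0 < C\<^sub>f\<^sub>2" "0 < \<sigma>\<^sub>f\<^sub>2" "0 < L\<^sub>f\<^sub>1" "0 < D\<^sub>X" "0 < C\<^sub>g" "0 < \<sigma>\<^sub>g" "0 < \<alpha>" "0 < \<eta>"
    and weights: "\<tau> 0 = 0" "\<And>t. t < N \<Longrightarrow> 0 \<le> \<tau> t" "\<And>t. Suc t < N \<Longrightarrow> \<tau> (Suc t) \<le> 1 + \<tau> t"
    and convex_X: "convex X" and diameter: "\<And>w. w \<in> X \<Longrightarrow> norm (w - xopt) \<le> D\<^sub>X"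
    and continuous: "continuous_on UNIV f1" "continuous_on UNIV f2" "continuous_on UNIV g"
    and gradient: "\<And>a b. f1 b + df1 b \<bullet> (a - b) \<le> f1 a"
    and lipschitz: "L\<^sub>f\<^sub>1-lipschitz_on UNIV df1"
    and monotone: "affine_map f2 \<or> (\<forall>v. df1 v \<in> nonneg_orthant)"
    and convex_g: "\<And>j. convex_on UNIV (\<lambda>w. g w $ j)"
    and saddle: "saddle_point X (\<lambda>w. f1 (f2 w)) g xopt lopt"
    and inner_value: "\<And>w. w \<in> X \<Longrightarrow> integrable M (\<lambda>\<omega>. f2s w (\<xi>2 \<omega>)) \<and> f2 w = (\<integral>\<omega>. f2s w (\<xi>2 \<omega>) \<partial>M)"
      "\<And>w. w \<in> X \<Longrightarrow>
           integrable M (\<lambda>\<omega>. (norm (f2s w (\<xi>2 \<omega>) - f2 w))\<^sup>2) \<and>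
           (\<integral>\<omega>. (norm (f2s w (\<xi>2 \<omega>) - f2 w))\<^sup>2 \<partial>M) \<le> \<sigma>\<^sub>f\<^sub>2\<^sup>2"
    and inner_subgradient: "\<And>w. w \<in> X \<Longrightarrow>
           integrable M (\<lambda>\<omega>. df2s w (\<xi>2 \<omega>)) \<and>
           (\<integral>\<omega>. df2s w (\<xi>2 \<omega>) \<partial>M) \<in> subgradient_matrices f2 w \<and>
           integrable M (\<lambda>\<omega>. (norm (df2s w (\<xi>2 \<omega>)))\<^sup>2) \<and>
           (\<integral>\<omega>. (norm (df2s w (\<xi>2 \<omega>)))\<^sup>2 \<partial>M) \<le> C\<^sub>f\<^sub>2\<^sup>2"
    and outer_gradient: "\<And>v. integrable M (\<lambda>\<omega>. df1s v (\<xi>1 \<omega>)) \<and>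
           (\<integral>\<omega>. df1s v (\<xi>1 \<omega>) \<partial>M) = df1 v \<and>
           integrable M (\<lambda>\<omega>. (norm (df1s v (\<xi>1 \<omega>)))\<^sup>2) \<and>
           (\<integral>\<omega>. (norm (df1s v (\<xi>1 \<omega>)))\<^sup>2 \<partial>M) \<le> C\<^sub>f\<^sub>1\<^sup>2"
    and constraint_value: "\<And>j w. w \<in> X \<Longrightarrow>
           integrable M (\<lambda>\<omega>. gs j w (\<zeta> \<omega> j)) \<and> g w $ j = (\<integral>\<omega>. gs j w (\<zeta> \<omega> j) \<partial>M)"
      "\<And>w. w \<in> X \<Longrightarrow>
           integrable M (\<lambda>\<omega>. (norm (sampled_constraints gs w (\<zeta> \<omega>) - g w))\<^sup>2) \<and>
           (\<integral>\<omega>. (norm (sampled_constraints gs w (\<zeta> \<omega>) - g w))\<^sup>2 \<partial>M) \<le> \<sigma>\<^sub>g\<^sup>2"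
    and constraint_subgradient: "\<And>w. w \<in> X \<Longrightarrow>
           integrable M (\<lambda>\<omega>. dgs w (\<zeta> \<omega>)) \<and>
           (\<integral>\<omega>. dgs w (\<zeta> \<omega>) \<partial>M) \<in> subgradient_matrices g w \<and>
           integrable M (\<lambda>\<omega>. (norm (dgs w (\<zeta> \<omega>)))\<^sup>2) \<and>
           (\<integral>\<omega>. (norm (dgs w (\<zeta> \<omega>)))\<^sup>2 \<partial>M) \<le> C\<^sub>g\<^sup>2"
    and x0: "x0 \<in> X"
    and run: "\<And>\<omega>. \<omega> \<in> space M \<Longrightarrow>
           ec_scgd_run X f2s df2s df1s gs dgs (\<lambda>_. \<alpha>) (\<lambda>_. \<eta>) \<tau> N x0 0
             (\<lambda>t. u10 t \<omega>) (\<lambda>t. u20 t \<omega>) (\<lambda>t. u21 t \<omega>) (\<lambda>t. z0 t \<omega>) (\<lambda>t. z1 t \<omega>)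
             (\<lambda>t. x t \<omega>) (\<lambda>t. y t \<omega>) (\<lambda>t. l t \<omega>)"
begin

definition "F w = f1 (f2 w)"
definition "mean_df2 w = (\<integral>\<omega>. df2s w (\<xi>2 \<omega>) \<partial>M)"
definition "mean_dg w = (\<integral>\<omega>. dgs w (\<zeta> \<omega>) \<partial>M)"

lemma mean_norm_le:
  fixes h :: "'w \<Rightarrow> 'v::euclidean_space"
  assumes "integrable M h" and "integrable M (\<lambda>\<omega>. (norm (h \<omega>))\<^sup>2)"
    and "(\<integral>\<omega>. (norm (h \<omega>))\<^sup>2 \<partial>M) \<le> c\<^sup>2" and "0 < c"
  shows "(\<integral>\<omega>. norm (h \<omega>) \<partial>M) \<le> c" and "norm (\<integral>\<omega>. h \<omega> \<partial>M) \<le> c"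
proof -
  show "(\<integral>\<omega>. norm (h \<omega>) \<partial>M) \<le> c"
    using assms(1) by (intro expectation_le_of_square(2)[OF _ assms(2-4)]) auto
  with integral_norm_bound[of M h] show "norm (\<integral>\<omega>. h \<omega> \<partial>M) \<le> c" by linarith
qed

lemma mean_df2:
  assumes "w \<in> X"
  shows "mean_df2 w \<in> subgradient_matrices f2 w" and "norm (mean_df2 w) \<le> C\<^sub>f\<^sub>2"
  using inner_subgradient[OF assms] constants mean_norm_le(2)[of "\<lambda>\<omega>. df2s w (\<xi>2 \<omega>)" C\<^sub>f\<^sub>2]
  by (auto simp: mean_df2_def)

lemma mean_dg:
  assumes "w \<in> X"
  shows "mean_dg w \<in> subgradient_matrices g w" and "norm (mean_dg w) \<le> C\<^sub>g"
  using constraint_subgradient[OF assms] constants mean_norm_le(2)[of "\<lambda>\<omega>. dgs w (\<zeta> \<omega>)" C\<^sub>g]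
  by (auto simp: mean_dg_def)

lemma norm_df1_le: "norm (df1 v) \<le> C\<^sub>f\<^sub>1"
  using outer_gradient[of v] constants mean_norm_le(2)[of "\<lambda>\<omega>. df1s v (\<xi>1 \<omega>)" C\<^sub>f\<^sub>1] by auto

text \<open>This one inequality gives the subgradient inequality towards the optimum, Jensen's inequality at
  the mean iterate and the Lipschitz bound for the objective.\<close>

lemma inner_decrease:
  assumes "w \<in> X"
  shows "df1 v \<bullet> (f2 w - f2 z) \<le> (mean_df2 w *v df1 v) \<bullet> (w - z)"
  using monotone by (intro linearised_decrease[OF mean_df2(1)[OF assms]]) auto

lemma F_lipschitz:
  assumes "w \<in> X"
  shows "F w - F z \<le> C\<^sub>f\<^sub>1 * C\<^sub>f\<^sub>2 * norm (w - z)"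
proof -
  have "F w - F z \<le> df1 (f2 w) \<bullet> (f2 w - f2 z)"
    using gradient[of "f2 w" "f2 z"] by (simp add: F_def inner_diff_right)
  also have "\<dots> \<le> (mean_df2 w *v df1 (f2 w)) \<bullet> (w - z)" by (rule inner_decrease[OF assms])
  also have "\<dots> \<le> norm (mean_df2 w *v df1 (f2 w)) * norm (w - z)" by (rule norm_cauchy_schwarz)
  also have "\<dots> \<le> (C\<^sub>f\<^sub>2 * C\<^sub>f\<^sub>1) * norm (w - z)"
    using mean_df2(2)[OF assms] norm_df1_le constants
    by (intro mult_right_mono order.trans[OF norm_matrix_vector_le] mult_mono) auto
  finally show ?thesis by (simp add: mult.commute)
qed

lemma g_lipschitz:
  assumes "w \<in> X" "z \<in> X"
  shows "(norm (g w - g z))\<^sup>2 \<le> 2 * C\<^sub>g\<^sup>2 * (norm (w - z))\<^sup>2"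
proof -
  have "(norm (mean_dg w))\<^sup>2 + (norm (mean_dg z))\<^sup>2 \<le> C\<^sub>g\<^sup>2 + C\<^sub>g\<^sup>2"
    using assms mean_dg(2) constants by (intro add_mono power_mono) auto
  then have "((norm (mean_dg w))\<^sup>2 + (norm (mean_dg z))\<^sup>2) * (norm (w - z))\<^sup>2
      \<le> (C\<^sub>g\<^sup>2 + C\<^sub>g\<^sup>2) * (norm (w - z))\<^sup>2"
    by (intro mult_right_mono) auto
  with subgradient_lipschitz[OF mean_dg(1) mean_dg(1), OF assms] show ?thesis by simp
qed

lemma xopt: "xopt \<in> X" and lopt: "lopt \<in> nonneg_orthant"
  using saddle by (auto simp: saddle_point_def)

text \<open>Raising one multiplier at a saddle point must not raise the Lagrangian.\<close>

lemma g_xopt_nonpos: "g xopt $ j \<le> 0"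
proof -
  have "lagrangian F g xopt (lopt + axis j 1) \<le> lagrangian F g xopt lopt"
    using saddle lopt xopt unfolding saddle_point_def F_def
    by (auto simp: nonneg_orthant_def axis_def)
  then show ?thesis by (simp add: lagrangian_def inner_add_left inner_axis inner_commute[of "axis j 1"])
qed

lemma complementary_slackness: "lopt \<bullet> g xopt = 0"
proof -
  have "(0 :: real^'m) \<in> nonneg_orthant" by (simp add: nonneg_orthant_def)
  then have "lagrangian F g xopt 0 \<le> lagrangian F g xopt lopt"
    using saddle xopt unfolding saddle_point_def F_def by blast
  moreover have "lopt \<bullet> g xopt \<le> lopt \<bullet> 0"
    using inner_nonneg_mono[OF lopt, of "g xopt" 0] g_xopt_nonpos by simp
  ultimately show ?thesis by (simp add: lagrangian_def)
qed

lemma lagrangian_lower_bound: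
  assumes "w \<in> X" shows "F xopt \<le> F w + lopt \<bullet> g w"
  using saddle assms lopt complementary_slackness
  by (auto simp: saddle_point_def lagrangian_def F_def)

text \<open>The value of \<open>y (t+1)\<close> for a noiseless evaluation of \<open>f2\<close>. Unlike \<open>y (t+1)\<close> it depends on the
  past only, so the gradient of \<open>f1\<close> there is orthogonal to the noise of step \<open>t\<close>.\<close>

definition "ypred t \<omega> = (1 / (1 + \<tau> t)) *\<^sub>R (f2 (x t \<omega>) + \<tau> t *\<^sub>R y t \<omega>)"
definition "noise_f t \<omega> = f2s (x t \<omega>) (u21 t \<omega>) - f2 (x t \<omega>)"
definition "noise_g t \<omega> = sampled_constraints gs (x t \<omega>) (z1 t \<omega>) - g (x t \<omega>)"
definition "dir_f t \<omega> = df2s (x t \<omega>) (u20 t \<omega>) *v df1s (y (Suc t) \<omega>) (u10 t \<omega>)"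
definition "dir_g t \<omega> = dgs (x t \<omega>) (z0 t \<omega>) *v l t \<omega>"
definition "mean_dir_f t \<omega> = mean_df2 (x t \<omega>) *v df1 (y (Suc t) \<omega>)"
definition "mean_dir_g t \<omega> = mean_dg (x t \<omega>) *v l t \<omega>"
text \<open>What one step costs beyond the telescoping terms: the inner products have mean zero and the
  squares have bounded means. The term with \<open>L\<^sub>f\<^sub>1\<close> pays for moving the gradient from \<open>y (t+1)\<close> to
  \<open>ypred t\<close>; the constant \<open>2 C\<^sub>g\<^sup>2 D\<^sub>X\<^sup>2\<close> bounds the squared variation of the constraints between the
  iterate and the optimum.\<close>

definition "remainder t \<omega> = df1 (ypred t \<omega>) \<bullet> noise_f t \<omega> + L\<^sub>f\<^sub>1 / (1 + \<tau> t) * (norm (noise_f t \<omega>))\<^sup>2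
   - (dir_f t \<omega> - mean_dir_f t \<omega>) \<bullet> (x t \<omega> - xopt) - (dir_g t \<omega> - mean_dir_g t \<omega>) \<bullet> (x t \<omega> - xopt)
   + l t \<omega> \<bullet> noise_g t \<omega> + (norm (dir_f t \<omega> + dir_g t \<omega>))\<^sup>2 / (2 * \<eta>)
   + ((norm (noise_g t \<omega>))\<^sup>2 + 2 * C\<^sub>g\<^sup>2 * D\<^sub>X\<^sup>2) / \<alpha>"

context
  fixes \<omega> assumes \<omega>: "\<omega> \<in> space M"
begin

lemma init: "x 0 \<omega> = x0" "y 0 \<omega> = 0" "l 0 \<omega> = 0"
  using run[OF \<omega>] by (auto simp: ec_scgd_run_def)

lemma steps:
  assumes "t < N"
  shows "y (Suc t) \<omega> = (1 / (1 + \<tau> t)) *\<^sub>R (f2s (x t \<omega>) (u21 t \<omega>) + \<tau> t *\<^sub>R y t \<omega>)"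
    and "is_arg_min (dist (x t \<omega> - (1 / \<eta>) *\<^sub>R (dir_f t \<omega> + dir_g t \<omega>))) (\<lambda>p. p \<in> X) (x (Suc t) \<omega>)"
    and "l (Suc t) \<omega> = pos_part (l t \<omega> + (1 / \<alpha>) *\<^sub>R sampled_constraints gs (x t \<omega>) (z1 t \<omega>))"
  using run[OF \<omega>] assms by (auto simp: ec_scgd_run_def dir_f_def dir_g_def)

lemma x_in_X: "t \<le> N \<Longrightarrow> x t \<omega> \<in> X"
  using init x0 steps(2) by (cases t) (auto simp: is_arg_min_def)

lemma l_nonneg: "t \<le> N \<Longrightarrow> l t \<omega> \<in> nonneg_orthant"
  using init steps(3) pos_part_nonneg by (cases t) (auto simp: nonneg_orthant_def)

lemma mean_in_X:
  assumes "0 < k" and "\<And>t. t \<in> T \<Longrightarrow> t \<le> N" and "finite T" and "card T = k"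
  shows "(1 / real k) *\<^sub>R (\<Sum>t\<in>T. x t \<omega>) \<in> X"
  using convex_sum[OF assms(3) convex_X, of "\<lambda>_. 1 / real k" "\<lambda>t. x t \<omega>"] assms x_in_X
  by (simp add: scaleR_sum_right)

text \<open>The pairing of the multiplier with \<open>g (x t) - g xopt\<close> occurs in the primal step with one sign and
  in the dual step with the other, and cancels. This leaves the pairing with \<open>v\<close>.\<close>

lemma one_step:
  assumes t: "t < N" and v: "v \<in> nonneg_orthant"
  shows "df1 (y (Suc t) \<omega>) \<bullet> (f2s (x t \<omega>) (u21 t \<omega>) - f2 xopt) + g (x t \<omega>) \<bullet> v
     + \<eta> / 2 * ((norm (x (Suc t) \<omega> - xopt))\<^sup>2 - (norm (x t \<omega> - xopt))\<^sup>2)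
     + \<alpha> / 2 * ((norm (l (Suc t) \<omega> - v))\<^sup>2 - (norm (l t \<omega> - v))\<^sup>2)
     \<le> remainder t \<omega> - noise_g t \<omega> \<bullet> v"
proof -
  define x' y' l' s q G where d: "x' = x t \<omega>" "y' = y (Suc t) \<omega>" "l' = l t \<omega>"
    "s = f2s x' (u21 t \<omega>)" "q = df1 y'" "G = sampled_constraints gs x' (z1 t \<omega>)"
  have X: "x' \<in> X" and l': "l' \<in> nonneg_orthant" using x_in_X l_nonneg t by (auto simp: d)
  have \<delta>: "noise_f t \<omega> = s - f2 x'" and \<epsilon>: "noise_g t \<omega> = G - g x'"
    by (auto simp: noise_f_def noise_g_def d)
  have noise: "q \<bullet> (s - f2 x') \<le> df1 (ypred t \<omega>) \<bullet> (s - f2 x') + L\<^sub>f\<^sub>1 / (1 + \<tau> t) * (norm (s - f2 x'))\<^sup>2"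
  proof -
    have "y' - ypred t \<omega> = (1 / (1 + \<tau> t)) *\<^sub>R (s - f2 x')"
      using steps(1)[OF t] by (simp add: d ypred_def algebra_simps)
    then have "norm (q - df1 (ypred t \<omega>)) \<le> L\<^sub>f\<^sub>1 * (norm (s - f2 x') / (1 + \<tau> t))"
      using lipschitz_onD[OF lipschitz, of y' "ypred t \<omega>"] weights(2)[OF t]
      by (simp add: d dist_norm)
    then have "norm (q - df1 (ypred t \<omega>)) * norm (s - f2 x')
        \<le> L\<^sub>f\<^sub>1 * (norm (s - f2 x') / (1 + \<tau> t)) * norm (s - f2 x')"
      by (rule mult_right_mono) simp
    with norm_cauchy_schwarz[of "q - df1 (ypred t \<omega>)" "s - f2 x'"]
    show ?thesis by (simp add: inner_diff_left power2_eq_square)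
  qed
  have objective: "q \<bullet> (f2 x' - f2 xopt) \<le> mean_dir_f t \<omega> \<bullet> (x' - xopt)"
    using inner_decrease[OF X] by (simp add: mean_dir_f_def d)
  have constraint: "(g x' - g xopt) \<bullet> l' \<le> mean_dir_g t \<omega> \<bullet> (x' - xopt)"
    using linearised_decrease[OF mean_dg(1)[OF X] disjI2[OF l'], of xopt]
    by (simp add: mean_dir_g_def d inner_commute)
  have primal: "(dir_f t \<omega> + dir_g t \<omega>) \<bullet> (x' - xopt)
      \<le> \<eta> / 2 * ((norm (x' - xopt))\<^sup>2 - (norm (x (Suc t) \<omega> - xopt))\<^sup>2)
        + (norm (dir_f t \<omega> + dir_g t \<omega>))\<^sup>2 / (2 * \<eta>)"
    using projected_step_inequality[OF convex_X steps(2)[OF t] xopt] constants by (simp add: d)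
  have dual: "G \<bullet> v - (G - g xopt) \<bullet> l'
      \<le> \<alpha> / 2 * ((norm (l' - v))\<^sup>2 - (norm (l (Suc t) \<omega> - v))\<^sup>2) + (norm (G - g xopt))\<^sup>2 / (2 * \<alpha>)"
    using dual_step_inequality[OF _ v g_xopt_nonpos steps(3)[OF t]] constants by (simp add: d)
  have "(norm (G - g xopt))\<^sup>2 \<le> 2 * (norm (G - g x'))\<^sup>2 + 4 * C\<^sub>g\<^sup>2 * D\<^sub>X\<^sup>2"
  proof -
    have "(norm (g x' - g xopt))\<^sup>2 \<le> 2 * C\<^sub>g\<^sup>2 * D\<^sub>X\<^sup>2"
      using g_lipschitz[OF X xopt] diameter[OF X]
      by (elim order.trans) (intro mult_left_mono power_mono, auto)
    moreover have "(norm ((G - g x') + (g x' - g xopt)))\<^sup>2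
        \<le> 2 * (norm (G - g x'))\<^sup>2 + 2 * (norm (g x' - g xopt))\<^sup>2"
      by (rule norm_add_square_le)
    ultimately show ?thesis by simp
  qed
  then have "(norm (G - g xopt))\<^sup>2 / (2 * \<alpha>) \<le> (2 * (norm (G - g x'))\<^sup>2 + 4 * C\<^sub>g\<^sup>2 * D\<^sub>X\<^sup>2) / (2 * \<alpha>)"
    using constants by (intro divide_right_mono) auto
  also have "\<dots> = ((norm (G - g x'))\<^sup>2 + 2 * C\<^sub>g\<^sup>2 * D\<^sub>X\<^sup>2) / \<alpha>"
    using constants by (simp add: field_simps)
  finally have size: "(norm (G - g xopt))\<^sup>2 / (2 * \<alpha>) \<le> ((norm (G - g x'))\<^sup>2 + 2 * C\<^sub>g\<^sup>2 * D\<^sub>X\<^sup>2) / \<alpha>" .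
  have split: "q \<bullet> (s - f2 xopt) = q \<bullet> (s - f2 x') + q \<bullet> (f2 x' - f2 xopt)"
    "g x' \<bullet> v = G \<bullet> v - (G - g x') \<bullet> v"
    "(G - g xopt) \<bullet> l' = (g x' - g xopt) \<bullet> l' + l' \<bullet> (G - g x')"
    "(dir_f t \<omega> + dir_g t \<omega>) \<bullet> (x' - xopt) = dir_f t \<omega> \<bullet> (x' - xopt) + dir_g t \<omega> \<bullet> (x' - xopt)"
    by (simp add: inner_diff_right, simp add: inner_diff_left,
        simp add: inner_diff_left inner_diff_right inner_commute, rule inner_add_left)
  have flip: "r / 2 * (a - b) = - (r / 2 * (b - a))" for r a b :: real by (simp add: right_diff_distrib)
  have rem: "remainder t \<omega> = df1 (ypred t \<omega>) \<bullet> (s - f2 x') + L\<^sub>f\<^sub>1 / (1 + \<tau> t) * (norm (s - f2 x'))\<^sup>2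
     - (dir_f t \<omega> \<bullet> (x' - xopt) - mean_dir_f t \<omega> \<bullet> (x' - xopt))
     - (dir_g t \<omega> \<bullet> (x' - xopt) - mean_dir_g t \<omega> \<bullet> (x' - xopt))
     + l' \<bullet> (G - g x') + (norm (dir_f t \<omega> + dir_g t \<omega>))\<^sup>2 / (2 * \<eta>)
     + ((norm (G - g x'))\<^sup>2 + 2 * C\<^sub>g\<^sup>2 * D\<^sub>X\<^sup>2) / \<alpha>"
    unfolding remainder_def \<delta> \<epsilon> inner_diff_left[of "dir_f t \<omega>"] inner_diff_left[of "dir_g t \<omega>"]
    by (simp only: d)
  have "q \<bullet> (s - f2 xopt) + g x' \<bullet> v
     + \<eta> / 2 * ((norm (x (Suc t) \<omega> - xopt))\<^sup>2 - (norm (x' - xopt))\<^sup>2)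
     + \<alpha> / 2 * ((norm (l (Suc t) \<omega> - v))\<^sup>2 - (norm (l' - v))\<^sup>2)
     \<le> remainder t \<omega> - noise_g t \<omega> \<bullet> v"
    unfolding rem \<epsilon> flip[of _ "(norm (x (Suc t) \<omega> - xopt))\<^sup>2"] flip[of _ "(norm (l (Suc t) \<omega> - v))\<^sup>2"]
    using noise objective constraint primal dual size split by linarith
  then show ?thesis by (simp only: d)
qed

text \<open>Because \<open>v\<close> is arbitrary, its pairing with the noise is bounded by the norm of the accumulated
  noise. The same is done for the gradient of \<open>f1\<close> at the mean iterate, which depends on the whole
  trajectory as well.\<close>

lemma pathwise_gap:
  assumes k: "k \<le> N" and v: "v \<in> nonneg_orthant"
  shows "real k * (F ((1 / real k) *\<^sub>R (\<Sum>t<k. x t \<omega>)) - F xopt) + (\<Sum>t<k. g (x t \<omega>) \<bullet> v)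
      + \<alpha> / 2 * (norm (l k \<omega> - v))\<^sup>2
    \<le> \<eta> / 2 * (norm (x0 - xopt))\<^sup>2 + \<alpha> / 2 * (norm v)\<^sup>2 + (\<Sum>t<k. remainder t \<omega>)
      + C\<^sub>f\<^sub>1 * norm (\<Sum>t<k. noise_f t \<omega>) + norm v * norm (\<Sum>t<k. noise_g t \<omega>)"
proof -
  let ?s = "\<lambda>t. f2s (x t \<omega>) (u21 t \<omega>)"
  let ?m = "(1 / real k) *\<^sub>R (\<Sum>t<k. x t \<omega>)"
  let ?W = "\<Sum>t<k. noise_f t \<omega>" and ?V = "\<Sum>t<k. noise_g t \<omega>"
  have telescope: "(\<Sum>t<k. r / 2 * (h (Suc t) - h t)) = r / 2 * (h k - h 0)" for r and h :: "nat \<Rightarrow> real"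
    by (simp only: sum_distrib_left[symmetric] sum_lessThan_telescope)
  have "(\<Sum>t<k. df1 (y (Suc t) \<omega>) \<bullet> (?s t - f2 xopt) + g (x t \<omega>) \<bullet> v
       + \<eta> / 2 * ((norm (x (Suc t) \<omega> - xopt))\<^sup>2 - (norm (x t \<omega> - xopt))\<^sup>2)
       + \<alpha> / 2 * ((norm (l (Suc t) \<omega> - v))\<^sup>2 - (norm (l t \<omega> - v))\<^sup>2))
     \<le> (\<Sum>t<k. remainder t \<omega> - noise_g t \<omega> \<bullet> v)"
    using k by (intro sum_mono one_step v) auto
  then have steps_sum: "(\<Sum>t<k. df1 (y (Suc t) \<omega>) \<bullet> (?s t - f2 xopt)) + (\<Sum>t<k. g (x t \<omega>) \<bullet> v)
      + \<eta> / 2 * ((norm (x k \<omega> - xopt))\<^sup>2 - (norm (x0 - xopt))\<^sup>2)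
      + \<alpha> / 2 * ((norm (l k \<omega> - v))\<^sup>2 - (norm v)\<^sup>2)
      \<le> (\<Sum>t<k. remainder t \<omega>) - ?V \<bullet> v"
    unfolding sum.distrib sum_subtractf telescope[of \<eta> "\<lambda>t. (norm (x t \<omega> - xopt))\<^sup>2"]
      telescope[of \<alpha> "\<lambda>t. (norm (l t \<omega> - v))\<^sup>2"] inner_sum_left
    by (simp add: init)
  have composite: "real k * (F ?m - F xopt)
      \<le> (\<Sum>t<k. df1 (y (Suc t) \<omega>) \<bullet> (?s t - f2 xopt)) + C\<^sub>f\<^sub>1 * norm ?W"
  proof (cases "k = 0")
    case False
    let ?q = "df1 (f2 ?m)" and ?sm = "(1 / real k) *\<^sub>R (\<Sum>t<k. ?s t)"
    have m: "?m \<in> X" using False k by (intro mean_in_X) auto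
    have "real k * (f1 ?sm - f1 (f2 xopt)) \<le> (\<Sum>t<k. df1 (y (Suc t) \<omega>) \<bullet> (?s t - f2 xopt))"
      using k False weights steps(1)
      by (intro averaged_linearisations[where f = f1 and D = df1 and y = "\<lambda>t. y t \<omega>" and \<tau> = \<tau>] gradient) auto
    moreover have "f1 (f2 ?m) + ?q \<bullet> (?sm - f2 ?m) \<le> f1 ?sm" by (rule gradient)
    then have "real k * (f1 (f2 ?m) + ?q \<bullet> (?sm - f2 ?m)) \<le> real k * f1 ?sm"
      by (rule mult_left_mono) simp
    moreover have "- (C\<^sub>f\<^sub>1 * norm ?W) \<le> real k * (?q \<bullet> (?sm - f2 ?m))"
    proof -
      have "(\<Sum>t<k. ?q \<bullet> (f2 ?m - f2 (x t \<omega>))) \<le> (\<Sum>t<k. (mean_df2 ?m *v ?q) \<bullet> (?m - x t \<omega>))"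
        by (intro sum_mono inner_decrease m)
      also have "\<dots> = 0"
        using False by (simp add: inner_sum_right[symmetric] sum_subtractf sum_constant_scaleR
            del: sum_constant)
      finally have "(\<Sum>t<k. ?q \<bullet> (f2 ?m - f2 (x t \<omega>))) \<le> 0" .
      moreover have "real k * (?q \<bullet> (?sm - f2 ?m)) = ?q \<bullet> ?W - (\<Sum>t<k. ?q \<bullet> (f2 ?m - f2 (x t \<omega>)))"
        using False by (simp add: noise_f_def inner_sum_right[symmetric] sum_subtractf
            sum_constant_scaleR inner_diff_right right_diff_distrib del: sum_constant)
      moreover have "\<bar>?q \<bullet> ?W\<bar> \<le> C\<^sub>f\<^sub>1 * norm ?W"
        using norm_df1_le by (intro order.trans[OF Cauchy_Schwarz_ineq2] mult_right_mono) auto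
      ultimately show ?thesis by linarith
    qed
    ultimately show ?thesis by (simp add: F_def right_diff_distrib distrib_left)
  qed (use constants in simp)
  have "- (?V \<bullet> v) \<le> norm v * norm ?V"
    using Cauchy_Schwarz_ineq2[of ?V v] by (simp add: mult.commute)
  moreover have "0 \<le> \<eta> / 2 * (norm (x k \<omega> - xopt))\<^sup>2" using constants by simp
  ultimately show ?thesis
    using steps_sum composite unfolding right_diff_distrib[of "\<eta> / 2"] right_diff_distrib[of "\<alpha> / 2"]
    by linarith
qed

end

section \<open>The iterates are adapted to the samples\<close>

text \<open>The pair \<open>(k, t)\<close> stands for the \<open>k\<close>-th of the five samples that are drawn in step \<open>t\<close>.\<close>

definition sample_events :: "nat \<times> nat \<Rightarrow> 'w set set" where
  "sample_events = (\<lambda>(k, t). [events_of M S1 (u10 t), events_of M S2 (u20 t), events_of M S2 (u21 t),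
     events_of M (Pi\<^sub>M UNIV Z) (z0 t), events_of M (Pi\<^sub>M UNIV Z) (z1 t)] ! k)"

definition "indices = {..<5::nat} \<times> {..<N}"
definition "past t = {..<5::nat} \<times> {..<t}"

abbreviation "hist J \<equiv> history M sample_events J"

lemma sample_events_eq:
  "sample_events (0, t) = events_of M S1 (u10 t)" "sample_events (1, t) = events_of M S2 (u20 t)"
  "sample_events (2, t) = events_of M S2 (u21 t)" "sample_events (3, t) = events_of M (Pi\<^sub>M UNIV Z) (z0 t)"
  "sample_events (4, t) = events_of M (Pi\<^sub>M UNIV Z) (z1 t)"
  by (simp_all add: sample_events_def)

lemma copies:
  assumes "t < N"
  shows "copy_of M S1 \<xi>1 (u10 t)" "copy_of M S2 \<xi>2 (u20 t)" "copy_of M S2 \<xi>2 (u21 t)"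
    "copy_of M (Pi\<^sub>M UNIV Z) \<zeta> (z0 t)" "copy_of M (Pi\<^sub>M UNIV Z) \<zeta> (z1 t)"
  using samples assms by (auto simp: independent_samples_def)

lemma indep_sample_events: "indep_sets sample_events indices"
  using samples by (simp add: independent_samples_def sample_events_def indices_def)

lemma sample_events_sets: "i \<in> indices \<Longrightarrow> sample_events i \<subseteq> sets M"
  using indep_sample_events by (auto simp: indep_sets_def)

lemma Int_stable_sample_events: "i \<in> indices \<Longrightarrow> Int_stable (sample_events i)"
proof -
  assume "i \<in> indices"
  then obtain k t where i: "i = (k, t)" and "k < 5" by (auto simp: indices_def)
  then have "k \<in> {0, 1, 2, 3, 4}" by auto
  then show ?thesis unfolding i by (auto simp: sample_events_eq Int_stable_events_of
    sample_events_eq(2)[simplified])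
qed

lemma indep_of_history:
  assumes "J \<subseteq> indices" "i \<in> indices - J" "W \<in> measurable (hist J) T" "sample_events i = events_of M S U"
  shows "indep_set (events_of M T W) (events_of M S U)"
  using indep_set_history[OF indep_sample_events Int_stable_sample_events] assms by blast

lemma history_mean_zero:
  fixes n :: "'t \<times> 's \<Rightarrow> 'v::euclidean_space" and c :: "'w \<Rightarrow> 'v"
  assumes J: "J \<subseteq> indices" "i \<in> indices - J" "sample_events i = events_of M S U"
    and \<xi>: "\<xi> \<in> measurable M S" and U: "copy_of M S \<xi> U"
    and W: "W \<in> measurable (hist J) T" and c: "c \<in> borel_measurable (hist J)"
    and n: "n \<in> borel_measurable (T \<Otimes>\<^sub>M S)"
    and int: "\<And>\<omega>. \<omega> \<in> space M \<Longrightarrow> integrable M (\<lambda>\<omega>'. n (W \<omega>, \<xi> \<omega>'))"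
    and mean: "\<And>\<omega>. \<omega> \<in> space M \<Longrightarrow> (\<integral>\<omega>'. n (W \<omega>, \<xi> \<omega>') \<partial>M) = 0"
    and bound: "\<And>\<omega>. \<omega> \<in> space M \<Longrightarrow> (\<integral>\<omega>'. norm (n (W \<omega>, \<xi> \<omega>')) \<partial>M) \<le> K"
    and int_c: "integrable M (\<lambda>\<omega>. norm (c \<omega>))"
  shows "integrable M (\<lambda>\<omega>. c \<omega> \<bullet> n (W \<omega>, U \<omega>)) \<and> (\<integral>\<omega>. c \<omega> \<bullet> n (W \<omega>, U \<omega>) \<partial>M) = 0"
proof -
  have ev: "\<And>j. j \<in> J \<Longrightarrow> sample_events j \<subseteq> sets M" using J(1) sample_events_sets by auto
  have "(\<lambda>\<omega>. (W \<omega>, c \<omega>)) \<in> measurable (hist J) (T \<Otimes>\<^sub>M borel)"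
    using W c by (rule measurable_Pair)
  note ind = indep_of_history[OF J(1,2) this J(3)]
  show ?thesis
    using mean_zero_inner[OF measurable_from_history[OF ev W] measurable_from_history[OF ev c]
        \<xi> U ind n int mean bound int_c] by blast
qed

lemma history_moment_le:
  fixes h :: "'t \<times> 's \<Rightarrow> real" and q :: "'w \<Rightarrow> real"
  assumes J: "J \<subseteq> indices" "i \<in> indices - J" "sample_events i = events_of M S U"
    and \<xi>: "\<xi> \<in> measurable M S" and U: "copy_of M S \<xi> U"
    and W: "W \<in> measurable (hist J) T" and q: "q \<in> borel_measurable (hist J)"
    and h: "h \<in> borel_measurable (T \<Otimes>\<^sub>M S)"
    and nonneg: "\<And>p. 0 \<le> h p" "\<And>\<omega>. 0 \<le> q \<omega>"
    and int: "\<And>\<omega>. \<omega> \<in> space M \<Longrightarrow> integrable M (\<lambda>\<omega>'. h (W \<omega>, \<xi> \<omega>'))"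
    and bound: "\<And>\<omega>. \<omega> \<in> space M \<Longrightarrow> (\<integral>\<omega>'. h (W \<omega>, \<xi> \<omega>') \<partial>M) \<le> K"
    and int_q: "integrable M q"
  shows "integrable M (\<lambda>\<omega>. q \<omega> * h (W \<omega>, U \<omega>))
    \<and> (\<integral>\<omega>. q \<omega> * h (W \<omega>, U \<omega>) \<partial>M) \<le> K * (\<integral>\<omega>. q \<omega> \<partial>M)"
proof -
  have ev: "\<And>j. j \<in> J \<Longrightarrow> sample_events j \<subseteq> sets M" using J(1) sample_events_sets by auto
  have "(\<lambda>\<omega>. (W \<omega>, q \<omega>)) \<in> measurable (hist J) (T \<Otimes>\<^sub>M borel)"
    using W q by (rule measurable_Pair)
  note ind = indep_of_history[OF J(1,2) this J(3)]
  show ?thesis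
    using weighted_moment_le[OF measurable_from_history[OF ev W] measurable_from_history[OF ev q]
        \<xi> U ind h nonneg int bound int_q] by blast
qed

lemma continuous_measurable [measurable]:
  "f1 \<in> borel_measurable borel" "f2 \<in> borel_measurable borel" "g \<in> borel_measurable borel" "df1 \<in> borel_measurable borel"
  by (intro borel_measurable_continuous_onI continuous lipschitz_on_continuous_on[OF lipschitz])+

lemma df1s_compose [measurable (raw)]:
  assumes "v \<in> borel_measurable H" and "s \<in> measurable H S1"
  shows "(\<lambda>\<omega>. df1s (v \<omega>) (s \<omega>)) \<in> borel_measurable H"
  using measurable_compose[OF measurable_Pair[OF assms] oracle_measurable(1)] by simp

lemma f2s_compose [measurable (raw)]:
  assumes "w \<in> borel_measurable H" and "s \<in> measurable H S2"
  shows "(\<lambda>\<omega>. f2s (w \<omega>) (s \<omega>)) \<in> borel_measurable H"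
  using measurable_compose[OF measurable_Pair[OF assms] oracle_measurable(2)] by simp

lemma df2s_compose [measurable (raw)]:
  assumes "w \<in> borel_measurable H" and "s \<in> measurable H S2"
  shows "(\<lambda>\<omega>. df2s (w \<omega>) (s \<omega>)) \<in> borel_measurable H"
  using measurable_compose[OF measurable_Pair[OF assms] oracle_measurable(3)] by simp

lemma dgs_compose [measurable (raw)]:
  assumes "w \<in> borel_measurable H" and "z \<in> measurable H (Pi\<^sub>M UNIV Z)"
  shows "(\<lambda>\<omega>. dgs (w \<omega>) (z \<omega>)) \<in> borel_measurable H"
  using measurable_compose[OF measurable_Pair[OF assms] oracle_measurable(5)] by simp

lemma sampled_constraints_compose [measurable (raw)]:
  assumes "w \<in> borel_measurable H" and "z \<in> measurable H (Pi\<^sub>M UNIV Z)"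
  shows "(\<lambda>\<omega>. sampled_constraints gs (w \<omega>) (z \<omega>)) \<in> borel_measurable H"
proof (rule borel_measurable_vecI)
  fix j
  have "(\<lambda>\<omega>. z \<omega> j) \<in> measurable H (Z j)"
    using assms(2) by (rule measurable_compose) (rule measurable_component_singleton, simp)
  from measurable_compose[OF measurable_Pair[OF assms(1) this] oracle_measurable(4)]
  show "(\<lambda>\<omega>. sampled_constraints gs (w \<omega>) (z \<omega>) $ j) \<in> borel_measurable H"
    by (simp add: sampled_constraints_def)
qed

lemma mean_measurable [measurable]:
  "mean_df2 \<in> borel_measurable borel" "mean_dg \<in> borel_measurable borel"
proof -
  have "(\<lambda>w. \<integral>\<omega>. df2s w (\<xi>2 \<omega>) \<partial>M) \<in> borel_measurable borel"
    by (rule borel_measurable_lebesgue_integral) measurable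
  then show "mean_df2 \<in> borel_measurable borel" by (simp add: mean_df2_def[abs_def])
  have "(\<lambda>w. \<integral>\<omega>. dgs w (\<zeta> \<omega>) \<partial>M) \<in> borel_measurable borel"
    by (rule borel_measurable_lebesgue_integral) measurable
  then show "mean_dg \<in> borel_measurable borel" by (simp add: mean_dg_def[abs_def])
qed

lemma past_subset: "t \<le> N \<Longrightarrow> past t \<subseteq> indices"
  by (auto simp: past_def indices_def)

lemma past_Suc: "past (Suc t) = past t \<union> {(0, t), (1, t), (2, t), (3, t), (4, t)}"
proof -
  have five: "{..<5::nat} = {0, 1, 2, 3, 4}"
    by (simp add: eval_nat_numeral lessThan_Suc insert_commute)
  have "past (Suc t) = past t \<union> {..<5} \<times> {t}" by (auto simp: past_def)
  also have "{..<5::nat} \<times> {t} = {(0, t), (1, t), (2, t), (3, t), (4, t)}" unfolding five by blast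
  finally show ?thesis .
qed

lemma history_mono:
  assumes "J \<subseteq> J'" "J' \<subseteq> indices" "W \<in> measurable (hist J) T"
  shows "W \<in> measurable (hist J') T"
  by (rule measurable_history_mono[OF assms(1) _ assms(3)]) (use assms(2) sample_events_sets in auto)

lemma history_random_variable:
  assumes "J \<subseteq> indices" "W \<in> measurable (hist J) T"
  shows "W \<in> measurable M T"
  by (rule measurable_from_history[OF _ assms(2)]) (use assms(1) sample_events_sets in auto)

lemma history_member:
  assumes "J \<subseteq> indices" "i \<in> J" "sample_events i = events_of M S U" "copy_of M S \<xi> U"
  shows "U \<in> measurable (hist J) S"
  by (rule measurable_history_member[where E = sample_events, OF assms(2,3)])
    (use assms(1,4) sample_events_sets in \<open>auto simp: copy_of_def\<close>)

lemma sample_history_measurable: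
  assumes J: "J \<subseteq> indices" and t: "t < N"
  shows "(0, t) \<in> J \<Longrightarrow> u10 t \<in> measurable (hist J) S1"
    and "(1, t) \<in> J \<Longrightarrow> u20 t \<in> measurable (hist J) S2"
    and "(2, t) \<in> J \<Longrightarrow> u21 t \<in> measurable (hist J) S2"
    and "(3, t) \<in> J \<Longrightarrow> z0 t \<in> measurable (hist J) (Pi\<^sub>M UNIV Z)"
    and "(4, t) \<in> J \<Longrightarrow> z1 t \<in> measurable (hist J) (Pi\<^sub>M UNIV Z)"
proof -
  show "(0, t) \<in> J \<Longrightarrow> u10 t \<in> measurable (hist J) S1"
    by (rule history_member[OF J _ sample_events_eq(1) copies(1)[OF t]])
  show "(1, t) \<in> J \<Longrightarrow> u20 t \<in> measurable (hist J) S2"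
    by (rule history_member[OF J _ sample_events_eq(2) copies(2)[OF t]])
  show "(2, t) \<in> J \<Longrightarrow> u21 t \<in> measurable (hist J) S2"
    by (rule history_member[OF J _ sample_events_eq(3) copies(3)[OF t]])
  show "(3, t) \<in> J \<Longrightarrow> z0 t \<in> measurable (hist J) (Pi\<^sub>M UNIV Z)"
    by (rule history_member[OF J _ sample_events_eq(4) copies(4)[OF t]])
  show "(4, t) \<in> J \<Longrightarrow> z1 t \<in> measurable (hist J) (Pi\<^sub>M UNIV Z)"
    by (rule history_member[OF J _ sample_events_eq(5) copies(5)[OF t]])
qed

text \<open>Only the sample of \<open>f2\<close> is needed to form \<open>y (t+1)\<close>; hence \<open>y (t+1)\<close> is still independent of the
  samples that make up the direction of the same step.\<close>

lemma y_next_measurable: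
  assumes t: "t < N" and J: "J \<subseteq> indices" "(2, t) \<in> J"
    and [measurable]: "x t \<in> borel_measurable (hist J)" "y t \<in> borel_measurable (hist J)"
  shows "y (Suc t) \<in> borel_measurable (hist J)"
proof -
  note [measurable] = sample_history_measurable(3)[OF J(1) t J(2)]
  have "(\<lambda>\<omega>. (1 / (1 + \<tau> t)) *\<^sub>R (f2s (x t \<omega>) (u21 t \<omega>) + \<tau> t *\<^sub>R y t \<omega>)) \<in> borel_measurable (hist J)"
    by measurable
  then show ?thesis
    by (rule measurable_cong[THEN iffD2, rotated]) (use steps(1) t in auto)
qed

lemma constant_measurable:
  fixes h :: "'w \<Rightarrow> 'v::euclidean_space"
  assumes "\<And>\<omega>. \<omega> \<in> space M \<Longrightarrow> h \<omega> = c"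
  shows "h \<in> borel_measurable (hist J)"
  by (rule measurable_cong[THEN iffD2, of _ h "\<lambda>_. c"]) (use assms in auto)

lemma state_measurable:
  "t \<le> N \<Longrightarrow> x t \<in> borel_measurable (hist (past t)) \<and> y t \<in> borel_measurable (hist (past t))
    \<and> l t \<in> borel_measurable (hist (past t))"
proof (induction t)
  case 0
  show ?case using init by (auto intro: constant_measurable)
next
  case (Suc t)
  let ?J = "past (Suc t)"
  have t: "t < N" and J: "?J \<subseteq> indices" and sub: "past t \<subseteq> ?J"
    using Suc.prems past_subset[of "Suc t"] by (auto simp: past_def)
  have [measurable]: "x t \<in> borel_measurable (hist ?J)" "y t \<in> borel_measurable (hist ?J)"
    "l t \<in> borel_measurable (hist ?J)"
    using Suc history_mono[OF sub J] by auto
  note [measurable] = sample_history_measurable[OF J t]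
  have [measurable]: "(0, t) \<in> ?J" "(1, t) \<in> ?J" "(2, t) \<in> ?J" "(3, t) \<in> ?J" "(4, t) \<in> ?J"
    by (auto simp: past_Suc)
  have y[measurable]: "y (Suc t) \<in> borel_measurable (hist ?J)"
    by (rule y_next_measurable[OF t J]) fact+
  have [measurable]: "closest_point (closure X) \<in> borel_measurable borel"
    using convex_X x0 closure_subset[of X]
    by (intro borel_measurable_continuous_onI continuous_on_closest_point convex_closure) auto
  have "(\<lambda>\<omega>. closest_point (closure X) (x t \<omega> - (1 / \<eta>) *\<^sub>R
      (df2s (x t \<omega>) (u20 t \<omega>) *v df1s (y (Suc t) \<omega>) (u10 t \<omega>) + dgs (x t \<omega>) (z0 t \<omega>) *v l t \<omega>)))
      \<in> borel_measurable (hist ?J)" by measurable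
  then have "x (Suc t) \<in> borel_measurable (hist ?J)"
    by (rule measurable_cong[THEN iffD2, rotated])
      (use nearest_point_eq_closest_point[OF convex_X steps(2)] t in \<open>auto simp: dir_f_def dir_g_def\<close>)
  moreover have "(\<lambda>\<omega>. pos_part (l t \<omega> + (1 / \<alpha>) *\<^sub>R sampled_constraints gs (x t \<omega>) (z1 t \<omega>)))
      \<in> borel_measurable (hist ?J)" by measurable
  then have "l (Suc t) \<in> borel_measurable (hist ?J)"
    by (rule measurable_cong[THEN iffD2, rotated]) (use steps(3) t in auto)
  ultimately show ?case using y by simp
qed

section \<open>Moments of the noise\<close>

lemma state_random_variable [measurable]:
  assumes "t \<le> N"
  shows "x t \<in> borel_measurable M" "y t \<in> borel_measurable M" "l t \<in> borel_measurable M"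
  using state_measurable[OF assms] history_random_variable[OF past_subset[OF assms]] by auto

lemma sample_random_variable:
  assumes "t < N"
  shows "u10 t \<in> measurable M S1" "u20 t \<in> measurable M S2" "u21 t \<in> measurable M S2"
    "z0 t \<in> measurable M (Pi\<^sub>M UNIV Z)" "z1 t \<in> measurable M (Pi\<^sub>M UNIV Z)"
  using copies[OF assms] by (auto simp: copy_of_def)

lemma noise_f_inner:
  assumes "w \<in> X"
  shows "integrable M (\<lambda>\<omega>. f2s w (\<xi>2 \<omega>) - f2 w)"
    and "(\<integral>\<omega>. f2s w (\<xi>2 \<omega>) - f2 w \<partial>M) = 0"
    and "(\<integral>\<omega>. norm (f2s w (\<xi>2 \<omega>) - f2 w) \<partial>M) \<le> \<sigma>\<^sub>f\<^sub>2"
proof -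
  have int: "integrable M (\<lambda>\<omega>. f2s w (\<xi>2 \<omega>))" and eq: "f2 w = (\<integral>\<omega>. f2s w (\<xi>2 \<omega>) \<partial>M)"
    using inner_value(1)[OF assms] by blast+
  show 1: "integrable M (\<lambda>\<omega>. f2s w (\<xi>2 \<omega>) - f2 w)" using int by simp
  have "(\<integral>\<omega>. f2s w (\<xi>2 \<omega>) - f2 w \<partial>M) = (\<integral>\<omega>. f2s w (\<xi>2 \<omega>) \<partial>M) - f2 w"
    using int by (simp add: prob_space)
  then show "(\<integral>\<omega>. f2s w (\<xi>2 \<omega>) - f2 w \<partial>M) = 0" using eq by simp
  show "(\<integral>\<omega>. norm (f2s w (\<xi>2 \<omega>) - f2 w) \<partial>M) \<le> \<sigma>\<^sub>f\<^sub>2"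
    using inner_value(2)[OF assms] constants by (intro mean_norm_le(1)[OF 1]) auto
qed

lemma noise_g_inner:
  assumes "w \<in> X"
  shows "integrable M (\<lambda>\<omega>. sampled_constraints gs w (\<zeta> \<omega>) - g w)"
    and "(\<integral>\<omega>. sampled_constraints gs w (\<zeta> \<omega>) - g w \<partial>M) = 0"
    and "(\<integral>\<omega>. norm (sampled_constraints gs w (\<zeta> \<omega>) - g w) \<partial>M) \<le> \<sigma>\<^sub>g"
proof -
  have int: "integrable M (\<lambda>\<omega>. sampled_constraints gs w (\<zeta> \<omega>))"
    using constraint_value(1)[OF assms] by (intro integrable_vec) (simp add: sampled_constraints_def)
  have "(\<integral>\<omega>. sampled_constraints gs w (\<zeta> \<omega>) \<partial>M) $ j = g w $ j" for j
    using constraint_value(1)[OF assms]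
    by (subst integrable_vec(2)) (simp_all add: sampled_constraints_def)
  then have eq: "(\<integral>\<omega>. sampled_constraints gs w (\<zeta> \<omega>) \<partial>M) = g w" by (simp add: vec_eq_iff)
  show 1: "integrable M (\<lambda>\<omega>. sampled_constraints gs w (\<zeta> \<omega>) - g w)" using int by simp
  show "(\<integral>\<omega>. sampled_constraints gs w (\<zeta> \<omega>) - g w \<partial>M) = 0"
    using int eq by (simp add: prob_space)
  show "(\<integral>\<omega>. norm (sampled_constraints gs w (\<zeta> \<omega>) - g w) \<partial>M) \<le> \<sigma>\<^sub>g"
    using constraint_value(2)[OF assms] constants by (intro mean_norm_le(1)[OF 1]) auto
qed

lemma centred_inner:
  fixes h :: "'w \<Rightarrow> 'v::euclidean_space"
  assumes "integrable M h" and "integrable M (\<lambda>\<omega>. (norm (h \<omega>))\<^sup>2)"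
    and "(\<integral>\<omega>. (norm (h \<omega>))\<^sup>2 \<partial>M) \<le> c\<^sup>2" and "0 < c" and m: "(\<integral>\<omega>. h \<omega> \<partial>M) = m"
  shows "integrable M (\<lambda>\<omega>. h \<omega> - m)" and "(\<integral>\<omega>. h \<omega> - m \<partial>M) = 0"
    and "(\<integral>\<omega>. norm (h \<omega> - m) \<partial>M) \<le> 2 * c"
proof -
  show "integrable M (\<lambda>\<omega>. h \<omega> - m)" "(\<integral>\<omega>. h \<omega> - m \<partial>M) = 0"
    using assms(1) m by (auto simp: prob_space)
  have "(\<integral>\<omega>. norm (h \<omega> - m) \<partial>M) \<le> (\<integral>\<omega>. norm (h \<omega>) + norm m \<partial>M)"
    using assms(1) by (intro integral_mono norm_triangle_ineq4) auto
  also have "\<dots> = (\<integral>\<omega>. norm (h \<omega>) \<partial>M) + norm m" using assms(1) by (simp add: prob_space)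
  also have "\<dots> \<le> 2 * c" using mean_norm_le[OF assms(1-4)] m by simp
  finally show "(\<integral>\<omega>. norm (h \<omega> - m) \<partial>M) \<le> 2 * c" .
qed

lemma integrable_norm_of_square:
  fixes h :: "'w \<Rightarrow> 'v::euclidean_space"
  assumes "h \<in> borel_measurable M" and "integrable M (\<lambda>\<omega>. (norm (h \<omega>))\<^sup>2)"
  shows "integrable M (\<lambda>\<omega>. norm (h \<omega>))"
  by (rule square_integrable_imp_integrable) (use assms in auto)

context
  fixes t assumes t: "t < N"
begin

lemma t_le: "t \<le> N" using t by simp

lemma past_indices: "past t \<subseteq> indices" by (rule past_subset[OF t_le])

lemma new_index:
  "(0, t) \<in> indices - past t" "(1, t) \<in> indices - past t" "(2, t) \<in> indices - past t"
  "(3, t) \<in> indices - past t" "(4, t) \<in> indices - past t"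
  using t unfolding indices_def past_def by simp_all

lemmas state = state_measurable[OF t_le, THEN conjunct1] state_measurable[OF t_le, THEN conjunct2, THEN conjunct1]
  state_measurable[OF t_le, THEN conjunct2, THEN conjunct2]

lemma noise_f_orthogonal:
  assumes "c \<in> borel_measurable (hist (past t))" and "integrable M (\<lambda>\<omega>. norm (c \<omega>))"
  shows "integrable M (\<lambda>\<omega>. c \<omega> \<bullet> noise_f t \<omega>) \<and> (\<integral>\<omega>. c \<omega> \<bullet> noise_f t \<omega> \<partial>M) = 0"
proof -
  let ?n = "\<lambda>p. f2s (fst p) (snd p) - f2 (fst p)"
  have n: "?n \<in> borel_measurable (borel \<Otimes>\<^sub>M S2)" by measurable
  have inner: "integrable M (\<lambda>\<omega>'. ?n (x t \<omega>, \<xi>2 \<omega>'))" "(\<integral>\<omega>'. ?n (x t \<omega>, \<xi>2 \<omega>') \<partial>M) = 0"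
    "(\<integral>\<omega>'. norm (?n (x t \<omega>, \<xi>2 \<omega>')) \<partial>M) \<le> \<sigma>\<^sub>f\<^sub>2" if "\<omega> \<in> space M" for \<omega>
    using noise_f_inner[OF x_in_X[OF that t_le]] by simp_all
  show ?thesis
    using history_mean_zero[OF past_indices new_index(3) sample_events_eq(3) sources(2) copies(3)[OF t]
        state(1) assms(1) n inner assms(2)]
    by (simp add: noise_f_def)
qed

lemma noise_f_moment:
  "integrable M (\<lambda>\<omega>. (norm (noise_f t \<omega>))\<^sup>2)" "(\<integral>\<omega>. (norm (noise_f t \<omega>))\<^sup>2 \<partial>M) \<le> \<sigma>\<^sub>f\<^sub>2\<^sup>2"
proof -
  let ?h = "\<lambda>p. (norm (f2s (fst p) (snd p) - f2 (fst p)))\<^sup>2"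
  have h: "?h \<in> borel_measurable (borel \<Otimes>\<^sub>M S2)" by measurable
  have inner: "integrable M (\<lambda>\<omega>'. ?h (x t \<omega>, \<xi>2 \<omega>'))" "(\<integral>\<omega>'. ?h (x t \<omega>, \<xi>2 \<omega>') \<partial>M) \<le> \<sigma>\<^sub>f\<^sub>2\<^sup>2"
    if "\<omega> \<in> space M" for \<omega>
    using inner_value(2)[OF x_in_X[OF that t_le]] by simp_all
  show "integrable M (\<lambda>\<omega>. (norm (noise_f t \<omega>))\<^sup>2)" "(\<integral>\<omega>. (norm (noise_f t \<omega>))\<^sup>2 \<partial>M) \<le> \<sigma>\<^sub>f\<^sub>2\<^sup>2"
    using history_moment_le[OF past_indices new_index(3) sample_events_eq(3) sources(2) copies(3)[OF t]
        state(1) borel_measurable_const h _ _ inner, of 1]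
    by (simp_all add: noise_f_def prob_space)
qed

lemma noise_g_orthogonal:
  assumes "c \<in> borel_measurable (hist (past t))" and "integrable M (\<lambda>\<omega>. norm (c \<omega>))"
  shows "integrable M (\<lambda>\<omega>. c \<omega> \<bullet> noise_g t \<omega>) \<and> (\<integral>\<omega>. c \<omega> \<bullet> noise_g t \<omega> \<partial>M) = 0"
proof -
  let ?n = "\<lambda>p. sampled_constraints gs (fst p) (snd p) - g (fst p)"
  have n: "?n \<in> borel_measurable (borel \<Otimes>\<^sub>M Pi\<^sub>M UNIV Z)" by measurable
  have inner: "integrable M (\<lambda>\<omega>'. ?n (x t \<omega>, \<zeta> \<omega>'))" "(\<integral>\<omega>'. ?n (x t \<omega>, \<zeta> \<omega>') \<partial>M) = 0"
    "(\<integral>\<omega>'. norm (?n (x t \<omega>, \<zeta> \<omega>')) \<partial>M) \<le> \<sigma>\<^sub>g" if "\<omega> \<in> space M" for \<omega>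
    using noise_g_inner[OF x_in_X[OF that t_le]] by simp_all
  show ?thesis
    using history_mean_zero[OF past_indices new_index(5) sample_events_eq(5) sources(3) copies(5)[OF t]
        state(1) assms(1) n inner assms(2)]
    by (simp add: noise_g_def)
qed

lemma noise_g_moment:
  "integrable M (\<lambda>\<omega>. (norm (noise_g t \<omega>))\<^sup>2)" "(\<integral>\<omega>. (norm (noise_g t \<omega>))\<^sup>2 \<partial>M) \<le> \<sigma>\<^sub>g\<^sup>2"
proof -
  let ?h = "\<lambda>p. (norm (sampled_constraints gs (fst p) (snd p) - g (fst p)))\<^sup>2"
  have h: "?h \<in> borel_measurable (borel \<Otimes>\<^sub>M Pi\<^sub>M UNIV Z)" by measurable
  have inner: "integrable M (\<lambda>\<omega>'. ?h (x t \<omega>, \<zeta> \<omega>'))" "(\<integral>\<omega>'. ?h (x t \<omega>, \<zeta> \<omega>') \<partial>M) \<le> \<sigma>\<^sub>g\<^sup>2"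
    if "\<omega> \<in> space M" for \<omega>
    using constraint_value(2)[OF x_in_X[OF that t_le]] by simp_all
  show "integrable M (\<lambda>\<omega>. (norm (noise_g t \<omega>))\<^sup>2)" "(\<integral>\<omega>. (norm (noise_g t \<omega>))\<^sup>2 \<partial>M) \<le> \<sigma>\<^sub>g\<^sup>2"
    using history_moment_le[OF past_indices new_index(5) sample_events_eq(5) sources(3) copies(5)[OF t]
        state(1) borel_measurable_const h _ _ inner, of 1]
    by (simp_all add: noise_g_def prob_space)
qed

lemma noise_random_variable [measurable]:
  "noise_f t \<in> borel_measurable M" "noise_g t \<in> borel_measurable M"
  "dir_f t \<in> borel_measurable M" "dir_g t \<in> borel_measurable M"
proof -
  note [measurable] = sample_random_variable[OF t] state_random_variable[OF t_le]
    state_random_variable(2)[OF Suc_leI[OF t]]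
  show "noise_f t \<in> borel_measurable M" "noise_g t \<in> borel_measurable M"
    "dir_f t \<in> borel_measurable M" "dir_g t \<in> borel_measurable M"
    unfolding noise_f_def[abs_def] noise_g_def[abs_def] dir_f_def[abs_def] dir_g_def[abs_def]
    by measurable
qed

text \<open>Constraint values are bounded on \<open>X\<close>, so the multiplier grows in one step by no more than a
  constant plus a multiple of the noise.\<close>

lemma l_square_step:
  assumes "integrable M (\<lambda>\<omega>. (norm (l t \<omega>))\<^sup>2)"
  shows "integrable M (\<lambda>\<omega>. (norm (l (Suc t) \<omega>))\<^sup>2)"
proof -
  note [measurable] = state_random_variable(3)[OF Suc_leI[OF t]]
  let ?G = "\<lambda>\<omega>. sampled_constraints gs (x t \<omega>) (z1 t \<omega>)"
  let ?B = "2 * (2 * (C\<^sub>g\<^sup>2 * D\<^sub>X\<^sup>2)) + 2 * (norm (g xopt))\<^sup>2"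
  let ?Q = "\<lambda>\<omega>. 2 * (norm (l t \<omega>))\<^sup>2 + 2 * ((1 / \<alpha>)\<^sup>2 * (2 * (norm (noise_g t \<omega>))\<^sup>2 + 2 * ?B))"
  have bound: "(norm (l (Suc t) \<omega>))\<^sup>2 \<le> ?Q \<omega>" if \<omega>: "\<omega> \<in> space M" for \<omega>
  proof -
    have X: "x t \<omega> \<in> X" using x_in_X[OF \<omega> t_le] .
    have "(norm (l (Suc t) \<omega>))\<^sup>2 \<le> (norm (l t \<omega> + (1 / \<alpha>) *\<^sub>R ?G \<omega>))\<^sup>2"
      unfolding steps(3)[OF \<omega> t] by (intro power_mono norm_pos_part_le) simp
    also have "\<dots> \<le> 2 * (norm (l t \<omega>))\<^sup>2 + 2 * (norm ((1 / \<alpha>) *\<^sub>R ?G \<omega>))\<^sup>2" by (rule norm_add_square_le)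
    also have "(norm ((1 / \<alpha>) *\<^sub>R ?G \<omega>))\<^sup>2 = (1 / \<alpha>)\<^sup>2 * (norm (?G \<omega>))\<^sup>2"
      by (simp add: power_mult_distrib power_divide)
    also have "(norm (?G \<omega>))\<^sup>2 \<le> 2 * (norm (noise_g t \<omega>))\<^sup>2 + 2 * (norm (g (x t \<omega>)))\<^sup>2"
      using norm_add_square_le[of "noise_g t \<omega>" "g (x t \<omega>)"] by (simp add: noise_g_def)
    also have "(norm (g (x t \<omega>)))\<^sup>2 \<le> ?B"
    proof -
      have "(norm (g (x t \<omega>) - g xopt))\<^sup>2 \<le> 2 * C\<^sub>g\<^sup>2 * (norm (x t \<omega> - xopt))\<^sup>2"
        by (rule g_lipschitz[OF X xopt])
      also have "\<dots> \<le> 2 * C\<^sub>g\<^sup>2 * D\<^sub>X\<^sup>2" using diameter[OF X] by (intro mult_left_mono power_mono) auto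
      finally show ?thesis using norm_add_square_le[of "g (x t \<omega>) - g xopt" "g xopt"] by simp
    qed
    finally show ?thesis by (simp add: mult_left_mono)
  qed
  have Q: "integrable M ?Q" using assms noise_g_moment by auto
  show ?thesis
    by (rule Bochner_Integration.integrable_bound[OF Q])
      (measurable, rule AE_I2, use bound in \<open>force intro: order.trans[OF _ abs_ge_self]\<close>)
qed

end

lemma l_square_integrable: "t \<le> N \<Longrightarrow> integrable M (\<lambda>\<omega>. (norm (l t \<omega>))\<^sup>2)"
proof (induction t)
  case 0
  then show ?case
    by (subst Bochner_Integration.integrable_cong[OF refl, of _ _ "\<lambda>_. 0"]) (auto simp: init)
next
  case (Suc t) then show ?case by (intro l_square_step) auto
qed

context
  fixes t assumes t: "t < N"
begin

lemma dir_g_moment: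
  "integrable M (\<lambda>\<omega>. (norm (dir_g t \<omega>))\<^sup>2)"
  "(\<integral>\<omega>. (norm (dir_g t \<omega>))\<^sup>2 \<partial>M) \<le> C\<^sub>g\<^sup>2 * (\<integral>\<omega>. (norm (l t \<omega>))\<^sup>2 \<partial>M)"
proof -
  note [measurable] = state[OF t] noise_random_variable[OF t]
  let ?h = "\<lambda>p. (norm (dgs (fst p) (snd p)))\<^sup>2"
  have h: "?h \<in> borel_measurable (borel \<Otimes>\<^sub>M Pi\<^sub>M UNIV Z)" by measurable
  have inner: "integrable M (\<lambda>\<omega>'. ?h (x t \<omega>, \<zeta> \<omega>'))" "(\<integral>\<omega>'. ?h (x t \<omega>, \<zeta> \<omega>') \<partial>M) \<le> C\<^sub>g\<^sup>2"
    if "\<omega> \<in> space M" for \<omega>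
    using constraint_subgradient[OF x_in_X[OF that t_le[OF t]]] by simp_all
  have q: "(\<lambda>\<omega>. (norm (l t \<omega>))\<^sup>2) \<in> borel_measurable (hist (past t))" by measurable
  have l2: "integrable M (\<lambda>\<omega>. (norm (l t \<omega>))\<^sup>2)" using l_square_integrable t by simp
  have m: "integrable M (\<lambda>\<omega>. (norm (l t \<omega>))\<^sup>2 * (norm (dgs (x t \<omega>) (z0 t \<omega>)))\<^sup>2)"
    "(\<integral>\<omega>. (norm (l t \<omega>))\<^sup>2 * (norm (dgs (x t \<omega>) (z0 t \<omega>)))\<^sup>2 \<partial>M) \<le> C\<^sub>g\<^sup>2 * (\<integral>\<omega>. (norm (l t \<omega>))\<^sup>2 \<partial>M)"
    using history_moment_le[OF past_indices[OF t] new_index(4)[OF t] sample_events_eq(4) sources(3) copies(4)[OF t]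
        state(1)[OF t] q h _ _ inner l2]
    by simp_all
  have le: "(norm (dir_g t \<omega>))\<^sup>2 \<le> (norm (l t \<omega>))\<^sup>2 * (norm (dgs (x t \<omega>) (z0 t \<omega>)))\<^sup>2" for \<omega>
    using power_mono[OF norm_matrix_vector_le, of "dgs (x t \<omega>) (z0 t \<omega>)" "l t \<omega>" 2]
    by (simp add: dir_g_def power_mult_distrib mult.commute)
  show i: "integrable M (\<lambda>\<omega>. (norm (dir_g t \<omega>))\<^sup>2)"
    by (rule Bochner_Integration.integrable_bound[OF m(1)]) (measurable, auto intro: le)
  show "(\<integral>\<omega>. (norm (dir_g t \<omega>))\<^sup>2 \<partial>M) \<le> C\<^sub>g\<^sup>2 * (\<integral>\<omega>. (norm (l t \<omega>))\<^sup>2 \<partial>M)"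
    using integral_mono[OF i m(1) le] m(2) by linarith
qed

lemma dir_g_mean_zero:
  "integrable M (\<lambda>\<omega>. (dir_g t \<omega> - mean_dir_g t \<omega>) \<bullet> (x t \<omega> - xopt))"
  "(\<integral>\<omega>. (dir_g t \<omega> - mean_dir_g t \<omega>) \<bullet> (x t \<omega> - xopt) \<partial>M) = 0"
proof -
  note [measurable] = state[OF t] state_random_variable[OF t_le[OF t]]
  let ?c = "\<lambda>\<omega>. outer (x t \<omega> - xopt) (l t \<omega>)"
  let ?n = "\<lambda>p. dgs (fst p) (snd p) - mean_dg (fst p)"
  have n: "?n \<in> borel_measurable (borel \<Otimes>\<^sub>M Pi\<^sub>M UNIV Z)" by measurable
  have c: "?c \<in> borel_measurable (hist (past t))" by measurable
  have "integrable M (\<lambda>\<omega>. D\<^sub>X * norm (l t \<omega>))"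
    using integrable_norm_of_square[OF _ l_square_integrable[OF t_le[OF t]]] by simp
  then have ci: "integrable M (\<lambda>\<omega>. norm (?c \<omega>))"
    by (rule Bochner_Integration.integrable_bound)
      (measurable, rule AE_I2, use diameter x_in_X[OF _ t_le[OF t]] constants in
        \<open>auto simp: norm_outer abs_mult intro!: mult_right_mono\<close>)
  have inner: "integrable M (\<lambda>\<omega>'. ?n (x t \<omega>, \<zeta> \<omega>'))" "(\<integral>\<omega>'. ?n (x t \<omega>, \<zeta> \<omega>') \<partial>M) = 0"
    "(\<integral>\<omega>'. norm (?n (x t \<omega>, \<zeta> \<omega>')) \<partial>M) \<le> 2 * C\<^sub>g" if "\<omega> \<in> space M" for \<omega>
    using constraint_subgradient[OF x_in_X[OF that t_le[OF t]]] constants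
      centred_inner[of "\<lambda>\<omega>'. dgs (x t \<omega>) (\<zeta> \<omega>')" C\<^sub>g "mean_dg (x t \<omega>)"]
    by (simp_all add: mean_dg_def)
  have eq: "(dir_g t \<omega> - mean_dir_g t \<omega>) \<bullet> (x t \<omega> - xopt)
      = ?c \<omega> \<bullet> (dgs (x t \<omega>) (z0 t \<omega>) - mean_dg (x t \<omega>))" for \<omega>
    by (simp add: inner_outer dir_g_def mean_dir_g_def matrix_vector_mult_diff_rdistrib)
  show "integrable M (\<lambda>\<omega>. (dir_g t \<omega> - mean_dir_g t \<omega>) \<bullet> (x t \<omega> - xopt))"
    "(\<integral>\<omega>. (dir_g t \<omega> - mean_dir_g t \<omega>) \<bullet> (x t \<omega> - xopt) \<partial>M) = 0"
    unfolding eq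
    using history_mean_zero[OF past_indices[OF t] new_index(4)[OF t] sample_events_eq(4) sources(3) copies(4)[OF t]
        state(1)[OF t] c n inner ci]
    by simp_all
qed

text \<open>The direction of a step multiplies two samples. They are revealed one after the other: first
  the sample of \<open>f2\<close>, which fixes \<open>y (t+1)\<close>, then the subgradient sample \<open>(1, t)\<close>, and last the
  gradient sample \<open>(0, t)\<close>.\<close>

lemma after_inner_value:
  defines "J \<equiv> insert (2, t) (past t)"
  shows "J \<subseteq> indices" "(1, t) \<in> indices - J" "insert (1, t) J \<subseteq> indices" "(0, t) \<in> indices - insert (1, t) J"
    "x t \<in> borel_measurable (hist J)" "y (Suc t) \<in> borel_measurable (hist J)"
    "x t \<in> borel_measurable (hist (insert (1, t) J))" "y (Suc t) \<in> borel_measurable (hist (insert (1, t) J))"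
    "u20 t \<in> measurable (hist (insert (1, t) J)) S2"
proof -
  show J: "J \<subseteq> indices" and J': "insert (1, t) J \<subseteq> indices"
    and "(1, t) \<in> indices - J" "(0, t) \<in> indices - insert (1, t) J"
    using t by (auto simp: J_def indices_def past_def)
  have sub: "past t \<subseteq> J" by (auto simp: J_def)
  have x: "x t \<in> borel_measurable (hist J)" and y: "y t \<in> borel_measurable (hist J)"
    using history_mono[OF sub J] state[OF t] by auto
  then show "x t \<in> borel_measurable (hist J)" and y': "y (Suc t) \<in> borel_measurable (hist J)"
    using y_next_measurable[OF t J] by (auto simp: J_def)
  show "x t \<in> borel_measurable (hist (insert (1, t) J))" "y (Suc t) \<in> borel_measurable (hist (insert (1, t) J))"
    using x y' history_mono[OF subset_insertI J'] by blast+
  show "u20 t \<in> measurable (hist (insert (1, t) J)) S2"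
    by (rule sample_history_measurable(2)[OF J' t]) simp
qed

lemma subgradient_moment:
  "integrable M (\<lambda>\<omega>. (norm (df2s (x t \<omega>) (u20 t \<omega>)))\<^sup>2)"
  "(\<integral>\<omega>. (norm (df2s (x t \<omega>) (u20 t \<omega>)))\<^sup>2 \<partial>M) \<le> C\<^sub>f\<^sub>2\<^sup>2"
proof -
  let ?h = "\<lambda>p. (norm (df2s (fst p) (snd p)))\<^sup>2"
  have h: "?h \<in> borel_measurable (borel \<Otimes>\<^sub>M S2)" by measurable
  have inner: "integrable M (\<lambda>\<omega>'. ?h (x t \<omega>, \<xi>2 \<omega>'))" "(\<integral>\<omega>'. ?h (x t \<omega>, \<xi>2 \<omega>') \<partial>M) \<le> C\<^sub>f\<^sub>2\<^sup>2"
    if "\<omega> \<in> space M" for \<omega>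
    using inner_subgradient[OF x_in_X[OF that t_le[OF t]]] by simp_all
  show "integrable M (\<lambda>\<omega>. (norm (df2s (x t \<omega>) (u20 t \<omega>)))\<^sup>2)"
    "(\<integral>\<omega>. (norm (df2s (x t \<omega>) (u20 t \<omega>)))\<^sup>2 \<partial>M) \<le> C\<^sub>f\<^sub>2\<^sup>2"
    using history_moment_le[OF past_indices[OF t] new_index(2)[OF t] sample_events_eq(2) sources(2) copies(2)[OF t]
        state(1)[OF t] borel_measurable_const h _ _ inner, of 1]
    by (simp_all add: prob_space)
qed

lemma dir_f_moment:
  "integrable M (\<lambda>\<omega>. (norm (dir_f t \<omega>))\<^sup>2)"
  "(\<integral>\<omega>. (norm (dir_f t \<omega>))\<^sup>2 \<partial>M) \<le> C\<^sub>f\<^sub>1\<^sup>2 * C\<^sub>f\<^sub>2\<^sup>2"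
proof -
  note [measurable] = after_inner_value(7-9) noise_random_variable[OF t]
  let ?q = "\<lambda>\<omega>. (norm (df2s (x t \<omega>) (u20 t \<omega>)))\<^sup>2"
  let ?h = "\<lambda>p. (norm (df1s (fst p) (snd p)))\<^sup>2"
  have h: "?h \<in> borel_measurable (borel \<Otimes>\<^sub>M S1)" by measurable
  have inner: "integrable M (\<lambda>\<omega>'. ?h (y (Suc t) \<omega>, \<xi>1 \<omega>'))" "(\<integral>\<omega>'. ?h (y (Suc t) \<omega>, \<xi>1 \<omega>') \<partial>M) \<le> C\<^sub>f\<^sub>1\<^sup>2" for \<omega>
    using outer_gradient[of "y (Suc t) \<omega>"] by simp_all
  have q: "?q \<in> borel_measurable (hist (insert (1, t) (insert (2, t) (past t))))" by measurable
  have m: "integrable M (\<lambda>\<omega>. ?q \<omega> * (norm (df1s (y (Suc t) \<omega>) (u10 t \<omega>)))\<^sup>2)"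
    "(\<integral>\<omega>. ?q \<omega> * (norm (df1s (y (Suc t) \<omega>) (u10 t \<omega>)))\<^sup>2 \<partial>M) \<le> C\<^sub>f\<^sub>1\<^sup>2 * (\<integral>\<omega>. ?q \<omega> \<partial>M)"
    using history_moment_le[OF after_inner_value(3,4) sample_events_eq(1) sources(1) copies(1)[OF t]
        after_inner_value(8) q h _ _ inner subgradient_moment(1)]
    by simp_all
  have le: "(norm (dir_f t \<omega>))\<^sup>2 \<le> ?q \<omega> * (norm (df1s (y (Suc t) \<omega>) (u10 t \<omega>)))\<^sup>2" for \<omega>
    using power_mono[OF norm_matrix_vector_le, of "df2s (x t \<omega>) (u20 t \<omega>)" "df1s (y (Suc t) \<omega>) (u10 t \<omega>)" 2]
    by (simp add: dir_f_def power_mult_distrib)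
  show i: "integrable M (\<lambda>\<omega>. (norm (dir_f t \<omega>))\<^sup>2)"
    by (rule Bochner_Integration.integrable_bound[OF m(1)]) (measurable, auto intro: le)
  have "C\<^sub>f\<^sub>1\<^sup>2 * (\<integral>\<omega>. ?q \<omega> \<partial>M) \<le> C\<^sub>f\<^sub>1\<^sup>2 * C\<^sub>f\<^sub>2\<^sup>2"
    using subgradient_moment(2) by (rule mult_left_mono) simp
  then show "(\<integral>\<omega>. (norm (dir_f t \<omega>))\<^sup>2 \<partial>M) \<le> C\<^sub>f\<^sub>1\<^sup>2 * C\<^sub>f\<^sub>2\<^sup>2"
    using integral_mono[OF i m(1) le] m(2) by linarith
qed

text \<open>The product noise splits into gradient noise, weighted by the sampled subgradient, and subgradient
  noise, weighted by the exact gradient.\<close>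

lemma dir_f_mean_zero:
  "integrable M (\<lambda>\<omega>. (dir_f t \<omega> - mean_dir_f t \<omega>) \<bullet> (x t \<omega> - xopt))"
  "(\<integral>\<omega>. (dir_f t \<omega> - mean_dir_f t \<omega>) \<bullet> (x t \<omega> - xopt) \<partial>M) = 0"
proof -
  let ?J = "insert (2, t) (past t)"
  let ?D = "\<lambda>\<omega>. df2s (x t \<omega>) (u20 t \<omega>)" and ?z = "\<lambda>\<omega>. x t \<omega> - xopt"
  let ?c1 = "\<lambda>\<omega>. transpose (?D \<omega>) *v ?z \<omega>" and ?c2 = "\<lambda>\<omega>. outer (?z \<omega>) (df1 (y (Suc t) \<omega>))"
  let ?n1 = "\<lambda>\<omega>. df1s (y (Suc t) \<omega>) (u10 t \<omega>) - df1 (y (Suc t) \<omega>)"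
  let ?n2 = "\<lambda>\<omega>. ?D \<omega> - mean_df2 (x t \<omega>)"
  have z: "norm (?z \<omega>) \<le> D\<^sub>X" if "\<omega> \<in> space M" for \<omega> using diameter x_in_X[OF that t_le[OF t]] by simp
  have eq: "(dir_f t \<omega> - mean_dir_f t \<omega>) \<bullet> ?z \<omega> = ?c1 \<omega> \<bullet> ?n1 \<omega> + ?c2 \<omega> \<bullet> ?n2 \<omega>" for \<omega>
  proof -
    have "?c1 \<omega> \<bullet> ?n1 \<omega> = (?D \<omega> *v ?n1 \<omega>) \<bullet> ?z \<omega>"
      by (simp add: transpose_matrix_vector dot_lmul_matrix inner_commute)
    moreover have "?c2 \<omega> \<bullet> ?n2 \<omega> = (?n2 \<omega> *v df1 (y (Suc t) \<omega>)) \<bullet> ?z \<omega>" by (rule inner_outer)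
    ultimately show ?thesis
      by (simp add: dir_f_def mean_dir_f_def matrix_vector_mult_diff_rdistrib
          matrix_vector_mult_diff_distrib inner_diff_left)
  qed
  have 1: "integrable M (\<lambda>\<omega>. ?c1 \<omega> \<bullet> ?n1 \<omega>) \<and> (\<integral>\<omega>. ?c1 \<omega> \<bullet> ?n1 \<omega> \<partial>M) = 0"
  proof -
    note [measurable] = after_inner_value(7-9)
    have c: "?c1 \<in> borel_measurable (hist (insert (1, t) ?J))"
    proof (rule borel_measurable_vecI)
      fix i
      have "(\<lambda>\<omega>. \<Sum>k\<in>UNIV. ?D \<omega> $ k $ i * ?z \<omega> $ k) \<in> borel_measurable (hist (insert (1, t) ?J))" by measurable
      then show "(\<lambda>\<omega>. ?c1 \<omega> $ i) \<in> borel_measurable (hist (insert (1, t) ?J))"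
        by (simp add: matrix_vector_mult_def transpose_def)
    qed
    let ?n = "\<lambda>p. df1s (fst p) (snd p) - df1 (fst p)"
    have n: "?n \<in> borel_measurable (borel \<Otimes>\<^sub>M S1)" by measurable
    have inner: "integrable M (\<lambda>\<omega>'. ?n (y (Suc t) \<omega>, \<xi>1 \<omega>'))" "(\<integral>\<omega>'. ?n (y (Suc t) \<omega>, \<xi>1 \<omega>') \<partial>M) = 0"
      "(\<integral>\<omega>'. norm (?n (y (Suc t) \<omega>, \<xi>1 \<omega>')) \<partial>M) \<le> 2 * C\<^sub>f\<^sub>1" for \<omega>
      using outer_gradient[of "y (Suc t) \<omega>"] constants
        centred_inner[of "\<lambda>\<omega>'. df1s (y (Suc t) \<omega>) (\<xi>1 \<omega>')" C\<^sub>f\<^sub>1 "df1 (y (Suc t) \<omega>)"]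
      by simp_all
    have nt: "norm (transpose A) = norm A" for A :: "real^'dy^'dx"
      by (simp add: norm_eq_sqrt_inner inner_vec_def transpose_def) (rule sum.swap)
    have D: "integrable M (\<lambda>\<omega>. D\<^sub>X * norm (?D \<omega>))"
    proof -
      have "?D \<in> borel_measurable M" by (rule history_random_variable[OF after_inner_value(3)]) measurable
      from integrable_norm_of_square[OF this subgradient_moment(1)] show ?thesis by simp
    qed
    have ci: "integrable M (\<lambda>\<omega>. norm (?c1 \<omega>))"
    proof (rule Bochner_Integration.integrable_bound[OF D])
      show "(\<lambda>\<omega>. norm (?c1 \<omega>)) \<in> borel_measurable M"
        using history_random_variable[OF after_inner_value(3) c] by simp
      have "norm (?c1 \<omega>) \<le> D\<^sub>X * norm (?D \<omega>)" if "\<omega> \<in> space M" for \<omega>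
        using norm_matrix_vector_le[of "transpose (?D \<omega>)" "?z \<omega>"] z[OF that]
          mult_right_mono[OF z[OF that] norm_ge_zero[of "?D \<omega>"]] by (simp add: nt mult.commute)
      then show "AE \<omega> in M. norm (norm (?c1 \<omega>)) \<le> norm (D\<^sub>X * norm (?D \<omega>))"
        using constants by (intro AE_I2) (simp add: abs_mult)
    qed
    show ?thesis
      using history_mean_zero[OF after_inner_value(3,4) sample_events_eq(1) sources(1) copies(1)[OF t]
          after_inner_value(8) c n inner ci]
      by simp
  qed
  have 2: "integrable M (\<lambda>\<omega>. ?c2 \<omega> \<bullet> ?n2 \<omega>) \<and> (\<integral>\<omega>. ?c2 \<omega> \<bullet> ?n2 \<omega> \<partial>M) = 0"
  proof -
    note [measurable] = after_inner_value(5,6)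
    have c: "?c2 \<in> borel_measurable (hist ?J)" by measurable
    let ?n = "\<lambda>p. df2s (fst p) (snd p) - mean_df2 (fst p)"
    have n: "?n \<in> borel_measurable (borel \<Otimes>\<^sub>M S2)" by measurable
    have ci: "integrable M (\<lambda>\<omega>. norm (?c2 \<omega>))"
    proof (rule Bochner_Integration.integrable_bound[of _ "\<lambda>_. D\<^sub>X * C\<^sub>f\<^sub>1"])
      show "(\<lambda>\<omega>. norm (?c2 \<omega>)) \<in> borel_measurable M"
        using history_random_variable[OF after_inner_value(1) c] by simp
      show "AE \<omega> in M. norm (norm (?c2 \<omega>)) \<le> norm (D\<^sub>X * C\<^sub>f\<^sub>1)"
        using z norm_df1_le constants by (intro AE_I2) (auto simp: norm_outer intro!: mult_mono)
    qed simp
    have inner: "integrable M (\<lambda>\<omega>'. ?n (x t \<omega>, \<xi>2 \<omega>'))" "(\<integral>\<omega>'. ?n (x t \<omega>, \<xi>2 \<omega>') \<partial>M) = 0"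
      "(\<integral>\<omega>'. norm (?n (x t \<omega>, \<xi>2 \<omega>')) \<partial>M) \<le> 2 * C\<^sub>f\<^sub>2" if "\<omega> \<in> space M" for \<omega>
      using inner_subgradient[OF x_in_X[OF that t_le[OF t]]] constants
        centred_inner[of "\<lambda>\<omega>'. df2s (x t \<omega>) (\<xi>2 \<omega>')" C\<^sub>f\<^sub>2 "mean_df2 (x t \<omega>)"]
      by (simp_all add: mean_df2_def)
    show ?thesis
      using history_mean_zero[OF after_inner_value(1,2) sample_events_eq(2) sources(2) copies(2)[OF t]
          after_inner_value(5) c n inner ci]
      by simp
  qed
  show "integrable M (\<lambda>\<omega>. (dir_f t \<omega> - mean_dir_f t \<omega>) \<bullet> ?z \<omega>)"
    "(\<integral>\<omega>. (dir_f t \<omega> - mean_dir_f t \<omega>) \<bullet> ?z \<omega> \<partial>M) = 0"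
    unfolding eq using 1 2 by simp_all
qed

end

text \<open>A partial sum of noise is determined by the past and therefore orthogonal to the next noise.\<close>

lemma noise_sums:
  assumes k: "k \<le> N"
  shows "integrable M (\<lambda>\<omega>. norm (\<Sum>t<k. noise_f t \<omega>))"
    and "(\<integral>\<omega>. norm (\<Sum>t<k. noise_f t \<omega>) \<partial>M) \<le> \<sigma>\<^sub>f\<^sub>2 * sqrt (real k)"
    and "integrable M (\<lambda>\<omega>. norm (\<Sum>t<k. noise_g t \<omega>))"
    and "(\<integral>\<omega>. norm (\<Sum>t<k. noise_g t \<omega>) \<partial>M) \<le> \<sigma>\<^sub>g * sqrt (real k)"
proof -
  have adapted: "noise_f s \<in> borel_measurable (hist (past t))" "noise_g s \<in> borel_measurable (hist (past t))"
    if "s < t" "t < k" for s t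
  proof -
    have s: "s < N" and sub: "past s \<subseteq> past t" and J: "past t \<subseteq> indices"
      and mem: "(2, s) \<in> past t" "(4, s) \<in> past t"
      using that k past_subset[of t] by (auto simp: past_def)
    note [measurable] = history_mono[OF sub J state(1)[OF s]]
      sample_history_measurable(3)[OF J s mem(1)] sample_history_measurable(5)[OF J s mem(2)]
    show "noise_f s \<in> borel_measurable (hist (past t))" "noise_g s \<in> borel_measurable (hist (past t))"
      unfolding noise_f_def[abs_def] noise_g_def[abs_def] by measurable
  qed
  have f: "integrable M (\<lambda>\<omega>. (\<Sum>s<t. noise_f s \<omega>) \<bullet> noise_f t \<omega>)
      \<and> (\<integral>\<omega>. (\<Sum>s<t. noise_f s \<omega>) \<bullet> noise_f t \<omega> \<partial>M) = 0"
    if "t < k" "integrable M (\<lambda>\<omega>. norm (\<Sum>s<t. noise_f s \<omega>))" for t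
    using that k adapted(1) by (intro noise_f_orthogonal borel_measurable_sum) auto
  have g: "integrable M (\<lambda>\<omega>. (\<Sum>s<t. noise_g s \<omega>) \<bullet> noise_g t \<omega>)
      \<and> (\<integral>\<omega>. (\<Sum>s<t. noise_g s \<omega>) \<bullet> noise_g t \<omega> \<partial>M) = 0"
    if "t < k" "integrable M (\<lambda>\<omega>. norm (\<Sum>s<t. noise_g s \<omega>))" for t
    using that k adapted(2) by (intro noise_g_orthogonal borel_measurable_sum) auto
  have N: "t < N" if "t < k" for t using that k by simp
  show "integrable M (\<lambda>\<omega>. norm (\<Sum>t<k. noise_f t \<omega>))"
    "(\<integral>\<omega>. norm (\<Sum>t<k. noise_f t \<omega>) \<partial>M) \<le> \<sigma>\<^sub>f\<^sub>2 * sqrt (real k)"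
    by (rule expectation_norm_sum_le[OF noise_random_variable(1)[OF N] noise_f_moment[OF N] f constants(3)],
        assumption+)+
  show "integrable M (\<lambda>\<omega>. norm (\<Sum>t<k. noise_g t \<omega>))"
    "(\<integral>\<omega>. norm (\<Sum>t<k. noise_g t \<omega>) \<partial>M) \<le> \<sigma>\<^sub>g * sqrt (real k)"
    by (rule expectation_norm_sum_le[OF noise_random_variable(2)[OF N] noise_g_moment[OF N] g constants(7)],
        assumption+)+
qed

text \<open>All inner products with fresh noise vanish in expectation. The multiplier survives only in the
  second moment of its part of the direction, which the step size \<open>\<eta>\<close> damps.\<close>

lemma remainder_expectation:
  assumes t: "t < N"
  shows "integrable M (remainder t)"
    and "(\<integral>\<omega>. remainder t \<omega> \<partial>M) \<le> L\<^sub>f\<^sub>1 * \<sigma>\<^sub>f\<^sub>2\<^sup>2 / (1 + \<tau> t)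
      + (C\<^sub>f\<^sub>1\<^sup>2 * C\<^sub>f\<^sub>2\<^sup>2 + C\<^sub>g\<^sup>2 * (\<integral>\<omega>. (norm (l t \<omega>))\<^sup>2 \<partial>M)) / \<eta>
      + (\<sigma>\<^sub>g\<^sup>2 + 2 * C\<^sub>g\<^sup>2 * D\<^sub>X\<^sup>2) / \<alpha>"
proof -
  note [measurable] = state[OF t] noise_random_variable[OF t]
  have pred: "(\<lambda>\<omega>. df1 (ypred t \<omega>)) \<in> borel_measurable (hist (past t))"
    unfolding ypred_def by measurable
  have pi: "integrable M (\<lambda>\<omega>. norm (df1 (ypred t \<omega>)))"
    using history_random_variable[OF past_indices[OF t] pred] norm_df1_le
    by (intro integrable_const_bound[of _ C\<^sub>f\<^sub>1]) auto
  have smooth: "integrable M (\<lambda>\<omega>. df1 (ypred t \<omega>) \<bullet> noise_f t \<omega>)"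
    "(\<integral>\<omega>. df1 (ypred t \<omega>) \<bullet> noise_f t \<omega> \<partial>M) = 0"
    using noise_f_orthogonal[OF t pred pi] by blast+
  have l2: "integrable M (\<lambda>\<omega>. (norm (l t \<omega>))\<^sup>2)" using l_square_integrable t by simp
  have dual: "integrable M (\<lambda>\<omega>. l t \<omega> \<bullet> noise_g t \<omega>)" "(\<integral>\<omega>. l t \<omega> \<bullet> noise_g t \<omega> \<partial>M) = 0"
    using noise_g_orthogonal[OF t state(3)[OF t] integrable_norm_of_square[OF _ l2]]
      state_random_variable[OF t_le[OF t]] by blast+
  let ?d = "\<lambda>\<omega>. (norm (dir_f t \<omega> + dir_g t \<omega>))\<^sup>2"
  let ?b = "\<lambda>\<omega>. 2 * (norm (dir_f t \<omega>))\<^sup>2 + 2 * (norm (dir_g t \<omega>))\<^sup>2"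
  have b: "integrable M ?b" using dir_f_moment(1)[OF t] dir_g_moment(1)[OF t] by simp
  have d: "integrable M ?d"
    by (rule Bochner_Integration.integrable_bound[OF b])
      (measurable, rule AE_I2, use norm_add_square_le in \<open>auto\<close>)
  have "(\<integral>\<omega>. ?d \<omega> \<partial>M) \<le> (\<integral>\<omega>. ?b \<omega> \<partial>M)" by (rule integral_mono[OF d b]) (rule norm_add_square_le)
  also have "\<dots> \<le> 2 * (C\<^sub>f\<^sub>1\<^sup>2 * C\<^sub>f\<^sub>2\<^sup>2 + C\<^sub>g\<^sup>2 * (\<integral>\<omega>. (norm (l t \<omega>))\<^sup>2 \<partial>M))"
    using dir_f_moment[OF t] dir_g_moment[OF t] by simp
  finally have d2: "(\<integral>\<omega>. ?d \<omega> \<partial>M)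
      \<le> 2 * (C\<^sub>f\<^sub>1\<^sup>2 * C\<^sub>f\<^sub>2\<^sup>2 + C\<^sub>g\<^sup>2 * (\<integral>\<omega>. (norm (l t \<omega>))\<^sup>2 \<partial>M))" .
  have double: "2 * r / (2 * \<eta>) = r / \<eta>" for r by simp
  have "(\<integral>\<omega>. ?d \<omega> \<partial>M) / (2 * \<eta>) \<le> 2 * (C\<^sub>f\<^sub>1\<^sup>2 * C\<^sub>f\<^sub>2\<^sup>2 + C\<^sub>g\<^sup>2 * (\<integral>\<omega>. (norm (l t \<omega>))\<^sup>2 \<partial>M)) / (2 * \<eta>)"
    by (rule divide_right_mono[OF d2]) (use constants in simp)
  then have d_le: "(\<integral>\<omega>. ?d \<omega> \<partial>M) / (2 * \<eta>) \<le> (C\<^sub>f\<^sub>1\<^sup>2 * C\<^sub>f\<^sub>2\<^sup>2 + C\<^sub>g\<^sup>2 * (\<integral>\<omega>. (norm (l t \<omega>))\<^sup>2 \<partial>M)) / \<eta>"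
    unfolding double .
  have f_le: "L\<^sub>f\<^sub>1 / (1 + \<tau> t) * (\<integral>\<omega>. (norm (noise_f t \<omega>))\<^sup>2 \<partial>M) \<le> L\<^sub>f\<^sub>1 / (1 + \<tau> t) * \<sigma>\<^sub>f\<^sub>2\<^sup>2"
    using noise_f_moment(2)[OF t] constants weights(2)[OF t] by (intro mult_left_mono) auto
  have g_le: "((\<integral>\<omega>. (norm (noise_g t \<omega>))\<^sup>2 \<partial>M) + 2 * C\<^sub>g\<^sup>2 * D\<^sub>X\<^sup>2) / \<alpha> \<le> (\<sigma>\<^sub>g\<^sup>2 + 2 * C\<^sub>g\<^sup>2 * D\<^sub>X\<^sup>2) / \<alpha>"
    using noise_g_moment(2)[OF t] constants by (intro divide_right_mono) auto
  note parts = smooth(1) noise_f_moment(1)[OF t] dir_f_mean_zero(1)[OF t] dir_g_mean_zero(1)[OF t]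
    dual(1) d noise_g_moment(1)[OF t]
  show "integrable M (remainder t)"
    unfolding remainder_def[abs_def] using parts by simp
  have "(\<integral>\<omega>. remainder t \<omega> \<partial>M) = L\<^sub>f\<^sub>1 / (1 + \<tau> t) * (\<integral>\<omega>. (norm (noise_f t \<omega>))\<^sup>2 \<partial>M)
      + (\<integral>\<omega>. ?d \<omega> \<partial>M) / (2 * \<eta>) + ((\<integral>\<omega>. (norm (noise_g t \<omega>))\<^sup>2 \<partial>M) + 2 * C\<^sub>g\<^sup>2 * D\<^sub>X\<^sup>2) / \<alpha>"
    unfolding remainder_def using parts
    by (simp add: smooth(2) dual(2) dir_f_mean_zero(2)[OF t] dir_g_mean_zero(2)[OF t] prob_space)
  with d_le f_le g_le show "(\<integral>\<omega>. remainder t \<omega> \<partial>M) \<le> L\<^sub>f\<^sub>1 * \<sigma>\<^sub>f\<^sub>2\<^sup>2 / (1 + \<tau> t)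
      + (C\<^sub>f\<^sub>1\<^sup>2 * C\<^sub>f\<^sub>2\<^sup>2 + C\<^sub>g\<^sup>2 * (\<integral>\<omega>. (norm (l t \<omega>))\<^sup>2 \<partial>M)) / \<eta>
      + (\<sigma>\<^sub>g\<^sup>2 + 2 * C\<^sub>g\<^sup>2 * D\<^sub>X\<^sup>2) / \<alpha>" by simp
qed

section \<open>From saddle gap to objective and constraints\<close>

lemma g_mean_le:
  assumes "\<omega> \<in> space M" and v: "v \<in> nonneg_orthant"
  shows "real k * (g ((1 / real k) *\<^sub>R (\<Sum>t<k. x t \<omega>)) \<bullet> v) \<le> (\<Sum>t<k. g (x t \<omega>) \<bullet> v)"
proof (cases "k = 0")
  case False
  have "g ((1 / real k) *\<^sub>R (\<Sum>t<k. x t \<omega>)) $ j \<le> ((1 / real k) *\<^sub>R (\<Sum>t<k. g (x t \<omega>))) $ j" for j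
    using convex_on_sum[OF _ _ convex_g[of j], of "{..<k}" "\<lambda>_. 1 / real k" "\<lambda>t. x t \<omega>"] False
    by (simp add: scaleR_sum_right sum_distrib_left lessThan_empty_iff)
  then have "v \<bullet> g ((1 / real k) *\<^sub>R (\<Sum>t<k. x t \<omega>)) \<le> v \<bullet> ((1 / real k) *\<^sub>R (\<Sum>t<k. g (x t \<omega>)))"
    by (rule inner_nonneg_mono[OF v])
  with False show ?thesis by (simp add: inner_sum_right inner_commute field_simps)
qed simp

text \<open>The choice \<open>v = lopt\<close>: the saddle point property makes the gap nonnegative.\<close>

lemma multiplier_pathwise:
  assumes \<omega>: "\<omega> \<in> space M" and k: "k \<le> N"
  shows "\<alpha> / 2 * (norm (l k \<omega> - lopt))\<^sup>2
    \<le> \<eta> / 2 * (norm (x0 - xopt))\<^sup>2 + \<alpha> / 2 * (norm lopt)\<^sup>2 + (\<Sum>t<k. remainder t \<omega>)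
      + C\<^sub>f\<^sub>1 * norm (\<Sum>t<k. noise_f t \<omega>) + norm lopt * norm (\<Sum>t<k. noise_g t \<omega>)"
proof -
  let ?m = "(1 / real k) *\<^sub>R (\<Sum>t<k. x t \<omega>)"
  have "0 \<le> real k * (F ?m - F xopt) + (\<Sum>t<k. g (x t \<omega>) \<bullet> lopt)"
  proof (cases "k = 0")
    case False
    then have "F xopt \<le> F ?m + lopt \<bullet> g ?m"
      using k by (intro lagrangian_lower_bound mean_in_X[OF \<omega>]) auto
    then have "0 \<le> real k * (F ?m - F xopt + g ?m \<bullet> lopt)" by (simp add: inner_commute)
    with g_mean_le[OF \<omega> lopt, of k] show ?thesis by (simp add: distrib_left)
  qed simp
  with pathwise_gap[OF \<omega> k lopt] show ?thesis by linarith
qed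

lemma objective_pathwise:
  assumes \<omega>: "\<omega> \<in> space M"
  shows "real N * (F ((1 / real N) *\<^sub>R (\<Sum>t<N. x t \<omega>)) - F xopt)
    \<le> \<eta> / 2 * (norm (x0 - xopt))\<^sup>2 + (\<Sum>t<N. remainder t \<omega>) + C\<^sub>f\<^sub>1 * norm (\<Sum>t<N. noise_f t \<omega>)"
proof -
  have "(0 :: real^'m) \<in> nonneg_orthant" by (simp add: nonneg_orthant_def)
  from pathwise_gap[OF \<omega> order_refl this]
  have "real N * (F ((1 / real N) *\<^sub>R (\<Sum>t<N. x t \<omega>)) - F xopt) + \<alpha> / 2 * (norm (l N \<omega>))\<^sup>2
    \<le> \<eta> / 2 * (norm (x0 - xopt))\<^sup>2 + (\<Sum>t<N. remainder t \<omega>) + C\<^sub>f\<^sub>1 * norm (\<Sum>t<N. noise_f t \<omega>)"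
    by simp
  moreover have "0 \<le> \<alpha> / 2 * (norm (l N \<omega>))\<^sup>2" using constants by simp
  ultimately show ?thesis by linarith
qed

text \<open>At the mean iterate the objective can undercut the optimum by at most \<open>norm lopt\<close> times the
  violation. The norm \<open>norm lopt + 1\<close> of \<open>v\<close> leaves exactly the violation.\<close>

lemma constraint_pathwise:
  assumes \<omega>: "\<omega> \<in> space M" and N: "0 < N"
  shows "real N * norm (pos_part (g ((1 / real N) *\<^sub>R (\<Sum>t<N. x t \<omega>))))
    \<le> \<eta> / 2 * (norm (x0 - xopt))\<^sup>2 + \<alpha> / 2 * (norm lopt + 1)\<^sup>2 + (\<Sum>t<N. remainder t \<omega>)
      + C\<^sub>f\<^sub>1 * norm (\<Sum>t<N. noise_f t \<omega>) + (norm lopt + 1) * norm (\<Sum>t<N. noise_g t \<omega>)"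
proof -
  let ?m = "(1 / real N) *\<^sub>R (\<Sum>t<N. x t \<omega>)"
  define p where "p = pos_part (g ?m)"
  define v where "v = ((norm lopt + 1) / norm p) *\<^sub>R p"
  have p: "p \<in> nonneg_orthant" using pos_part_nonneg by (simp add: p_def)
  have pg: "g ?m \<bullet> p = (norm p)\<^sup>2"
    by (simp add: power2_norm_eq_inner p_def inner_vec_def pos_part_def max_def if_distrib cong: if_cong)
  have m: "?m \<in> X" using N by (intro mean_in_X[OF \<omega>]) auto
  have v: "v \<in> nonneg_orthant" using p by (simp add: v_def nonneg_orthant_def)
  have gv: "g ?m \<bullet> v = (norm lopt + 1) * norm p"
    by (cases "p = 0") (simp_all add: v_def pg power2_eq_square)
  have nv: "norm v \<le> norm lopt + 1" by (cases "p = 0") (simp_all add: v_def)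
  have "lopt \<bullet> g ?m \<le> lopt \<bullet> p"
    by (rule inner_nonneg_mono[OF lopt]) (simp add: p_def pos_part_def)
  also have "\<dots> \<le> norm lopt * norm p" by (rule norm_cauchy_schwarz)
  finally have "norm p \<le> (F ?m - F xopt) + g ?m \<bullet> v"
    using lagrangian_lower_bound[OF m] gv by (simp add: algebra_simps)
  then have "real N * norm p \<le> real N * ((F ?m - F xopt) + g ?m \<bullet> v)" by (rule mult_left_mono) simp
  then have "real N * norm p \<le> real N * (F ?m - F xopt) + (\<Sum>t<N. g (x t \<omega>) \<bullet> v)"
    using g_mean_le[OF \<omega> v, of N] by (simp add: distrib_left)
  moreover have "0 \<le> \<alpha> / 2 * (norm (l N \<omega> - v))\<^sup>2" using constants by simp
  moreover have "\<alpha> / 2 * (norm v)\<^sup>2 \<le> \<alpha> / 2 * (norm lopt + 1)\<^sup>2"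
    using constants nv by (intro mult_left_mono power_mono) auto
  moreover have "norm v * norm (\<Sum>t<N. noise_g t \<omega>) \<le> (norm lopt + 1) * norm (\<Sum>t<N. noise_g t \<omega>)"
    using nv by (intro mult_right_mono) auto
  ultimately show ?thesis
    using pathwise_gap[OF \<omega> order_refl v] unfolding p_def by linarith
qed

text \<open>The two means differ by \<open>(x N - x 0) / N\<close>.\<close>

lemma shifted_mean:
  assumes \<omega>: "\<omega> \<in> space M" and N: "0 < N"
  defines "m \<equiv> (1 / real N) *\<^sub>R (\<Sum>t<N. x t \<omega>)" and "m' \<equiv> (1 / real N) *\<^sub>R (\<Sum>t=1..N. x t \<omega>)"
  shows "m \<in> X" "m' \<in> X"
    and "F m' \<le> F m + 2 * C\<^sub>f\<^sub>1 * C\<^sub>f\<^sub>2 * D\<^sub>X / real N"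
    and "norm (pos_part (g m')) \<le> norm (pos_part (g m)) + 4 * C\<^sub>g * D\<^sub>X / real N"
proof -
  show m: "m \<in> X" unfolding m_def using N by (intro mean_in_X[OF \<omega>]) auto
  show m': "m' \<in> X" unfolding m'_def using N by (intro mean_in_X[OF \<omega>]) auto
  have "(\<Sum>t=1..N. x t \<omega>) = (\<Sum>t<N. x (Suc t) \<omega>)" by (simp add: sum.atLeast1_atMost_eq)
  also have "\<dots> = (\<Sum>t<N. x t \<omega>) + (\<Sum>t<N. x (Suc t) \<omega> - x t \<omega>)" by (simp add: sum_subtractf)
  also have "(\<Sum>t<N. x (Suc t) \<omega> - x t \<omega>) = x N \<omega> - x0"
    using sum_lessThan_telescope[of "\<lambda>t. x t \<omega>" N] by (simp add: init[OF \<omega>])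
  finally have "m' - m = (1 / real N) *\<^sub>R (x N \<omega> - x0)"
    by (simp add: m_def m'_def scaleR_add_right)
  then have "norm (m' - m) = norm (x N \<omega> - x0) / real N" by simp
  also have "norm (x N \<omega> - x0) \<le> norm (x N \<omega> - xopt) + norm (x0 - xopt)"
    using norm_triangle_ineq4[of "x N \<omega> - xopt" "x0 - xopt"] by simp
  also have "\<dots> \<le> 2 * D\<^sub>X" using diameter[OF x_in_X[OF \<omega> order_refl]] diameter[OF x0] by linarith
  finally have d: "norm (m' - m) \<le> 2 * D\<^sub>X / real N" by (simp add: divide_right_mono)
  have "F m' - F m \<le> C\<^sub>f\<^sub>1 * C\<^sub>f\<^sub>2 * norm (m' - m)" by (rule F_lipschitz[OF m'])
  also have "\<dots> \<le> C\<^sub>f\<^sub>1 * C\<^sub>f\<^sub>2 * (2 * D\<^sub>X / real N)" using d constants by (intro mult_left_mono) auto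
  finally show "F m' \<le> F m + 2 * C\<^sub>f\<^sub>1 * C\<^sub>f\<^sub>2 * D\<^sub>X / real N" by (simp add: ac_simps)
  have "(norm (g m' - g m))\<^sup>2 \<le> 2 * C\<^sub>g\<^sup>2 * (norm (m' - m))\<^sup>2" by (rule g_lipschitz[OF m' m])
  also have "\<dots> \<le> (2 * C\<^sub>g * norm (m' - m))\<^sup>2" by (simp add: power_mult_distrib mult_right_mono)
  finally have "norm (g m' - g m) \<le> 2 * C\<^sub>g * norm (m' - m)"
    using constants by (intro power2_le_imp_le[of "norm (g m' - g m)"]) auto
  also have "\<dots> \<le> 2 * C\<^sub>g * (2 * D\<^sub>X / real N)" using d constants by (intro mult_left_mono) auto
  finally have gd: "norm (g m' - g m) \<le> 4 * C\<^sub>g * D\<^sub>X / real N" by simp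
  have "norm (pos_part (g m') - pos_part (g m)) \<le> norm (g m' - g m)"
    by (rule norm_le_componentwise_cart) (auto simp: pos_part_def max_def)
  with gd norm_triangle_ineq2[of "pos_part (g m')" "pos_part (g m)"]
  show "norm (pos_part (g m')) \<le> norm (pos_part (g m)) + 4 * C\<^sub>g * D\<^sub>X / real N" by linarith
qed

end

text \<open>The increment of \<open>2 sqrt n\<close> is \<open>2 / (sqrt (n+1) + sqrt n)\<close>, and the denominator is at most \<open>n + 2\<close>.\<close>

lemma sum_inverse_sqrt_le: "(\<Sum>t<n. 1 / (1 + real t / 2)) \<le> 2 * sqrt (real n)"
proof (induction n)
  case (Suc n)
  have "1 / (1 + real n / 2) \<le> 2 * (sqrt (real (Suc n)) - sqrt (real n))"
  proof -
    define a b where "a = sqrt (real (Suc n))" and "b = sqrt (real n)"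
    have ab: "a\<^sup>2 = real n + 1" "b\<^sup>2 = real n" "0 < a" "0 \<le> b" "b \<le> a"
      by (auto simp: a_def b_def)
    have "(a - b) * (a + b) = 1" using ab by (simp add: algebra_simps power2_eq_square)
    then have diff: "a - b = 1 / (a + b)" using ab by (simp add: field_simps)
    have "0 \<le> (a - 1)\<^sup>2" by simp
    then have "a + b \<le> real n + 2" using ab by (simp add: power2_diff)
    then have "2 / (real n + 2) \<le> 2 / (a + b)" using ab by (intro divide_left_mono) auto
    moreover have "1 / (1 + real n / 2) = 2 / (real n + 2)" by (simp add: field_simps)
    ultimately show ?thesis using diff by (simp add: a_def b_def)
  qed
  with Suc show ?case by simp
qed simp

locale ec_scgd_stepsizes = ec_scgd +
  assumes N: "2 \<le> N" and \<alpha>: "\<alpha> = 2 * sqrt (real N)" and \<eta>: "\<eta> = 15 * C\<^sub>g\<^sup>2 * sqrt (real N) / 2"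
    and \<tau>: "\<And>t. t \<le> N \<Longrightarrow> \<tau> t = real t / 2"
begin

text \<open>A bound for the sum of the expected remainders, divided by \<open>sqrt N\<close>, without the contribution of the multipliers.\<close>

definition "drift = 2 * (L\<^sub>f\<^sub>1 * \<sigma>\<^sub>f\<^sub>2\<^sup>2) + 2 / 15 * (C\<^sub>f\<^sub>1\<^sup>2 * C\<^sub>f\<^sub>2\<^sup>2 / C\<^sub>g\<^sup>2) + \<sigma>\<^sub>g\<^sup>2 / 2 + D\<^sub>X\<^sup>2 * C\<^sub>g\<^sup>2"

definition "R = 7 * C\<^sub>f\<^sub>1\<^sup>2 * C\<^sub>f\<^sub>2\<^sup>2 / C\<^sub>g\<^sup>2 + D\<^sub>X\<^sup>2 * C\<^sub>g\<^sup>2 / 2 + 2 * (norm lopt)\<^sup>2 + \<sigma>\<^sub>g\<^sup>2 / 2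
  + L\<^sub>f\<^sub>1 * \<sigma>\<^sub>f\<^sub>2\<^sup>2 + 3 * C\<^sub>f\<^sub>1 * \<sigma>\<^sub>f\<^sub>2 + norm lopt * \<sigma>\<^sub>g
  + 15 * C\<^sub>g\<^sup>2 / 4 * (norm (x0 - xopt))\<^sup>2 + (norm lopt)\<^sup>2"

lemma sqrt_N: "1 \<le> sqrt (real N)" "sqrt (real N) * sqrt (real N) = real N"
  using N by auto

lemma le_sqrt_mult: "0 \<le> r \<Longrightarrow> r \<le> sqrt (real N) * r"
  using mult_right_mono[OF sqrt_N(1), of r] by (simp only: mult_1_left)

lemma divide_by_sqrt: "r \<le> T / sqrt (real N)" if "real N * r \<le> sqrt (real N) * T"
proof -
  have "sqrt (real N) * (sqrt (real N) * r) \<le> sqrt (real N) * T"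
    using that unfolding mult.assoc[symmetric] sqrt_N(2) .
  moreover have pos: "0 < sqrt (real N)" using N by simp
  ultimately have "sqrt (real N) * r \<le> T" by (simp only: mult_le_cancel_left_pos)
  then show ?thesis using pos by (simp add: pos_le_divide_eq mult.commute)
qed

lemma remainder_sum:
  assumes k: "k \<le> N" and B: "\<And>t. t < k \<Longrightarrow> (\<integral>\<omega>. (norm (l t \<omega>))\<^sup>2 \<partial>M) \<le> B" and "0 \<le> B"
  shows "integrable M (\<lambda>\<omega>. \<Sum>t<k. remainder t \<omega>)"
    and "(\<integral>\<omega>. (\<Sum>t<k. remainder t \<omega>) \<partial>M) \<le> sqrt (real N) * (drift + 2 / 15 * B)"
proof -
  let ?s = "sqrt (real N)"
  let ?c = "(C\<^sub>f\<^sub>1\<^sup>2 * C\<^sub>f\<^sub>2\<^sup>2 + C\<^sub>g\<^sup>2 * B) / \<eta> + (\<sigma>\<^sub>g\<^sup>2 + 2 * C\<^sub>g\<^sup>2 * D\<^sub>X\<^sup>2) / \<alpha>"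
  have t: "t < N" if "t < k" for t using that k by simp
  show "integrable M (\<lambda>\<omega>. \<Sum>t<k. remainder t \<omega>)"
    using remainder_expectation(1)[OF t] by (intro Bochner_Integration.integrable_sum) auto
  have "(\<integral>\<omega>. (\<Sum>t<k. remainder t \<omega>) \<partial>M) = (\<Sum>t<k. \<integral>\<omega>. remainder t \<omega> \<partial>M)"
    using remainder_expectation(1)[OF t] by (intro Bochner_Integration.integral_sum) auto
  also have "\<dots> \<le> (\<Sum>t<k. L\<^sub>f\<^sub>1 * \<sigma>\<^sub>f\<^sub>2\<^sup>2 * (1 / (1 + real t / 2)) + ?c)"
  proof (rule sum_mono)
    fix t assume "t \<in> {..<k}"
    then have tk: "t < k" by simp
    have "(C\<^sub>f\<^sub>1\<^sup>2 * C\<^sub>f\<^sub>2\<^sup>2 + C\<^sub>g\<^sup>2 * (\<integral>\<omega>. (norm (l t \<omega>))\<^sup>2 \<partial>M)) / \<eta> \<le> (C\<^sub>f\<^sub>1\<^sup>2 * C\<^sub>f\<^sub>2\<^sup>2 + C\<^sub>g\<^sup>2 * B) / \<eta>"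
      using B[OF tk] constants by (intro divide_right_mono add_left_mono mult_left_mono) auto
    with remainder_expectation(2)[OF t[OF tk]]
    show "(\<integral>\<omega>. remainder t \<omega> \<partial>M) \<le> L\<^sub>f\<^sub>1 * \<sigma>\<^sub>f\<^sub>2\<^sup>2 * (1 / (1 + real t / 2)) + ?c"
      using \<tau>[of t] t[OF tk] by simp
  qed
  also have "\<dots> = L\<^sub>f\<^sub>1 * \<sigma>\<^sub>f\<^sub>2\<^sup>2 * (\<Sum>t<k. 1 / (1 + real t / 2)) + real k * ?c"
    by (simp add: sum.distrib sum_distrib_left)
  also have "\<dots> \<le> L\<^sub>f\<^sub>1 * \<sigma>\<^sub>f\<^sub>2\<^sup>2 * (2 * ?s) + real N * ?c"
  proof (intro add_mono mult_left_mono mult_right_mono)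
    have "(\<Sum>t<k. 1 / (1 + real t / 2)) \<le> 2 * sqrt (real k)" by (rule sum_inverse_sqrt_le)
    also have "\<dots> \<le> 2 * ?s" using k by simp
    finally show "(\<Sum>t<k. 1 / (1 + real t / 2)) \<le> 2 * ?s" .
  qed (use k constants \<open>0 \<le> B\<close> in auto)
  also have "real N * ?c = ?s * (2 / 15 * (C\<^sub>f\<^sub>1\<^sup>2 * C\<^sub>f\<^sub>2\<^sup>2 / C\<^sub>g\<^sup>2) + 2 / 15 * B + (\<sigma>\<^sub>g\<^sup>2 / 2 + D\<^sub>X\<^sup>2 * C\<^sub>g\<^sup>2))"
  proof -
    have "real N * ?c = (?s * ?s) * ?c" using sqrt_N by simp
    also have "\<dots> = ?s * (2 / 15 * (C\<^sub>f\<^sub>1\<^sup>2 * C\<^sub>f\<^sub>2\<^sup>2 / C\<^sub>g\<^sup>2) + 2 / 15 * B + (\<sigma>\<^sub>g\<^sup>2 / 2 + D\<^sub>X\<^sup>2 * C\<^sub>g\<^sup>2))"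
      unfolding \<alpha> \<eta> using constants N by (simp add: field_simps del: real_sqrt_mult_self)
    finally show ?thesis .
  qed
  finally show "(\<integral>\<omega>. (\<Sum>t<k. remainder t \<omega>) \<partial>M) \<le> ?s * (drift + 2 / 15 * B)"
    by (simp add: drift_def algebra_simps)
qed

lemma noise_sums_le:
  assumes "k \<le> N"
  shows "(\<integral>\<omega>. norm (\<Sum>t<k. noise_f t \<omega>) \<partial>M) \<le> \<sigma>\<^sub>f\<^sub>2 * sqrt (real N)"
    and "(\<integral>\<omega>. norm (\<Sum>t<k. noise_g t \<omega>) \<partial>M) \<le> \<sigma>\<^sub>g * sqrt (real N)"
proof -
  have "\<sigma> * sqrt (real k) \<le> \<sigma> * sqrt (real N)" if "0 < \<sigma>" for \<sigma>
    using that assms by simp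
  then show "(\<integral>\<omega>. norm (\<Sum>t<k. noise_f t \<omega>) \<partial>M) \<le> \<sigma>\<^sub>f\<^sub>2 * sqrt (real N)"
    "(\<integral>\<omega>. norm (\<Sum>t<k. noise_g t \<omega>) \<partial>M) \<le> \<sigma>\<^sub>g * sqrt (real N)"
    using noise_sums(2,4)[OF assms] constants by (meson order.trans)+
qed

lemma R_parts:
  "0 \<le> C\<^sub>f\<^sub>1\<^sup>2 * C\<^sub>f\<^sub>2\<^sup>2 / C\<^sub>g\<^sup>2" "0 \<le> D\<^sub>X\<^sup>2 * C\<^sub>g\<^sup>2" "0 \<le> (norm lopt)\<^sup>2" "0 \<le> \<sigma>\<^sub>g\<^sup>2"
  "0 \<le> L\<^sub>f\<^sub>1 * \<sigma>\<^sub>f\<^sub>2\<^sup>2" "0 \<le> C\<^sub>f\<^sub>1 * \<sigma>\<^sub>f\<^sub>2" "0 \<le> norm lopt * \<sigma>\<^sub>g" "0 \<le> C\<^sub>g\<^sup>2 * (norm (x0 - xopt))\<^sup>2"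
  using constants by auto

lemma R_eq: "R = 7 * (C\<^sub>f\<^sub>1\<^sup>2 * C\<^sub>f\<^sub>2\<^sup>2 / C\<^sub>g\<^sup>2) + (D\<^sub>X\<^sup>2 * C\<^sub>g\<^sup>2) / 2 + 3 * (norm lopt)\<^sup>2 + \<sigma>\<^sub>g\<^sup>2 / 2
  + L\<^sub>f\<^sub>1 * \<sigma>\<^sub>f\<^sub>2\<^sup>2 + 3 * (C\<^sub>f\<^sub>1 * \<sigma>\<^sub>f\<^sub>2) + norm lopt * \<sigma>\<^sub>g
  + 15 / 4 * (C\<^sub>g\<^sup>2 * (norm (x0 - xopt))\<^sup>2)"
  by (simp add: R_def)

lemma R_nonneg: "0 \<le> R"
  unfolding R_eq using R_parts by (intro add_nonneg_nonneg) auto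

lemma multiplier_le_R: "3 * (norm lopt)\<^sup>2 \<le> R"
  using R_eq R_parts by linarith

lemma bound_terms:
  "7 * C\<^sub>f\<^sub>1\<^sup>2 * C\<^sub>f\<^sub>2\<^sup>2 / C\<^sub>g\<^sup>2 = 7 * (C\<^sub>f\<^sub>1\<^sup>2 * C\<^sub>f\<^sub>2\<^sup>2 / C\<^sub>g\<^sup>2)"
  "3 * C\<^sub>f\<^sub>1 * \<sigma>\<^sub>f\<^sub>2 = 3 * (C\<^sub>f\<^sub>1 * \<sigma>\<^sub>f\<^sub>2)"
  "15 * C\<^sub>g\<^sup>2 / 4 * (norm (x0 - xopt))\<^sup>2 = 15 / 4 * (C\<^sub>g\<^sup>2 * (norm (x0 - xopt))\<^sup>2)"
  by simp_all

text \<open>If all earlier mean squares are at most \<open>7 R\<close>, they contribute \<open>2 / 15 * (7 * R)\<close>, less than \<open>R\<close>,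
  and the other terms of the bound add up to at most \<open>2 R\<close>. This gives
  \<open>3 R\<close> for the deviation, and \<open>7 R\<close> for the mean square because \<open>R\<close> contains \<open>3 (norm lopt)\<^sup>2\<close>.\<close>

lemma multiplier_deviation:
  "k \<le> N \<Longrightarrow> (\<integral>\<omega>. (norm (l k \<omega> - lopt))\<^sup>2 \<partial>M) \<le> 3 * R
    \<and> (\<integral>\<omega>. (norm (l k \<omega>))\<^sup>2 \<partial>M) \<le> 7 * R"
proof (induction k rule: less_induct)
  case (less k)
  let ?s = "sqrt (real N)" and ?d = "\<lambda>\<omega>. (norm (l k \<omega> - lopt))\<^sup>2"
  let ?Q = "\<lambda>\<omega>. \<eta> / 2 * (norm (x0 - xopt))\<^sup>2 + \<alpha> / 2 * (norm lopt)\<^sup>2 + (\<Sum>t<k. remainder t \<omega>)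
      + C\<^sub>f\<^sub>1 * norm (\<Sum>t<k. noise_f t \<omega>) + norm lopt * norm (\<Sum>t<k. noise_g t \<omega>)"
  note [measurable] = state_random_variable(3)[OF less.prems]
  have B: "(\<integral>\<omega>. (norm (l t \<omega>))\<^sup>2 \<partial>M) \<le> 7 * R" if "t < k" for t
    using less.IH[OF that] that less.prems by simp
  note rem = remainder_sum[OF less.prems B] and ns = noise_sums[OF less.prems] noise_sums_le[OF less.prems]
  have l2: "integrable M (\<lambda>\<omega>. (norm (l k \<omega>))\<^sup>2)" by (rule l_square_integrable[OF less.prems])
  have d: "integrable M ?d"
  proof (rule Bochner_Integration.integrable_bound)
    show "integrable M (\<lambda>\<omega>. 2 * (norm (l k \<omega>))\<^sup>2 + 2 * (norm lopt)\<^sup>2)" using l2 by simp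
    show "AE \<omega> in M. norm (?d \<omega>) \<le> norm (2 * (norm (l k \<omega>))\<^sup>2 + 2 * (norm lopt)\<^sup>2)"
      using norm_add_square_le[of "l k \<omega>" "- lopt" for \<omega>] by (intro AE_I2) simp
  qed measurable
  have Q: "integrable M ?Q" using rem(1) ns R_nonneg by simp
  have "?s * (\<integral>\<omega>. ?d \<omega> \<partial>M) = (\<integral>\<omega>. \<alpha> / 2 * ?d \<omega> \<partial>M)" by (simp add: \<alpha>)
  also have "\<dots> \<le> (\<integral>\<omega>. ?Q \<omega> \<partial>M)"
    using d Q multiplier_pathwise[OF _ less.prems] by (intro integral_mono) auto
  also have "\<dots> = \<eta> / 2 * (norm (x0 - xopt))\<^sup>2 + \<alpha> / 2 * (norm lopt)\<^sup>2 + (\<integral>\<omega>. (\<Sum>t<k. remainder t \<omega>) \<partial>M)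
      + C\<^sub>f\<^sub>1 * (\<integral>\<omega>. norm (\<Sum>t<k. noise_f t \<omega>) \<partial>M) + norm lopt * (\<integral>\<omega>. norm (\<Sum>t<k. noise_g t \<omega>) \<partial>M)"
    using rem(1) ns R_nonneg by (simp add: prob_space)
  also have "\<dots> \<le> \<eta> / 2 * (norm (x0 - xopt))\<^sup>2 + \<alpha> / 2 * (norm lopt)\<^sup>2 + ?s * (drift + 2 / 15 * (7 * R))
      + C\<^sub>f\<^sub>1 * (\<sigma>\<^sub>f\<^sub>2 * ?s) + norm lopt * (\<sigma>\<^sub>g * ?s)"
    using rem(2) ns(5,6) constants R_nonneg by (intro add_mono mult_left_mono) auto
  also have "\<dots> = ?s * (15 / 4 * (C\<^sub>g\<^sup>2 * (norm (x0 - xopt))\<^sup>2) + (norm lopt)\<^sup>2 + drift + 14 / 15 * R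
      + C\<^sub>f\<^sub>1 * \<sigma>\<^sub>f\<^sub>2 + norm lopt * \<sigma>\<^sub>g)"
    by (simp add: \<alpha> \<eta> algebra_simps)
  also have "\<dots> \<le> ?s * (3 * R)"
  proof (rule mult_left_mono)
    (* T stands for R: with its value as a hypothesis the comparison of coefficients is linear *)
    have arith: "15 / 4 * r + n + (2 * l + 2 / 15 * c + s / 2 + d) + 14 / 15 * T + p + q
      \<le> 3 * T"
      if "T = 7 * c + d / 2 + 3 * n + s / 2 + l + 3 * p + q + 15 / 4 * r"
        "0 \<le> c" "0 \<le> d" "0 \<le> n" "0 \<le> s" "0 \<le> l" "0 \<le> p" "0 \<le> q" "0 \<le> r" for T c d n s l p q r :: real
      using that by linarith
    show "15 / 4 * (C\<^sub>g\<^sup>2 * (norm (x0 - xopt))\<^sup>2) + (norm lopt)\<^sup>2 + drift + 14 / 15 * R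
      + C\<^sub>f\<^sub>1 * \<sigma>\<^sub>f\<^sub>2 + norm lopt * \<sigma>\<^sub>g \<le> 3 * R"
      unfolding drift_def by (rule arith[OF R_eq R_parts])
  qed simp
  finally have a: "(\<integral>\<omega>. ?d \<omega> \<partial>M) \<le> 3 * R" using sqrt_N(1) by simp
  have "(\<integral>\<omega>. (norm (l k \<omega>))\<^sup>2 \<partial>M) \<le> (\<integral>\<omega>. 2 * ?d \<omega> + 2 * (norm lopt)\<^sup>2 \<partial>M)"
    using d l2 norm_add_square_le[of "l k \<omega> - lopt" lopt for \<omega>] by (intro integral_mono) auto
  also have "\<dots> = 2 * (\<integral>\<omega>. ?d \<omega> \<partial>M) + 2 * (norm lopt)\<^sup>2" using d by (simp add: prob_space)
  also have "\<dots> \<le> 7 * R" using a multiplier_le_R R_nonneg by linarith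
  finally show ?case using a by simp
qed

definition "xbar \<omega> = (1 / real N) *\<^sub>R (\<Sum>t=1..N. x t \<omega>)"

lemma xbar_in_X: "\<omega> \<in> space M \<Longrightarrow> xbar \<omega> \<in> X"
  unfolding xbar_def using N by (intro shifted_mean) auto

lemma xbar_measurable [measurable]: "xbar \<in> borel_measurable M"
  unfolding xbar_def[abs_def] using state_random_variable(1)
  by (intro borel_measurable_scaleR borel_measurable_sum borel_measurable_const) auto

lemma objective_integrable: "integrable M (\<lambda>\<omega>. F (xbar \<omega>))"
proof (rule integrable_const_bound[of _ "\<bar>F xopt\<bar> + C\<^sub>f\<^sub>1 * C\<^sub>f\<^sub>2 * D\<^sub>X"])
  show "(\<lambda>\<omega>. F (xbar \<omega>)) \<in> borel_measurable M" unfolding F_def by measurable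
  have "\<bar>F (xbar \<omega>)\<bar> \<le> \<bar>F xopt\<bar> + C\<^sub>f\<^sub>1 * C\<^sub>f\<^sub>2 * D\<^sub>X" if "\<omega> \<in> space M" for \<omega>
  proof -
    have X: "xbar \<omega> \<in> X" by (rule xbar_in_X[OF that])
    have "C\<^sub>f\<^sub>1 * C\<^sub>f\<^sub>2 * norm (xbar \<omega> - xopt) \<le> C\<^sub>f\<^sub>1 * C\<^sub>f\<^sub>2 * D\<^sub>X"
      using diameter[OF X] constants by (intro mult_left_mono) auto
    then show ?thesis
      using F_lipschitz[OF X, of xopt] F_lipschitz[OF xopt, of "xbar \<omega>"] by (simp add: norm_minus_commute)
  qed
  then show "AE \<omega> in M. norm (F (xbar \<omega>)) \<le> \<bar>F xopt\<bar> + C\<^sub>f\<^sub>1 * C\<^sub>f\<^sub>2 * D\<^sub>X" by (intro AE_I2) simp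
qed

lemma violation_integrable: "integrable M (\<lambda>\<omega>. norm (pos_part (g (xbar \<omega>))))"
proof (rule integrable_const_bound[of _ "norm (g xopt) + 2 * C\<^sub>g * D\<^sub>X"])
  have "norm (pos_part (g (xbar \<omega>))) \<le> norm (g xopt) + 2 * C\<^sub>g * D\<^sub>X" if "\<omega> \<in> space M" for \<omega>
  proof -
    have X: "xbar \<omega> \<in> X" by (rule xbar_in_X[OF that])
    have "(norm (g (xbar \<omega>) - g xopt))\<^sup>2 \<le> 2 * C\<^sub>g\<^sup>2 * (norm (xbar \<omega> - xopt))\<^sup>2"
      by (rule g_lipschitz[OF X xopt])
    also have "\<dots> \<le> 4 * C\<^sub>g\<^sup>2 * D\<^sub>X\<^sup>2"
      using diameter[OF X] constants by (intro mult_mono power_mono) auto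
    also have "\<dots> = (2 * C\<^sub>g * D\<^sub>X)\<^sup>2" by (simp add: power_mult_distrib)
    finally have "norm (g (xbar \<omega>) - g xopt) \<le> 2 * C\<^sub>g * D\<^sub>X"
      by (rule power2_le_imp_le) (use constants in simp)
    then show ?thesis
      using norm_pos_part_le[of "g (xbar \<omega>)"] norm_triangle_ineq2[of "g (xbar \<omega>)" "g xopt"] by linarith
  qed
  then show "AE \<omega> in M. norm (norm (pos_part (g (xbar \<omega>)))) \<le> norm (g xopt) + 2 * C\<^sub>g * D\<^sub>X"
    by (intro AE_I2) simp
qed measurable

text \<open>The crude bound \<open>e \<ge> 2\<close> suffices.\<close>

lemma R_exp: "4 * R \<le> R * (exp 1)\<^sup>2"
proof -
  have "2 \<le> exp (1::real)" using exp_ge_add_one_self[of 1] by simp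
  then have "2\<^sup>2 \<le> (exp (1::real))\<^sup>2" by (rule power_mono) simp
  then show ?thesis using mult_left_mono[of 4 "(exp 1)\<^sup>2" R] R_nonneg by simp
qed

lemma expected_remainder:
  "integrable M (\<lambda>\<omega>. \<Sum>t<N. remainder t \<omega>)"
  "(\<integral>\<omega>. (\<Sum>t<N. remainder t \<omega>) \<partial>M) \<le> sqrt (real N) * (drift + 2 / 15 * (7 * R))"
  using remainder_sum[OF order_refl, of "7 * R"] multiplier_deviation R_nonneg by simp_all

lemma objective_bound:
  "(\<integral>\<omega>. F (xbar \<omega>) \<partial>M) - F xopt
    \<le> 1 / sqrt (real N) *
      (7 * C\<^sub>f\<^sub>1\<^sup>2 * C\<^sub>f\<^sub>2\<^sup>2 / C\<^sub>g\<^sup>2 + L\<^sub>f\<^sub>1 * \<sigma>\<^sub>f\<^sub>2\<^sup>2 + 3 * C\<^sub>f\<^sub>1 * \<sigma>\<^sub>f\<^sub>2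
       + 15 * C\<^sub>g\<^sup>2 / 4 * (norm (x0 - xopt))\<^sup>2
       + (4 * (norm lopt)\<^sup>2 + 8 * R * (exp 1)\<^sup>2) / 3)" (is "_ \<le> 1 / ?s * ?T")
proof -
  let ?Q = "\<lambda>\<omega>. \<eta> / 2 * (norm (x0 - xopt))\<^sup>2 + (\<Sum>t<N. remainder t \<omega>)
      + C\<^sub>f\<^sub>1 * norm (\<Sum>t<N. noise_f t \<omega>) + (2 * C\<^sub>f\<^sub>1 * C\<^sub>f\<^sub>2 * D\<^sub>X + real N * F xopt)"
  have N0: "0 < N" using N by simp
  have pw: "real N * F (xbar \<omega>) \<le> ?Q \<omega>" if "\<omega> \<in> space M" for \<omega>
  proof -
    have "real N * F (xbar \<omega>) \<le> real N * (F ((1 / real N) *\<^sub>R (\<Sum>t<N. x t \<omega>)) + 2 * C\<^sub>f\<^sub>1 * C\<^sub>f\<^sub>2 * D\<^sub>X / real N)"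
      unfolding xbar_def by (intro mult_left_mono shifted_mean(3)[OF that N0]) simp
    also have "\<dots> = real N * (F ((1 / real N) *\<^sub>R (\<Sum>t<N. x t \<omega>)) - F xopt) + (2 * C\<^sub>f\<^sub>1 * C\<^sub>f\<^sub>2 * D\<^sub>X + real N * F xopt)"
      using N0 by (simp add: distrib_left right_diff_distrib)
    finally show ?thesis using objective_pathwise[OF that] by linarith
  qed
  note ns = noise_sums[OF order_refl] noise_sums_le[OF order_refl]
  have Q: "integrable M ?Q" using expected_remainder(1) ns by simp
  have "real N * (\<integral>\<omega>. F (xbar \<omega>) \<partial>M) = (\<integral>\<omega>. real N * F (xbar \<omega>) \<partial>M)" by simp
  also have "\<dots> \<le> (\<integral>\<omega>. ?Q \<omega> \<partial>M)"
    using objective_integrable Q pw by (intro integral_mono) auto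
  also have "\<dots> = \<eta> / 2 * (norm (x0 - xopt))\<^sup>2 + (\<integral>\<omega>. (\<Sum>t<N. remainder t \<omega>) \<partial>M)
      + C\<^sub>f\<^sub>1 * (\<integral>\<omega>. norm (\<Sum>t<N. noise_f t \<omega>) \<partial>M) + (2 * C\<^sub>f\<^sub>1 * C\<^sub>f\<^sub>2 * D\<^sub>X + real N * F xopt)"
    using expected_remainder(1) ns by (simp add: prob_space)
  also have "\<dots> \<le> \<eta> / 2 * (norm (x0 - xopt))\<^sup>2 + ?s * (drift + 2 / 15 * (7 * R))
      + C\<^sub>f\<^sub>1 * (\<sigma>\<^sub>f\<^sub>2 * ?s) + (?s * (D\<^sub>X\<^sup>2 * C\<^sub>g\<^sup>2 + C\<^sub>f\<^sub>1\<^sup>2 * C\<^sub>f\<^sub>2\<^sup>2 / C\<^sub>g\<^sup>2) + real N * F xopt)"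
  proof (intro add_mono mult_left_mono)
    (* shifting the mean costs a product of constants; AM-GM splits it into terms that occur in R *)
    have "2 * (D\<^sub>X * C\<^sub>g) * (C\<^sub>f\<^sub>1 * C\<^sub>f\<^sub>2 / C\<^sub>g) \<le> (D\<^sub>X * C\<^sub>g)\<^sup>2 + (C\<^sub>f\<^sub>1 * C\<^sub>f\<^sub>2 / C\<^sub>g)\<^sup>2"
      using sum_squares_bound[of "D\<^sub>X * C\<^sub>g" "C\<^sub>f\<^sub>1 * C\<^sub>f\<^sub>2 / C\<^sub>g"] by (simp add: power2_eq_square)
    then have "2 * C\<^sub>f\<^sub>1 * C\<^sub>f\<^sub>2 * D\<^sub>X \<le> D\<^sub>X\<^sup>2 * C\<^sub>g\<^sup>2 + C\<^sub>f\<^sub>1\<^sup>2 * C\<^sub>f\<^sub>2\<^sup>2 / C\<^sub>g\<^sup>2"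
      using constants by (simp add: power_mult_distrib power_divide mult_ac)
    also have "\<dots> \<le> ?s * (D\<^sub>X\<^sup>2 * C\<^sub>g\<^sup>2 + C\<^sub>f\<^sub>1\<^sup>2 * C\<^sub>f\<^sub>2\<^sup>2 / C\<^sub>g\<^sup>2)"
      by (rule le_sqrt_mult) (use R_parts(1,2) in simp)
    finally show "2 * C\<^sub>f\<^sub>1 * C\<^sub>f\<^sub>2 * D\<^sub>X \<le> ?s * (D\<^sub>X\<^sup>2 * C\<^sub>g\<^sup>2 + C\<^sub>f\<^sub>1\<^sup>2 * C\<^sub>f\<^sub>2\<^sup>2 / C\<^sub>g\<^sup>2)" .
  qed (use expected_remainder(2) ns(5) constants in auto)
  also have "\<dots> = ?s * (15 / 4 * (C\<^sub>g\<^sup>2 * (norm (x0 - xopt))\<^sup>2) + drift + 14 / 15 * R + C\<^sub>f\<^sub>1 * \<sigma>\<^sub>f\<^sub>2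
      + D\<^sub>X\<^sup>2 * C\<^sub>g\<^sup>2 + C\<^sub>f\<^sub>1\<^sup>2 * C\<^sub>f\<^sub>2\<^sup>2 / C\<^sub>g\<^sup>2) + real N * F xopt"
    by (simp add: \<eta> algebra_simps)
  also have "\<dots> \<le> ?s * ?T + real N * F xopt"
  proof (intro add_right_mono mult_left_mono)
    have arith: "2 * l + 2 / 15 * c + s / 2 + d + 14 / 15 * T + p + d + c
      \<le> 7 * c + l + 3 * p + 5 * T"
      if "T = 7 * c + d / 2 + 3 * n + s / 2 + l + 3 * p + q + 15 / 4 * r"
        "0 \<le> c" "0 \<le> d" "0 \<le> n" "0 \<le> s" "0 \<le> l" "0 \<le> p" "0 \<le> q" "0 \<le> r" for T c d n s l p q r :: real
      using that by linarith
    have "drift + 14 / 15 * R + C\<^sub>f\<^sub>1 * \<sigma>\<^sub>f\<^sub>2 + D\<^sub>X\<^sup>2 * C\<^sub>g\<^sup>2 + C\<^sub>f\<^sub>1\<^sup>2 * C\<^sub>f\<^sub>2\<^sup>2 / C\<^sub>g\<^sup>2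
      \<le> 7 * (C\<^sub>f\<^sub>1\<^sup>2 * C\<^sub>f\<^sub>2\<^sup>2 / C\<^sub>g\<^sup>2) + L\<^sub>f\<^sub>1 * \<sigma>\<^sub>f\<^sub>2\<^sup>2 + 3 * (C\<^sub>f\<^sub>1 * \<sigma>\<^sub>f\<^sub>2) + 5 * R"
      unfolding drift_def by (rule arith[OF R_eq R_parts])
    moreover have "5 * R \<le> (8 * R * (exp 1)\<^sup>2) / 3" using R_exp R_nonneg by simp
    ultimately show "15 / 4 * (C\<^sub>g\<^sup>2 * (norm (x0 - xopt))\<^sup>2) + drift + 14 / 15 * R + C\<^sub>f\<^sub>1 * \<sigma>\<^sub>f\<^sub>2
      + D\<^sub>X\<^sup>2 * C\<^sub>g\<^sup>2 + C\<^sub>f\<^sub>1\<^sup>2 * C\<^sub>f\<^sub>2\<^sup>2 / C\<^sub>g\<^sup>2 \<le> ?T"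
      unfolding bound_terms add_divide_distrib using R_parts(3) by linarith
  qed simp
  finally have "real N * ((\<integral>\<omega>. F (xbar \<omega>) \<partial>M) - F xopt) \<le> ?s * ?T" by (simp add: right_diff_distrib)
  from divide_by_sqrt[OF this] show ?thesis by simp
qed

lemma constraint_bound:
  "(\<integral>\<omega>. norm (pos_part (g (xbar \<omega>))) \<partial>M)
    \<le> 1 / sqrt (real N) *
      (7 * C\<^sub>f\<^sub>1\<^sup>2 * C\<^sub>f\<^sub>2\<^sup>2 / C\<^sub>g\<^sup>2 + L\<^sub>f\<^sub>1 * \<sigma>\<^sub>f\<^sub>2\<^sup>2 + 3 * C\<^sub>f\<^sub>1 * \<sigma>\<^sub>f\<^sub>2
       + 15 * C\<^sub>g\<^sup>2 / 4 * (norm (x0 - xopt))\<^sup>2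
       + D\<^sub>X\<^sup>2 * C\<^sub>g\<^sup>2 / 2 + \<sigma>\<^sub>g\<^sup>2 / 2)
     + ((2 * (norm lopt)\<^sup>2 + 4 * R * (exp 1)\<^sup>2) + 3 * (norm lopt + 1)\<^sup>2
        + (norm lopt + 1) * \<sigma>\<^sub>g) / sqrt (real N)" (is "_ \<le> 1 / ?s * ?T + ?U / ?s")
proof -
  let ?b = "norm lopt + 1"
  let ?Q = "\<lambda>\<omega>. \<eta> / 2 * (norm (x0 - xopt))\<^sup>2 + \<alpha> / 2 * ?b\<^sup>2 + (\<Sum>t<N. remainder t \<omega>)
      + C\<^sub>f\<^sub>1 * norm (\<Sum>t<N. noise_f t \<omega>) + ?b * norm (\<Sum>t<N. noise_g t \<omega>) + 4 * C\<^sub>g * D\<^sub>X"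
  have N0: "0 < N" using N by simp
  have pw: "real N * norm (pos_part (g (xbar \<omega>))) \<le> ?Q \<omega>" if "\<omega> \<in> space M" for \<omega>
  proof -
    have "real N * norm (pos_part (g (xbar \<omega>)))
        \<le> real N * (norm (pos_part (g ((1 / real N) *\<^sub>R (\<Sum>t<N. x t \<omega>)))) + 4 * C\<^sub>g * D\<^sub>X / real N)"
      unfolding xbar_def by (intro mult_left_mono shifted_mean(4)[OF that N0]) simp
    also have "\<dots> = real N * norm (pos_part (g ((1 / real N) *\<^sub>R (\<Sum>t<N. x t \<omega>)))) + 4 * C\<^sub>g * D\<^sub>X"
      using N0 by (simp add: distrib_left)
    finally show ?thesis using constraint_pathwise[OF that N0] by linarith
  qed
  note ns = noise_sums[OF order_refl] noise_sums_le[OF order_refl]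
  have Q: "integrable M ?Q" using expected_remainder(1) ns by simp
  have "real N * (\<integral>\<omega>. norm (pos_part (g (xbar \<omega>))) \<partial>M) = (\<integral>\<omega>. real N * norm (pos_part (g (xbar \<omega>))) \<partial>M)"
    by simp
  also have "\<dots> \<le> (\<integral>\<omega>. ?Q \<omega> \<partial>M)"
    using violation_integrable Q pw by (intro integral_mono) auto
  also have "\<dots> = \<eta> / 2 * (norm (x0 - xopt))\<^sup>2 + \<alpha> / 2 * ?b\<^sup>2 + (\<integral>\<omega>. (\<Sum>t<N. remainder t \<omega>) \<partial>M)
      + C\<^sub>f\<^sub>1 * (\<integral>\<omega>. norm (\<Sum>t<N. noise_f t \<omega>) \<partial>M) + ?b * (\<integral>\<omega>. norm (\<Sum>t<N. noise_g t \<omega>) \<partial>M) + 4 * C\<^sub>g * D\<^sub>X"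
    using expected_remainder(1) ns by (simp add: prob_space)
  also have "\<dots> \<le> \<eta> / 2 * (norm (x0 - xopt))\<^sup>2 + \<alpha> / 2 * ?b\<^sup>2 + ?s * (drift + 2 / 15 * (7 * R))
      + C\<^sub>f\<^sub>1 * (\<sigma>\<^sub>f\<^sub>2 * ?s) + ?b * (\<sigma>\<^sub>g * ?s) + ?s * (2 + 2 * (D\<^sub>X\<^sup>2 * C\<^sub>g\<^sup>2))"
  proof (intro add_mono mult_left_mono)
    (* AM-GM; the 2 is later paid by two of the three copies of (norm lopt + 1)^2 in the claim *)
    have "4 * C\<^sub>g * D\<^sub>X \<le> 2 + 2 * (D\<^sub>X\<^sup>2 * C\<^sub>g\<^sup>2)"
      using sum_squares_bound[of "D\<^sub>X * C\<^sub>g" 1] by (simp add: power_mult_distrib mult_ac)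
    also have "\<dots> \<le> ?s * (2 + 2 * (D\<^sub>X\<^sup>2 * C\<^sub>g\<^sup>2))"
      by (rule le_sqrt_mult) (use R_parts(2) in simp)
    finally show "4 * C\<^sub>g * D\<^sub>X \<le> ?s * (2 + 2 * (D\<^sub>X\<^sup>2 * C\<^sub>g\<^sup>2))" .
  qed (use expected_remainder(2) ns(5,6) constants in auto)
  also have "\<dots> = ?s * (15 / 4 * (C\<^sub>g\<^sup>2 * (norm (x0 - xopt))\<^sup>2) + ?b\<^sup>2 + drift + 14 / 15 * R + C\<^sub>f\<^sub>1 * \<sigma>\<^sub>f\<^sub>2
      + ?b * \<sigma>\<^sub>g + 2 + 2 * (D\<^sub>X\<^sup>2 * C\<^sub>g\<^sup>2))"
    by (simp add: \<eta> \<alpha> algebra_simps)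
  also have "\<dots> \<le> ?s * (?T + ?U)"
  proof (rule mult_left_mono)
    have arith: "2 * l + 2 / 15 * c + s / 2 + d + 14 / 15 * T + p + 2 * d
      \<le> 7 * c + l + 3 * p + d / 2 + s / 2 + 7 * T"
      if "T = 7 * c + d / 2 + 3 * n + s / 2 + l + 3 * p + q + 15 / 4 * r"
        "0 \<le> c" "0 \<le> d" "0 \<le> n" "0 \<le> s" "0 \<le> l" "0 \<le> p" "0 \<le> q" "0 \<le> r" for T c d n s l p q r :: real
      using that by linarith
    have "drift + 14 / 15 * R + C\<^sub>f\<^sub>1 * \<sigma>\<^sub>f\<^sub>2 + 2 * (D\<^sub>X\<^sup>2 * C\<^sub>g\<^sup>2)
      \<le> 7 * (C\<^sub>f\<^sub>1\<^sup>2 * C\<^sub>f\<^sub>2\<^sup>2 / C\<^sub>g\<^sup>2) + L\<^sub>f\<^sub>1 * \<sigma>\<^sub>f\<^sub>2\<^sup>2 + 3 * (C\<^sub>f\<^sub>1 * \<sigma>\<^sub>f\<^sub>2) + D\<^sub>X\<^sup>2 * C\<^sub>g\<^sup>2 / 2 + \<sigma>\<^sub>g\<^sup>2 / 2 + 7 * R"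
      unfolding drift_def by (rule arith[OF R_eq R_parts])
    moreover have "7 * R \<le> 4 * R * (exp 1)\<^sup>2" using R_exp R_nonneg by simp
    moreover have "2 \<le> 2 * ?b\<^sup>2" by (simp add: one_le_power)
    ultimately show "15 / 4 * (C\<^sub>g\<^sup>2 * (norm (x0 - xopt))\<^sup>2) + ?b\<^sup>2 + drift + 14 / 15 * R + C\<^sub>f\<^sub>1 * \<sigma>\<^sub>f\<^sub>2
      + ?b * \<sigma>\<^sub>g + 2 + 2 * (D\<^sub>X\<^sup>2 * C\<^sub>g\<^sup>2) \<le> ?T + ?U"
      unfolding bound_terms using R_parts(3) by linarith
  qed simp
  finally have "real N * (\<integral>\<omega>. norm (pos_part (g (xbar \<omega>))) \<partial>M) \<le> ?s * (?T + ?U)" .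
  from divide_by_sqrt[OF this] show ?thesis unfolding add_divide_distrib[of ?T] by simp
qed

end

section \<open>The convergence theorem\<close>

theorem theorem2:
  fixes M :: "'w measure"
    and S1 :: "'a measure" and S2 :: "'b measure" and Z :: "'m::finite \<Rightarrow> 'c measure"
    and \<xi>1 :: "'w \<Rightarrow> 'a" and \<xi>2 :: "'w \<Rightarrow> 'b" and \<zeta> :: "'w \<Rightarrow> 'm \<Rightarrow> 'c"
    and X :: "(real^'dx) set"
    and f1 :: "real^'dy \<Rightarrow> real" and f2 :: "real^'dx \<Rightarrow> real^'dy"
    and F :: "real^'dx \<Rightarrow> real" and g :: "real^'dx \<Rightarrow> real^'m"
    and f1s :: "real^'dy \<Rightarrow> 'a \<Rightarrow> real" and f2s :: "real^'dx \<Rightarrow> 'b \<Rightarrow> real^'dy"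
    and gs :: "'m \<Rightarrow> real^'dx \<Rightarrow> 'c \<Rightarrow> real"
    and df1 :: "real^'dy \<Rightarrow> real^'dy"
    and df1s :: "real^'dy \<Rightarrow> 'a \<Rightarrow> real^'dy" and df2s :: "real^'dx \<Rightarrow> 'b \<Rightarrow> real^'dy^'dx"
    and dgs :: "real^'dx \<Rightarrow> ('m \<Rightarrow> 'c) \<Rightarrow> real^'m^'dx"
    and C\<^sub>f\<^sub>1 C\<^sub>f\<^sub>2 \<sigma>\<^sub>f\<^sub>1 \<sigma>\<^sub>f\<^sub>2 L\<^sub>f\<^sub>1 D\<^sub>X C\<^sub>g \<sigma>\<^sub>g R :: real
    and xopt x0 :: "real^'dx" and lopt l0 :: "real^'m"
    and \<alpha> \<eta> \<tau> :: "nat \<Rightarrow> real" and N :: nat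
    and u10 :: "nat \<Rightarrow> 'w \<Rightarrow> 'a" and u20 u21 :: "nat \<Rightarrow> 'w \<Rightarrow> 'b"
    and z0 z1 :: "nat \<Rightarrow> 'w \<Rightarrow> 'm \<Rightarrow> 'c"
    and x :: "nat \<Rightarrow> 'w \<Rightarrow> real^'dx" and y :: "nat \<Rightarrow> 'w \<Rightarrow> real^'dy"
    and l :: "nat \<Rightarrow> 'w \<Rightarrow> real^'m" and xbar :: "'w \<Rightarrow> real^'dx"
  assumes "prob_space M"
    (* the problem *)
    and "independent_triple M S1 S2 (Pi\<^sub>M UNIV Z) \<xi>1 \<xi>2 \<zeta>"
    and "\<And>v. integrable M (\<lambda>\<omega>. f1s v (\<xi>1 \<omega>)) \<and> f1 v = (\<integral>\<omega>. f1s v (\<xi>1 \<omega>) \<partial>M)"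
    and "\<And>w. integrable M (\<lambda>\<omega>. f2s w (\<xi>2 \<omega>)) \<and> f2 w = (\<integral>\<omega>. f2s w (\<xi>2 \<omega>) \<partial>M)"
    and "\<And>j w. integrable M (\<lambda>\<omega>. gs j w (\<zeta> \<omega> j)) \<and> g w $ j = (\<integral>\<omega>. gs j w (\<zeta> \<omega> j) \<partial>M)"
    and "F = (\<lambda>w. f1 (f2 w))"
    and "convex X"
    and "convex_on UNIV f1"
    and "\<And>v. GDERIV f1 v :> df1 v"
    and "\<And>j. convex_on UNIV (\<lambda>w. f2 w $ j)"
    and "\<And>j. convex_on UNIV (\<lambda>w. g w $ j)"
    and "convex_on UNIV F"
    and "saddle_point X F g xopt lopt"
    (* the oracle outputs used by the algorithm are jointly measurable *)
    and "(\<lambda>(v, s). df1s v s) \<in> borel_measurable (borel \<Otimes>\<^sub>M S1)"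
    and "(\<lambda>(w, s). f2s w s) \<in> borel_measurable (borel \<Otimes>\<^sub>M S2)"
    and "(\<lambda>(w, s). df2s w s) \<in> borel_measurable (borel \<Otimes>\<^sub>M S2)"
    and "\<And>j. (\<lambda>(w, s). gs j w s) \<in> borel_measurable (borel \<Otimes>\<^sub>M Z j)"
    and "(\<lambda>(w, s). dgs w s) \<in> borel_measurable (borel \<Otimes>\<^sub>M Pi\<^sub>M UNIV Z)"
    (* constants *)
    and "0 < C\<^sub>f\<^sub>1" "0 < C\<^sub>f\<^sub>2" "0 < \<sigma>\<^sub>f\<^sub>1" "0 < \<sigma>\<^sub>f\<^sub>2" "0 < L\<^sub>f\<^sub>1" "0 < D\<^sub>X" "0 < C\<^sub>g" "0 < \<sigma>\<^sub>g"
    (* assumptions on the objective *)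
    and "bounded X" and "(SUP w\<in>X. norm (w - xopt)) \<le> D\<^sub>X"
    and "\<And>v. is_max_value (\<lambda>\<pi>. \<pi> \<bullet> v - fenchel_conjugate f1 \<pi>) (fenchel_domain f1) (f1 v)"
    and "\<And>w j. w \<in> X \<Longrightarrow>
           is_max_value (\<lambda>A. (transpose A *v w - fenchel_conjugate_vec f2 A) $ j)
             (fenchel_domain_matrices f2) (f2 w $ j)"
    and "L\<^sub>f\<^sub>1-lipschitz_on UNIV df1"
    and "\<And>w. w \<in> X \<Longrightarrow>
           integrable M (\<lambda>\<omega>. (norm (f2s w (\<xi>2 \<omega>) - f2 w))\<^sup>2) \<and>
           (\<integral>\<omega>. (norm (f2s w (\<xi>2 \<omega>) - f2 w))\<^sup>2 \<partial>M) = \<sigma>\<^sub>f\<^sub>2\<^sup>2"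
    and "\<And>v. integrable M (\<lambda>\<omega>. (f1s v (\<xi>1 \<omega>) - f1 v)\<^sup>2) \<and>
           (\<integral>\<omega>. (f1s v (\<xi>1 \<omega>) - f1 v)\<^sup>2 \<partial>M) = \<sigma>\<^sub>f\<^sub>1\<^sup>2"
    and "\<And>w. w \<in> X \<Longrightarrow>
           integrable M (\<lambda>\<omega>. df2s w (\<xi>2 \<omega>)) \<and>
           (\<integral>\<omega>. df2s w (\<xi>2 \<omega>) \<partial>M) \<in> subgradient_matrices f2 w \<and>
           integrable M (\<lambda>\<omega>. (norm (df2s w (\<xi>2 \<omega>)))\<^sup>2) \<and>
           (\<integral>\<omega>. (norm (df2s w (\<xi>2 \<omega>)))\<^sup>2 \<partial>M) \<le> C\<^sub>f\<^sub>2\<^sup>2"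
    and "\<And>v. integrable M (\<lambda>\<omega>. df1s v (\<xi>1 \<omega>)) \<and>
           (\<integral>\<omega>. df1s v (\<xi>1 \<omega>) \<partial>M) = df1 v \<and>
           integrable M (\<lambda>\<omega>. (norm (df1s v (\<xi>1 \<omega>)))\<^sup>2) \<and>
           (\<integral>\<omega>. (norm (df1s v (\<xi>1 \<omega>)))\<^sup>2 \<partial>M) \<le> C\<^sub>f\<^sub>1\<^sup>2"
    (* assumptions on the constraints *)
    and "\<And>w j. w \<in> X \<Longrightarrow>
           is_max_value (\<lambda>v. w \<bullet> v - fenchel_conjugate (\<lambda>u. g u $ j) v)
             (fenchel_domain (\<lambda>u. g u $ j)) (g w $ j)"
    and "\<And>w. w \<in> X \<Longrightarrow>
           integrable M (\<lambda>\<omega>. (norm (sampled_constraints gs w (\<zeta> \<omega>) - g w))\<^sup>2) \<and>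
           (\<integral>\<omega>. (norm (sampled_constraints gs w (\<zeta> \<omega>) - g w))\<^sup>2 \<partial>M) \<le> \<sigma>\<^sub>g\<^sup>2"
    and "\<And>w. w \<in> X \<Longrightarrow>
           integrable M (\<lambda>\<omega>. dgs w (\<zeta> \<omega>)) \<and>
           (\<integral>\<omega>. dgs w (\<zeta> \<omega>) \<partial>M) \<in> subgradient_matrices g w \<and>
           integrable M (\<lambda>\<omega>. (norm (dgs w (\<zeta> \<omega>)))\<^sup>2) \<and>
           (\<integral>\<omega>. (norm (dgs w (\<zeta> \<omega>)))\<^sup>2 \<partial>M) \<le> C\<^sub>g\<^sup>2"
    (* monotonicity *)
    and "\<not> affine_map f2 \<Longrightarrow> (\<forall>v. df1 v \<in> nonneg_orthant)"
    (* the run of the algorithm *)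
    and "independent_samples M S1 S2 (Pi\<^sub>M UNIV Z) \<xi>1 \<xi>2 \<zeta> N u10 u20 u21 z0 z1"
    and "x0 \<in> X" and "l0 = 0" and "2 \<le> N"
    and "\<And>t. t \<le> N \<Longrightarrow> \<tau> t = real t / 2"
    and "\<And>t. t \<le> N \<Longrightarrow> \<alpha> t = 2 * sqrt (real N)"
    and "\<And>t. t \<le> N \<Longrightarrow> \<eta> t = 15 * C\<^sub>g\<^sup>2 * sqrt (real N) / 2"
    and "\<And>\<omega>. \<omega> \<in> space M \<Longrightarrow>
           ec_scgd_run X f2s df2s df1s gs dgs \<alpha> \<eta> \<tau> N x0 l0
             (\<lambda>t. u10 t \<omega>) (\<lambda>t. u20 t \<omega>) (\<lambda>t. u21 t \<omega>) (\<lambda>t. z0 t \<omega>) (\<lambda>t. z1 t \<omega>)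
             (\<lambda>t. x t \<omega>) (\<lambda>t. y t \<omega>) (\<lambda>t. l t \<omega>)"
    and "xbar = (\<lambda>\<omega>. (1 / real N) *\<^sub>R (\<Sum>t=1..N. x t \<omega>))"
    and "R = 7 * C\<^sub>f\<^sub>1\<^sup>2 * C\<^sub>f\<^sub>2\<^sup>2 / C\<^sub>g\<^sup>2 + D\<^sub>X\<^sup>2 * C\<^sub>g\<^sup>2 / 2 + 2 * (norm lopt)\<^sup>2 + \<sigma>\<^sub>g\<^sup>2 / 2
             + L\<^sub>f\<^sub>1 * \<sigma>\<^sub>f\<^sub>2\<^sup>2 + 3 * C\<^sub>f\<^sub>1 * \<sigma>\<^sub>f\<^sub>2 + norm lopt * \<sigma>\<^sub>g
             + 15 * C\<^sub>g\<^sup>2 / 4 * (norm (x0 - xopt))\<^sup>2 + (norm (l0 - lopt))\<^sup>2"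
  shows "integrable M (\<lambda>\<omega>. F (xbar \<omega>)) \<and>
         (\<integral>\<omega>. F (xbar \<omega>) \<partial>M) - F xopt
           \<le> 1 / sqrt (real N) *
              (7 * C\<^sub>f\<^sub>1\<^sup>2 * C\<^sub>f\<^sub>2\<^sup>2 / C\<^sub>g\<^sup>2 + L\<^sub>f\<^sub>1 * \<sigma>\<^sub>f\<^sub>2\<^sup>2 + 3 * C\<^sub>f\<^sub>1 * \<sigma>\<^sub>f\<^sub>2
               + 15 * C\<^sub>g\<^sup>2 / 4 * (norm (x0 - xopt))\<^sup>2
               + (4 * (norm lopt)\<^sup>2 + 8 * R * (exp 1)\<^sup>2) / 3) \<and>
         integrable M (\<lambda>\<omega>. norm (pos_part (g (xbar \<omega>)))) \<and>
         (\<integral>\<omega>. norm (pos_part (g (xbar \<omega>))) \<partial>M)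
           \<le> 1 / sqrt (real N) *
              (7 * C\<^sub>f\<^sub>1\<^sup>2 * C\<^sub>f\<^sub>2\<^sup>2 / C\<^sub>g\<^sup>2 + L\<^sub>f\<^sub>1 * \<sigma>\<^sub>f\<^sub>2\<^sup>2 + 3 * C\<^sub>f\<^sub>1 * \<sigma>\<^sub>f\<^sub>2
               + 15 * C\<^sub>g\<^sup>2 / 4 * (norm (x0 - xopt))\<^sup>2
               + D\<^sub>X\<^sup>2 * C\<^sub>g\<^sup>2 / 2 + \<sigma>\<^sub>g\<^sup>2 / 2)
             + ((2 * (norm lopt)\<^sup>2 + 4 * R * (exp 1)\<^sup>2) + 3 * (norm lopt + 1)\<^sup>2
                + (norm lopt + 1) * \<sigma>\<^sub>g) / sqrt (real N)"
proof -
  interpret prob_space M by (rule assms(1))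
  have sources: "\<xi>1 \<in> measurable M S1" "\<xi>2 \<in> measurable M S2" "\<zeta> \<in> measurable M (Pi\<^sub>M UNIV Z)"
    using assms(2) by (auto simp: independent_triple_def)
  have diameter: "norm (w - xopt) \<le> D\<^sub>X" if "w \<in> X" for w
  proof -
    have "bounded ((\<lambda>w. w - xopt) ` X)" using assms(27) by (rule bounded_translation_minus)
    then have "bdd_above ((\<lambda>w. norm (w - xopt)) ` X)"
      by (auto simp: bounded_iff bdd_above_def)
    with that have "norm (w - xopt) \<le> (SUP w\<in>X. norm (w - xopt))" by (rule cSUP_upper)
    with assms(28) show ?thesis by linarith
  qed
  have continuous: "continuous_on UNIV f1" "continuous_on UNIV f2" "continuous_on UNIV g"
    using assms(8,10,11)
    by (auto intro: convex_on_continuous continuous_on_vec_lambda[of UNIV "\<lambda>j w. f2 w $ j", simplified]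
        continuous_on_vec_lambda[of UNIV "\<lambda>j w. g w $ j", simplified])
  have oracle_means: "integrable M (\<lambda>\<omega>. f2s w (\<xi>2 \<omega>)) \<and> f2 w = (\<integral>\<omega>. f2s w (\<xi>2 \<omega>) \<partial>M)"
    "integrable M (\<lambda>\<omega>. gs j w (\<zeta> \<omega> j)) \<and> g w $ j = (\<integral>\<omega>. gs j w (\<zeta> \<omega> j) \<partial>M)" if "w \<in> X" for w j
    by (rule assms(4), rule assms(5))
  have f2_variance: "integrable M (\<lambda>\<omega>. (norm (f2s w (\<xi>2 \<omega>) - f2 w))\<^sup>2) \<and>
      (\<integral>\<omega>. (norm (f2s w (\<xi>2 \<omega>) - f2 w))\<^sup>2 \<partial>M) \<le> \<sigma>\<^sub>f\<^sub>2\<^sup>2" if "w \<in> X" for w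
    using assms(32)[OF that] by simp
  have steps: "0 < 2 * sqrt (real N)" "0 < 15 * C\<^sub>g\<^sup>2 * sqrt (real N) / 2"
    using assms(25,43) by simp_all
  have weights: "\<tau> 0 = 0" "\<And>t. t < N \<Longrightarrow> 0 \<le> \<tau> t" "\<And>t. Suc t < N \<Longrightarrow> \<tau> (Suc t) \<le> 1 + \<tau> t"
  proof -
    show "\<tau> 0 = 0" using assms(44)[of 0] by simp
    show "0 \<le> \<tau> t" if "t < N" for t using assms(44)[of t] that by simp
    show "\<tau> (Suc t) \<le> 1 + \<tau> t" if "Suc t < N" for t
      using assms(44)[of t] assms(44)[of "Suc t"] that by simp
  qed
  have saddle: "saddle_point X (\<lambda>w. f1 (f2 w)) g xopt lopt" using assms(13) unfolding assms(6) .
  have monotone: "affine_map f2 \<or> (\<forall>v. df1 v \<in> nonneg_orthant)" using assms(39) by blast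
  have run: "ec_scgd_run X f2s df2s df1s gs dgs (\<lambda>_. 2 * sqrt (real N)) (\<lambda>_. 15 * C\<^sub>g\<^sup>2 * sqrt (real N) / 2)
      \<tau> N x0 0 (\<lambda>t. u10 t \<omega>) (\<lambda>t. u20 t \<omega>) (\<lambda>t. u21 t \<omega>) (\<lambda>t. z0 t \<omega>) (\<lambda>t. z1 t \<omega>)
      (\<lambda>t. x t \<omega>) (\<lambda>t. y t \<omega>) (\<lambda>t. l t \<omega>)" if "\<omega> \<in> space M" for \<omega>
  proof -
    have "ec_scgd_run X f2s df2s df1s gs dgs (\<lambda>_. 2 * sqrt (real N)) (\<lambda>_. 15 * C\<^sub>g\<^sup>2 * sqrt (real N) / 2)
      \<tau> N x0 0 (\<lambda>t. u10 t \<omega>) (\<lambda>t. u20 t \<omega>) (\<lambda>t. u21 t \<omega>) (\<lambda>t. z0 t \<omega>) (\<lambda>t. z1 t \<omega>)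
      (\<lambda>t. x t \<omega>) (\<lambda>t. y t \<omega>) (\<lambda>t. l t \<omega>)
      \<longleftrightarrow> ec_scgd_run X f2s df2s df1s gs dgs \<alpha> \<eta> \<tau> N x0 l0 (\<lambda>t. u10 t \<omega>) (\<lambda>t. u20 t \<omega>) (\<lambda>t. u21 t \<omega>) (\<lambda>t. z0 t \<omega>) (\<lambda>t. z1 t \<omega>)
      (\<lambda>t. x t \<omega>) (\<lambda>t. y t \<omega>) (\<lambda>t. l t \<omega>)"
      by (simp only: ec_scgd_run_def assms(42,45,46) less_imp_le cong: imp_cong)
    with assms(47)[OF that] show ?thesis by blast
  qed
  note facts = oracle_means assms(7,11,14-18,19-26,31,34,35,37,38,40,41,43,44) sources diameter continuous
    gradient_inequality[OF assms(8,9)] f2_variance steps weights saddle monotone run refl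
  interpret alg: ec_scgd_stepsizes M S1 S2 Z \<xi>1 \<xi>2 \<zeta> X f1 f2 g f2s gs df1 df1s df2s dgs
    C\<^sub>f\<^sub>1 C\<^sub>f\<^sub>2 \<sigma>\<^sub>f\<^sub>2 L\<^sub>f\<^sub>1 D\<^sub>X C\<^sub>g \<sigma>\<^sub>g xopt x0 lopt "2 * sqrt (real N)" "15 * C\<^sub>g\<^sup>2 * sqrt (real N) / 2"
    \<tau> N u10 u20 u21 z0 z1 x y l
    by unfold_locales (fact facts)+
  have F: "alg.F = F" using assms(6) by (simp add: alg.F_def[abs_def])
  have xbar: "alg.xbar = xbar" using assms(48) by (simp add: alg.xbar_def[abs_def])
  have R: "alg.R = R" using assms(49,42) by (simp add: alg.R_def)
  show ?thesis
    using alg.objective_integrable alg.objective_bound alg.violation_integrable alg.constraint_bound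
    unfolding F xbar R by blast
qed

end
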